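(* Let $n\ge2$ and $\chi>0$. Let $\mathbb H^n_{h,\chi}=\{x\in\mathbb H^n:V_h(x)\le\chi\}$, where $V_h=V_{(0)}-V_{(1)}$, with boundary $\Sigma_{h,\chi}$. Then $(\mathbb H^n_{h,\chi},b,\Sigma_{h,\chi})$ is a static manifold with boundary, whose boundary $\Sigma_{h,\chi}$ is a horosphere, with cosmological constants $(\widetilde\Lambda,\widetilde\lambda)=\left(-\tfrac{n(n-1)}2,\,n-1\right)$, and the corresponding space of static potentials (together with $0$) $\mathcal N^\chi_{b,h}$ has dimension $n$ and is generated by $V_h,V_{(2)},\dots,V_{(n)}$.
   Context: Hyperboloid model: $\mathbb H^n=\{x\in\mathbb R^{1,n}:-x_0^2+x_1^2+\dots+x_n^2=-1,\ x_0>0\}$ with induced Riemannian metric $b$; $V_{(i)}=x_i|_{\mathbb H^n}$, $i=0,\dots,n$. Static manifold with boundary: a triple $(M^n,g,\Sigma)$, $\Sigma=\partial M$, is a static manifold with boundary with cosmological constants $(\widetilde\Lambda,\widetilde\lambda)$ if, with $\Lambda=\frac2{n-1}\widetilde\Lambda$ and $\lambda=\frac1{n-1}\widetilde\lambda$, there is a function $V\not\equiv0$ on $M$ (a static potential) with $$\nabla_g^2V+\Lambda Vg-V\,\mathrm{Ric}_g=0,\qquad\Delta_gV+\Lambda V=0\quad\text{in }M,$$ $$\pi_g-\lambda\,g|_\Sigma=0,\qquad\frac{\partial V}{\partial\eta}-\lambda V=0\quad\text{along }\Sigma,$$ where $\eta$ is the outward unit normal and $\pi_g(X,Y)=g(\nabla_X\eta,Y)$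 is the second fundamental form. *)

theory Defs
  imports "HOL-Analysis.Analysis" "HOL-Library.Function_Algebras"
begin

section \<open>Smooth maps and embedded manifolds with boundary\<close>

text \<open>\<open>diff_times k f U\<close>: for open \<open>U\<close>, the map \<open>f\<close> is of class \<open>C^k\<close> on \<open>U\<close>.\<close>

primrec diff_times ::
    "nat \<Rightarrow> ('a::real_normed_vector \<Rightarrow> 'b::real_normed_vector) \<Rightarrow> 'a set \<Rightarrow> bool" where
  "diff_times 0 = (\<lambda>f U. continuous_on U f)"
| "diff_times (Suc k) = (\<lambda>f U. (\<forall>x\<in>U. f differentiable at x) \<and>
      (\<forall>v. diff_times k (\<lambda>x. frechet_derivative f (at x) v) U))"

definition smooth_on :: "'a set \<Rightarrow> ('a::real_normed_vector \<Rightarrow> 'b::real_normed_vector) \<Rightarrow> bool" where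
  "smooth_on U f \<longleftrightarrow> (\<forall>k. diff_times k f U)"

text \<open>A map on an arbitrary subset of Euclidean space is smooth if it has local smooth
  extensions; in particular, smooth maps on a manifold with boundary are smooth up to the
  boundary.\<close>

definition smooth_map :: "'a set \<Rightarrow> ('a::real_normed_vector \<Rightarrow> 'b::real_normed_vector) \<Rightarrow> bool" where
  "smooth_map M f \<longleftrightarrow>
     (\<forall>p\<in>M. \<exists>U F. open U \<and> p \<in> U \<and> smooth_on U F \<and> (\<forall>q\<in>U \<inter> M. F q = f q))"

definition diffeo_on :: "'a set \<Rightarrow> ('a::euclidean_space \<Rightarrow> 'a) \<Rightarrow> bool" where
  "diffeo_on U \<psi> \<longleftrightarrow> open U \<and> open (\<psi> ` U) \<and> inj_on \<psi> U \<and>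
     smooth_on U \<psi> \<and> smooth_on (\<psi> ` U) (inv_into U \<psi>)"

text \<open>Manifolds with boundary are embedded in a Euclidean space and given by slice charts,
  onto an open part of an \<open>n\<close>-dimensional linear subspace \<open>L\<close> or of a closed half-space of
  \<open>L\<close>. The metric \<open>g\<close> below is arbitrary: the Euclidean structure of the ambient space enters
  only through its smooth structure.\<close>

definition interior_point :: "nat \<Rightarrow> 'a::euclidean_space set \<Rightarrow> 'a \<Rightarrow> bool" where
  "interior_point n M p \<longleftrightarrow> (\<exists>U \<psi> L. p \<in> U \<and> diffeo_on U \<psi> \<and> subspace L \<and> dim L = n \<and>
     \<psi> ` (U \<inter> M) = \<psi> ` U \<inter> L)"

definition boundary_point :: "nat \<Rightarrow> 'a::euclidean_space set \<Rightarrow> 'a \<Rightarrow> bool" where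
  "boundary_point n M p \<longleftrightarrow> (\<exists>U \<psi> L e. p \<in> U \<and> diffeo_on U \<psi> \<and> subspace L \<and> dim L = n \<and>
     e \<in> L \<and> e \<noteq> 0 \<and> \<psi> p \<bullet> e = 0 \<and> \<psi> ` (U \<inter> M) = \<psi> ` U \<inter> {z \<in> L. z \<bullet> e \<ge> 0})"

definition manifold_with_boundary :: "nat \<Rightarrow> 'a::euclidean_space set \<Rightarrow> bool" where
  "manifold_with_boundary n M \<longleftrightarrow> (\<forall>p\<in>M. interior_point n M p \<or> boundary_point n M p)"

definition mfd_boundary :: "nat \<Rightarrow> 'a::euclidean_space set \<Rightarrow> 'a set" where
  "mfd_boundary n M = {p \<in> M. boundary_point n M p}"

section \<open>Tangent vectors and vector fields\<close>

text \<open>The one-sided velocities at \<open>p\<close> of curves in \<open>M\<close> starting at \<open>p\<close>. At a boundary point they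
  are the tangent vectors that do not point out of \<open>M\<close>, a closed half-space of the tangent
  space; hence the span in the definition of the latter.\<close>

definition tangent_cone :: "'a::euclidean_space set \<Rightarrow> 'a \<Rightarrow> 'a set" where
  "tangent_cone M p = {v. \<exists>\<gamma>. \<gamma> 0 = p \<and> (\<forall>t\<in>{0..1::real}. \<gamma> t \<in> M) \<and>
     (\<gamma> has_vector_derivative v) (at 0 within {0..1})}"

definition tangent_space :: "'a::euclidean_space set \<Rightarrow> 'a \<Rightarrow> 'a set" where
  "tangent_space M p = span (tangent_cone M p)"

text \<open>The derivative of \<open>f\<close> (a function or a vector-valued map on \<open>M\<close>) at \<open>p \<in> M\<close> in the direction
  of \<open>v\<close>. The derivative within \<open>M\<close> is not unique as a linear map on the ambient space, but its
  values on vectors \<open>v\<close> tangent to \<open>M\<close> are, and only these are used.\<close>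

definition dir_deriv ::
    "'a::euclidean_space set \<Rightarrow> ('a \<Rightarrow> 'b::real_normed_vector) \<Rightarrow> 'a \<Rightarrow> 'a \<Rightarrow> 'b" where
  "dir_deriv M f p v = frechet_derivative f (at p within M) v"

definition vector_fields :: "'a::euclidean_space set \<Rightarrow> ('a \<Rightarrow> 'a) set" where
  "vector_fields M = {X. smooth_map M X \<and> (\<forall>p\<in>M. X p \<in> tangent_space M p)}"

definition lie_bracket ::
    "'a::euclidean_space set \<Rightarrow> ('a \<Rightarrow> 'a) \<Rightarrow> ('a \<Rightarrow> 'a) \<Rightarrow> 'a \<Rightarrow> 'a" where
  "lie_bracket M X Y p = dir_deriv M Y p (X p) - dir_deriv M X p (Y p)"

text \<open>Some vector field with prescribed value \<open>v\<close> at \<open>p\<close>. It is used only to evaluate tensorial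
  expressions, whose values at \<open>p\<close> do not depend on the extension.\<close>

definition field_ext :: "'a::euclidean_space set \<Rightarrow> 'a \<Rightarrow> 'a \<Rightarrow> 'a \<Rightarrow> 'a" where
  "field_ext M p v = (SOME X. X \<in> vector_fields M \<and> X p = v)"

section \<open>Riemannian geometry\<close>

type_synonym 'a metric = "'a \<Rightarrow> 'a \<Rightarrow> 'a \<Rightarrow> real"

definition riemannian_metric :: "'a::euclidean_space set \<Rightarrow> 'a metric \<Rightarrow> bool" where
  "riemannian_metric M g \<longleftrightarrow>
     (\<forall>p\<in>M. \<forall>u\<in>tangent_space M p. \<forall>v\<in>tangent_space M p. \<forall>w\<in>tangent_space M p. \<forall>c.
        g p u v = g p v u \<and> g p (u + v) w = g p u w + g p v w \<and> g p (c *\<^sub>R u) v = c * g p u v) \<and>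
     (\<forall>p\<in>M. \<forall>u\<in>tangent_space M p. u \<noteq> 0 \<longrightarrow> g p u u > 0) \<and>
     (\<forall>X\<in>vector_fields M. \<forall>Y\<in>vector_fields M. smooth_map M (\<lambda>p. g p (X p) (Y p)))"

definition is_levi_civita ::
    "'a::euclidean_space set \<Rightarrow> 'a metric \<Rightarrow> (('a \<Rightarrow> 'a) \<Rightarrow> ('a \<Rightarrow> 'a) \<Rightarrow> 'a \<Rightarrow> 'a) \<Rightarrow> bool" where
  "is_levi_civita M g D \<longleftrightarrow>
     (\<forall>X\<in>vector_fields M. \<forall>Y\<in>vector_fields M.
        D X Y \<in> vector_fields M \<and>
        (\<forall>Z\<in>vector_fields M. \<forall>p\<in>M.
           D (\<lambda>q. X q + Z q) Y p = D X Y p + D Z Y p \<and>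
           D X (\<lambda>q. Y q + Z q) p = D X Y p + D X Z p) \<and>
        (\<forall>f. smooth_map M f \<longrightarrow> (\<forall>p\<in>M.
           D (\<lambda>q. f q *\<^sub>R X q) Y p = f p *\<^sub>R D X Y p \<and>
           D X (\<lambda>q. f q *\<^sub>R Y q) p = dir_deriv M f p (X p) *\<^sub>R Y p + f p *\<^sub>R D X Y p)) \<and>
        (\<forall>p\<in>M. D X Y p - D Y X p = lie_bracket M X Y p) \<and>
        (\<forall>Z\<in>vector_fields M. \<forall>p\<in>M.
           dir_deriv M (\<lambda>q. g q (Y q) (Z q)) p (X p) = g p (D X Y p) (Z p) + g p (Y p) (D X Z p)))"

text \<open>On vector fields, the Levi-Civita connection is unique up to values outside \<open>M\<close>.\<close>

definition levi_civita ::
    "'a::euclidean_space set \<Rightarrow> 'a metric \<Rightarrow> ('a \<Rightarrow> 'a) \<Rightarrow> ('a \<Rightarrow> 'a) \<Rightarrow> 'a \<Rightarrow> 'a" where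
  "levi_civita M g = (SOME D. is_levi_civita M g D)"

definition orthonormal_basis :: "'a::euclidean_space set \<Rightarrow> 'a metric \<Rightarrow> 'a \<Rightarrow> 'a set \<Rightarrow> bool" where
  "orthonormal_basis M g p B \<longleftrightarrow> finite B \<and> span B = tangent_space M p \<and>
     (\<forall>u\<in>B. \<forall>v\<in>B. g p u v = (if u = v then 1 else 0))"

text \<open>The trace with respect to \<open>g\<close> of a bilinear form on the tangent space at \<open>p\<close>.\<close>

definition metric_trace ::
    "'a::euclidean_space set \<Rightarrow> 'a metric \<Rightarrow> 'a \<Rightarrow> ('a \<Rightarrow> 'a \<Rightarrow> real) \<Rightarrow> real" where
  "metric_trace M g p \<beta> = (\<Sum>e\<in>(SOME B. orthonormal_basis M g p B). \<beta> e e)"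

definition riemann_curvature ::
    "'a::euclidean_space set \<Rightarrow> 'a metric \<Rightarrow> 'a \<Rightarrow> 'a \<Rightarrow> 'a \<Rightarrow> 'a \<Rightarrow> 'a" where
  "riemann_curvature M g p u v w =
     (let D = levi_civita M g; X = field_ext M p u; Y = field_ext M p v; Z = field_ext M p w
      in D X (D Y Z) p - D Y (D X Z) p - D (lie_bracket M X Y) Z p)"

text \<open>\<open>Ric(v,w)\<close> is the trace of \<open>u \<mapsto> R(u,v)w\<close>; it is positive on round spheres.\<close>

definition ricci :: "'a::euclidean_space set \<Rightarrow> 'a metric \<Rightarrow> 'a \<Rightarrow> 'a \<Rightarrow> 'a \<Rightarrow> real" where
  "ricci M g p v w = metric_trace M g p (\<lambda>u u'. g p (riemann_curvature M g p u v w) u')"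

text \<open>\<open>(Hess V)(X,Y) = X(Y V) - (\<nabla>\<^sub>X Y) V\<close>.\<close>

definition hessian ::
    "'a::euclidean_space set \<Rightarrow> 'a metric \<Rightarrow> ('a \<Rightarrow> real) \<Rightarrow> 'a \<Rightarrow> 'a \<Rightarrow> 'a \<Rightarrow> real" where
  "hessian M g V p u v =
     (let X = field_ext M p u; Y = field_ext M p v
      in dir_deriv M (\<lambda>q. dir_deriv M V q (Y q)) p (X p) - dir_deriv M V p (levi_civita M g X Y p))"

definition laplacian :: "'a::euclidean_space set \<Rightarrow> 'a metric \<Rightarrow> ('a \<Rightarrow> real) \<Rightarrow> 'a \<Rightarrow> real" where
  "laplacian M g V p = metric_trace M g p (hessian M g V p)"

text \<open>The condition \<open>- \<eta> \<in> tangent_cone M p\<close> says that \<open>- \<eta>\<close> points into \<open>M\<close>.\<close>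

definition outward_normal ::
    "'a::euclidean_space set \<Rightarrow> 'a metric \<Rightarrow> 'a set \<Rightarrow> 'a \<Rightarrow> 'a" where
  "outward_normal M g \<Sigma> p = (THE \<eta>. \<eta> \<in> tangent_space M p \<and> g p \<eta> \<eta> = 1 \<and>
     (\<forall>w\<in>tangent_space \<Sigma> p. g p \<eta> w = 0) \<and> - \<eta> \<in> tangent_cone M p)"

text \<open>\<open>\<pi>(u,v) = g(\<nabla>\<^sub>u \<eta>, v)\<close> for \<open>u\<close>, \<open>v\<close> tangent to \<open>\<Sigma>\<close>, where \<open>\<eta>\<close> is extended to a vector field \<open>N\<close> on \<open>M\<close>
  in order to apply the connection of \<open>M\<close>.\<close>

definition second_fundamental_form ::
    "'a::euclidean_space set \<Rightarrow> 'a metric \<Rightarrow> 'a set \<Rightarrow> 'a \<Rightarrow> 'a \<Rightarrow> 'a \<Rightarrow> real" where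
  "second_fundamental_form M g \<Sigma> p u v =
     (let N = (SOME N. N \<in> vector_fields M \<and>
                 (\<forall>\<^sub>F q in nhds p. q \<in> \<Sigma> \<longrightarrow> N q = outward_normal M g \<Sigma> q))
      in g p (levi_civita M g (field_ext M p u) N p) v)"

section \<open>Static manifolds with boundary\<close>

text \<open>The parameters \<open>Lt\<close>, \<open>lt\<close> are the cosmological constants (usually written with a tilde),
  and \<open>L\<close>, \<open>l\<close> are their normalizations.\<close>

definition static_potential ::
    "nat \<Rightarrow> 'a::euclidean_space set \<Rightarrow> 'a metric \<Rightarrow> 'a set \<Rightarrow> real \<Rightarrow> real \<Rightarrow> ('a \<Rightarrow> real) \<Rightarrow> bool" where
  "static_potential n M g \<Sigma> Lt lt V \<longleftrightarrow>
     smooth_map M V \<and> (\<exists>p\<in>M. V p \<noteq> 0) \<and>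
     (let L = 2 / (real n - 1) * Lt; l = 1 / (real n - 1) * lt in
       (\<forall>p\<in>M. \<forall>u\<in>tangent_space M p. \<forall>v\<in>tangent_space M p.
          hessian M g V p u v + L * V p * g p u v - V p * ricci M g p u v = 0) \<and>
       (\<forall>p\<in>M. laplacian M g V p + L * V p = 0) \<and>
       (\<forall>p\<in>\<Sigma>. \<forall>u\<in>tangent_space \<Sigma> p. \<forall>v\<in>tangent_space \<Sigma> p.
          second_fundamental_form M g \<Sigma> p u v - l * g p u v = 0) \<and>
       (\<forall>p\<in>\<Sigma>. dir_deriv M V p (outward_normal M g \<Sigma> p) - l * V p = 0))"

definition static_manifold_with_boundary ::
    "nat \<Rightarrow> 'a::euclidean_space set \<Rightarrow> 'a metric \<Rightarrow> 'a set \<Rightarrow> real \<Rightarrow> real \<Rightarrow> bool" where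
  "static_manifold_with_boundary n M g \<Sigma> Lt lt \<longleftrightarrow>
     manifold_with_boundary n M \<and> riemannian_metric M g \<and> \<Sigma> = mfd_boundary n M \<and>
     (\<exists>V. static_potential n M g \<Sigma> Lt lt V)"

text \<open>A function on \<open>M\<close> is represented by its extension by zero, so that functions on \<open>M\<close> form a
  real vector space of total functions.\<close>

definition restrict_to :: "'a set \<Rightarrow> ('a \<Rightarrow> real) \<Rightarrow> 'a \<Rightarrow> real" where
  "restrict_to M f = (\<lambda>p. if p \<in> M then f p else 0)"

definition static_potential_space ::
    "nat \<Rightarrow> 'a::euclidean_space set \<Rightarrow> 'a metric \<Rightarrow> 'a set \<Rightarrow> real \<Rightarrow> real \<Rightarrow> ('a \<Rightarrow> real) set" where
  "static_potential_space n M g \<Sigma> Lt lt =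
     {V. static_potential n M g \<Sigma> Lt lt V \<and> (\<forall>p. p \<notin> M \<longrightarrow> V p = 0)} \<union> {\<lambda>_. 0}"

definition fun_scale :: "real \<Rightarrow> ('a \<Rightarrow> real) \<Rightarrow> 'a \<Rightarrow> real" where
  "fun_scale c f = (\<lambda>x. c * f x)"

lemma vector_space_fun_scale: "vector_space fun_scale"
  by unfold_locales (auto simp: fun_scale_def plus_fun_def fun_eq_iff algebra_simps)

section \<open>The hyperboloid model\<close>

text \<open>\<open>\<real>\<^bsup>1,n\<^esup>\<close> with \<open>n = CARD('n)\<close>: the first component is \<open>x\<^sub>0\<close>, and the index type \<open>'n\<close> plays the
  role of \<open>{1..n}\<close>. An arbitrary element \<open>i1 :: 'n\<close> plays the role of the index \<open>1\<close>.\<close>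

type_synonym 'n minkowski = "real \<times> (real ^ 'n)"

definition lorentz :: "'n::finite minkowski \<Rightarrow> 'n minkowski \<Rightarrow> real" where
  "lorentz x y = - (fst x * fst y) + (\<Sum>i\<in>UNIV. snd x $ i * snd y $ i)"

definition hyperboloid :: "'n::finite minkowski set" where
  "hyperboloid = {x. lorentz x x = -1 \<and> fst x > 0}"

definition hyp_metric :: "'n::finite minkowski metric" where
  "hyp_metric p u v = lorentz u v"

definition V0 :: "'n::finite minkowski \<Rightarrow> real" where
  "V0 x = fst x"

definition V_coord :: "'n::finite \<Rightarrow> 'n minkowski \<Rightarrow> real" where
  "V_coord i x = snd x $ i"

definition V_h :: "'n::finite \<Rightarrow> 'n minkowski \<Rightarrow> real" where
  "V_h i1 x = V0 x - V_coord i1 x"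

definition hyp_horo_domain :: "'n::finite \<Rightarrow> real \<Rightarrow> 'n minkowski set" where
  "hyp_horo_domain i1 chi = {x \<in> hyperboloid. V_h i1 x \<le> chi}"

definition hyp_horo_boundary :: "'n::finite \<Rightarrow> real \<Rightarrow> 'n minkowski set" where
  "hyp_horo_boundary i1 chi = mfd_boundary CARD('n) (hyp_horo_domain i1 chi)"

text \<open>The hyperbolic distance is given by \<open>cosh d(x,y) = - \<langle>x,y\<rangle>\<close>. Horospheres are the level sets
  of the Busemann functions of geodesic rays.\<close>

definition hyp_dist :: "'n::finite minkowski \<Rightarrow> 'n minkowski \<Rightarrow> real" where
  "hyp_dist x y = arcosh (- lorentz x y)"

definition geodesic_ray :: "(real \<Rightarrow> 'n::finite minkowski) \<Rightarrow> bool" where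
  "geodesic_ray \<gamma> \<longleftrightarrow> (\<forall>t\<ge>0. \<gamma> t \<in> hyperboloid) \<and>
     (\<forall>s\<ge>0. \<forall>t\<ge>0. hyp_dist (\<gamma> s) (\<gamma> t) = \<bar>s - t\<bar>)"

definition horosphere :: "'n::finite minkowski set \<Rightarrow> bool" where
  "horosphere S \<longleftrightarrow> (\<exists>\<gamma> c. geodesic_ray \<gamma> \<and>
     S = {x \<in> hyperboloid. ((\<lambda>t. hyp_dist x (\<gamma> t) - t) \<longlongrightarrow> c) at_top})"

end

theory Submission
  imports Defs "HOL-Real_Asymp.Real_Asymp"
begin

text \<open>
  Write \<open>\<langle>x, y\<rangle>\<close> for the Lorentz form and let \<open>N = e\<^sub>0 + e\<^sub>1\<close>, a null vector, so that
  \<open>V_h x = - \<langle>x, N\<rangle>\<close>. The domain \<open>M\<close> is the closed horoball \<open>V_h \<le> \<chi>\<close>.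

  \<^emph>\<open>Geometry.\<close> The Levi-Civita connection of the hyperboloid is the tangential part of the
  flat derivative, \<open>D\<^sub>X Y = dY(X) - \<langle>X, Y\<rangle> p\<close>. Hence \<open>R(u,v)w = \<langle>u,w\<rangle> v - \<langle>v,w\<rangle> u\<close>, \<open>Ric = -(n-1) g\<close>,
  and a function with a local extension \<open>F\<close> has \<open>Hess(u,v) = D\<^sup>2F(u,v) + \<langle>u,v\<rangle> dF(p)\<close>
  (\<open>riemann_curvature_eq\<close>, \<open>ricci_eq\<close>, \<open>hessian_eq\<close>). With \<open>\<Lambda> = -n\<close> the two interior equations
  therefore amount to \<open>Hess V = V g\<close>, which every linear function satisfies. Along the boundary the
  outward unit normal is \<open>\<eta> = p - N / V_h(p)\<close>; since \<open>V_h\<close> is constant there, its derivative in a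
  boundary direction \<open>u\<close> is \<open>u\<close> itself, so \<open>\<pi> = g\<close> and \<open>\<lambda> = 1\<close>
  (\<open>outward_normal_eq\<close>, \<open>second_fundamental_form_eq\<close>).

  \<^emph>\<open>Classification.\<close> Conversely, if \<open>Hess V = V g\<close> then \<open>V'' = V\<close> along unit speed geodesics
  \<open>cosh t p + sinh t v\<close>, so \<open>V = cosh t V(p) + sinh t dV(v)\<close>. The horoball is geodesically convex,
  hence \<open>V\<close> is the restriction of a linear function \<open>l\<close> (\<open>hessian_eq_metric_imp_linear\<close>). For
  linear \<open>l\<close> the boundary condition \<open>l(\<eta>) = l(p)\<close> says \<open>l(N) = 0\<close>, and the linear functions that
  vanish on \<open>N\<close> are spanned by \<open>x\<^sub>0 - x\<^sub>1, x\<^sub>2, \<dots>, x\<^sub>n\<close>. These remain independent on the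
  boundary, as one sees by evaluating them at \<open>n\<close> suitable points.

  \<^emph>\<open>Boundary.\<close> The map \<open>x \<mapsto> (\<langle>x,x\<rangle> + 1, \<chi> - V_h x, x\<^sub>2, \<dots>, x\<^sub>n)\<close> straightens the
  horoball to a half-space; its inverse is rational. That points with \<open>V_h < \<chi>\<close> are not boundary
  points for any other chart is read off from the tangent cones
  (\<open>boundary_point_tangent_cone\<close>, \<open>tangent_cone_M\<close>). The level set \<open>V_h = \<chi>\<close> is the level \<open>ln \<chi>\<close>
  of the Busemann function \<open>ln V_h\<close> of the ray \<open>cosh t e\<^sub>0 + sinh t e\<^sub>1\<close> (\<open>busemann_horo_ray\<close>).
\<close>

section \<open>Calculus of smooth maps\<close>

lemma diff_times_cong:
  assumes "open U" "diff_times k f U" "\<And>x. x \<in> U \<Longrightarrow> f x = g x"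
  shows "diff_times k g U"
  using assms(2,3)
proof (induction k arbitrary: f g)
  case 0
  then show ?case by (simp cong: continuous_on_cong)
next
  case (Suc k)
  have "frechet_derivative f (at x) = frechet_derivative g (at x)" if "x \<in> U" for x
    using Suc.prems assms(1) that by (intro frechet_derivative_transform_within_open[of f x U g]) auto
  moreover have "g differentiable at x" if "x \<in> U" for x
    using Suc.prems assms(1) that
    by (metis diff_times.simps(2) differentiable_def has_derivative_transform_within_open)
  moreover have "diff_times k (\<lambda>x. frechet_derivative g (at x) v) U" for v
  proof (rule Suc.IH)
    show "diff_times k (\<lambda>x. frechet_derivative f (at x) v) U" using Suc.prems by simp
  qed (simp add: calculation)
  ultimately show ?case by simp
qed

text \<open>Allows any family of derivatives to stand in for the canonical choice
  \<open>frechet_derivative\<close>; all the closure properties below are inductions with this rule.\<close>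

lemma diff_times_SucI:
  assumes "open U" "\<And>x. x \<in> U \<Longrightarrow> (f has_derivative f' x) (at x)"
    "\<And>v. diff_times k (\<lambda>x. f' x v) U"
  shows "diff_times (Suc k) f U"
proof -
  have "diff_times k (\<lambda>x. frechet_derivative f (at x) v) U" for v
    by (rule diff_times_cong[OF assms(1) assms(3)[of v]]) (metis assms(2) frechet_derivative_at)
  with assms(2) show ?thesis by (auto simp: differentiable_def)
qed

lemma diff_times_Suc_has_derivative:
  "diff_times (Suc k) f U \<Longrightarrow> x \<in> U \<Longrightarrow> (f has_derivative frechet_derivative f (at x)) (at x)"
  by (simp flip: frechet_derivative_works)

lemma diff_times_Suc_imp: "diff_times (Suc k) f U \<Longrightarrow> diff_times k f U"
proof (induction k arbitrary: f)
  case 0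
  then show ?case
    by (auto simp: continuous_on_eq_continuous_within
        intro: differentiable_imp_continuous_within differentiable_at_withinI)
qed auto

lemma diff_times_subset: "diff_times k f U \<Longrightarrow> V \<subseteq> U \<Longrightarrow> diff_times k f V"
  by (induction k arbitrary: f) (auto intro: continuous_on_subset)

lemma diff_times_const: "diff_times k (\<lambda>x. c) U"
  by (induction k arbitrary: c) auto

lemma diff_times_bounded_linear:
  assumes "open U" "bounded_linear h" "diff_times k f U"
  shows "diff_times k (\<lambda>x. h (f x)) U"
  using assms(3)
proof (induction k arbitrary: f)
  case 0
  then show ?case using bounded_linear.continuous_on[OF assms(2)] by auto
next
  case (Suc k)
  show ?case
  proof (rule diff_times_SucI[OF assms(1)])
    show "((\<lambda>x. h (f x)) has_derivative (\<lambda>v. h (frechet_derivative f (at x) v))) (at x)" if "x \<in> U" for x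
      by (rule bounded_linear.has_derivative[OF assms(2) diff_times_Suc_has_derivative[OF Suc.prems that]])
  qed (use Suc in auto)
qed

lemma diff_times_add:
  assumes "open U" "diff_times k f U" "diff_times k g U"
  shows "diff_times k (\<lambda>x. f x + g x) U"
  using assms(2,3)
proof (induction k arbitrary: f g)
  case 0
  then show ?case by (auto intro: continuous_intros)
next
  case (Suc k)
  show ?case
  proof (rule diff_times_SucI[OF assms(1)])
    show "((\<lambda>x. f x + g x) has_derivative
        (\<lambda>v. frechet_derivative f (at x) v + frechet_derivative g (at x) v)) (at x)" if "x \<in> U" for x
      using Suc.prems[THEN diff_times_Suc_has_derivative, OF that] by (rule has_derivative_add)
  qed (use Suc in auto)
qed

lemma diff_times_bounded_bilinear:
  assumes "open U" "bounded_bilinear b" "diff_times k f U" "diff_times k g U"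
  shows "diff_times k (\<lambda>x. b (f x) (g x)) U"
  using assms(3,4)
proof (induction k arbitrary: f g)
  case 0
  then show ?case using bounded_bilinear.continuous_on[OF assms(2)] by auto
next
  case (Suc k)
  show ?case
  proof (rule diff_times_SucI[OF assms(1)])
    show "((\<lambda>x. b (f x) (g x)) has_derivative
        (\<lambda>v. b (f x) (frechet_derivative g (at x) v) + b (frechet_derivative f (at x) v) (g x))) (at x)"
      if "x \<in> U" for x
      using Suc.prems[THEN diff_times_Suc_has_derivative, OF that]
      by (rule bounded_bilinear.FDERIV[OF assms(2)])
    show "diff_times k (\<lambda>x. b (f x) (frechet_derivative g (at x) v) +
        b (frechet_derivative f (at x) v) (g x)) U" for v
      using Suc.prems Suc.prems[THEN diff_times_Suc_imp]
      by (intro diff_times_add[OF assms(1)] Suc.IH) simp_all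
  qed
qed

text \<open>The derivative of \<open>1/f\<close> is a product of \<open>1/f\<close>, \<open>1/f\<close> and the derivative of \<open>f\<close>, so
  the product rule raises the order of differentiability by one.\<close>

lemma diff_times_inverse:
  fixes f :: "'a::real_normed_vector \<Rightarrow> real"
  assumes "open U" "diff_times k f U" "\<And>x. x \<in> U \<Longrightarrow> f x \<noteq> 0"
  shows "diff_times k (\<lambda>x. inverse (f x)) U"
  using assms(2)
proof (induction k)
  case 0
  then show ?case using assms(3) by (auto intro!: continuous_on_inverse)
next
  case (Suc k)
  note mult = diff_times_bounded_bilinear[OF assms(1) bounded_bilinear_mult]
  have inv: "diff_times k (\<lambda>x. inverse (f x)) U"
    using Suc diff_times_Suc_imp by blast
  show ?case
  proof (rule diff_times_SucI[OF assms(1)])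
    show "((\<lambda>x. inverse (f x)) has_derivative
        (\<lambda>v. - (inverse (f x) * frechet_derivative f (at x) v * inverse (f x)))) (at x)" if "x \<in> U" for x
      using that assms(3) diff_times_Suc_has_derivative[OF Suc.prems that] by (intro Deriv.has_derivative_inverse) auto
    show "diff_times k (\<lambda>x. - (inverse (f x) * frechet_derivative f (at x) v * inverse (f x))) U" for v
      by (rule diff_times_bounded_linear[OF assms(1) bounded_linear_minus[OF bounded_linear_ident]])
        (intro mult inv, use Suc.prems in auto)
  qed
qed

lemma smooth_on_has_derivative:
  "smooth_on U f \<Longrightarrow> x \<in> U \<Longrightarrow> (f has_derivative frechet_derivative f (at x)) (at x)"
  unfolding smooth_on_def by (blast intro: diff_times_Suc_has_derivative[of 0])

lemma smooth_on_continuous_on: "smooth_on U f \<Longrightarrow> continuous_on U f"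
  unfolding smooth_on_def by (metis diff_times.simps(1))

lemma smooth_on_subset: "smooth_on U f \<Longrightarrow> V \<subseteq> U \<Longrightarrow> smooth_on V f"
  by (auto simp: smooth_on_def intro: diff_times_subset)

lemma smooth_on_cong:
  "open U \<Longrightarrow> smooth_on U f \<Longrightarrow> (\<And>x. x \<in> U \<Longrightarrow> f x = g x) \<Longrightarrow> smooth_on U g"
  by (auto simp: smooth_on_def intro: diff_times_cong)

lemma smooth_on_const: "smooth_on U (\<lambda>x. c)"
  by (simp add: smooth_on_def diff_times_const)

lemma smooth_on_add:
  "open U \<Longrightarrow> smooth_on U f \<Longrightarrow> smooth_on U g \<Longrightarrow> smooth_on U (\<lambda>x. f x + g x)"
  by (auto simp: smooth_on_def intro: diff_times_add)

lemma smooth_on_sum: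
  assumes "open U" "\<And>i. i \<in> I \<Longrightarrow> smooth_on U (f i)"
  shows "smooth_on U (\<lambda>x. \<Sum>i\<in>I. f i x)"
  using assms(2) by (induction I rule: infinite_finite_induct) (auto intro: smooth_on_const smooth_on_add assms(1))

lemma smooth_on_comp_bounded_linear:
  "open U \<Longrightarrow> bounded_linear h \<Longrightarrow> smooth_on U f \<Longrightarrow> smooth_on U (\<lambda>x. h (f x))"
  by (auto simp: smooth_on_def intro: diff_times_bounded_linear)

lemma smooth_on_ident: "smooth_on U (\<lambda>x. x)"
proof -
  have "diff_times k (\<lambda>x::'a. x) U" for k by (cases k) (auto simp: diff_times_const)
  then show ?thesis by (simp add: smooth_on_def)
qed

lemma smooth_on_bounded_linear: "open U \<Longrightarrow> bounded_linear h \<Longrightarrow> smooth_on U h"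
  using smooth_on_comp_bounded_linear[OF _ _ smooth_on_ident] by blast

lemma smooth_on_bounded_bilinear:
  "open U \<Longrightarrow> bounded_bilinear b \<Longrightarrow> smooth_on U f \<Longrightarrow> smooth_on U g \<Longrightarrow>
    smooth_on U (\<lambda>x. b (f x) (g x))"
  by (auto simp: smooth_on_def intro: diff_times_bounded_bilinear)

lemmas smooth_on_mult = smooth_on_bounded_bilinear[OF _ bounded_bilinear_mult]

lemma smooth_on_linear:
  fixes h :: "'a::euclidean_space \<Rightarrow> 'b::real_normed_vector"
  shows "open U \<Longrightarrow> linear h \<Longrightarrow> smooth_on U h"
  by (intro smooth_on_bounded_linear) (auto simp: linear_conv_bounded_linear)

lemma smooth_on_diff:
  assumes "open U" "smooth_on U f" "smooth_on U g"
  shows "smooth_on U (\<lambda>x. f x - g x)"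
  using smooth_on_add[OF assms(1,2) smooth_on_bounded_bilinear[OF assms(1) bounded_bilinear_scaleR
    smooth_on_const assms(3)], of "-1"] by simp

lemma smooth_on_inverse:
  fixes f :: "'a::real_normed_vector \<Rightarrow> real"
  shows "open U \<Longrightarrow> smooth_on U f \<Longrightarrow> (\<And>x. x \<in> U \<Longrightarrow> f x \<noteq> 0) \<Longrightarrow> smooth_on U (\<lambda>x. inverse (f x))"
  by (auto simp: smooth_on_def intro: diff_times_inverse)

lemma smooth_on_frechet_derivative_const:
  "smooth_on U f \<Longrightarrow> smooth_on U (\<lambda>x. frechet_derivative f (at x) v)"
  unfolding smooth_on_def by (metis diff_times.simps(2))

lemma linear_eq_sum_Basis:
  fixes A :: "'a::euclidean_space \<Rightarrow> 'b::real_vector"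
  assumes "linear A"
  shows "A v = (\<Sum>b\<in>Basis. (v \<bullet> b) *\<^sub>R A b)"
proof -
  have "A v = A (\<Sum>b\<in>Basis. (v \<bullet> b) *\<^sub>R b)" by (simp add: euclidean_representation)
  then show ?thesis by (simp add: linear_sum[OF assms] linear_scale[OF assms])
qed

text \<open>The definition of smoothness only controls derivatives in constant directions; a variable
  direction is expanded in the standard basis.\<close>

lemma smooth_on_frechet_derivative:
  fixes f :: "'a::euclidean_space \<Rightarrow> 'b::real_normed_vector"
  assumes "open U" "smooth_on U f" "smooth_on U X"
  shows "smooth_on U (\<lambda>x. frechet_derivative f (at x) (X x))"
proof (rule smooth_on_cong[OF assms(1)])
  show "smooth_on U (\<lambda>x. \<Sum>b\<in>Basis. (X x \<bullet> b) *\<^sub>R frechet_derivative f (at x) b)"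
    by (intro smooth_on_sum assms(1) smooth_on_bounded_bilinear[OF assms(1) bounded_bilinear_scaleR]
        smooth_on_comp_bounded_linear[OF assms(1) bounded_linear_inner_left]
        smooth_on_frechet_derivative_const assms)
  show "(\<Sum>b\<in>Basis. (X x \<bullet> b) *\<^sub>R frechet_derivative f (at x) b) =
      frechet_derivative f (at x) (X x)" if "x \<in> U" for x
    using smooth_on_has_derivative[OF assms(2) that]
    by (intro linear_eq_sum_Basis[symmetric]) (auto dest: has_derivative_linear)
qed

lemma smooth_on_has_derivative_frechet_derivative:
  fixes f :: "'a::euclidean_space \<Rightarrow> 'b::real_normed_vector"
  assumes U: "open U" "p \<in> U" and f: "smooth_on U f" and X: "smooth_on U X"
  shows "((\<lambda>x. frechet_derivative f (at x) (X x)) has_derivative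
      (\<lambda>v. frechet_derivative (\<lambda>x. frechet_derivative f (at x) (X p)) (at p) v +
           frechet_derivative f (at p) (frechet_derivative X (at p) v))) (at p)"
proof -
  have lin: "linear (frechet_derivative f (at x))" if "x \<in> U" for x
    using smooth_on_has_derivative[OF f that] by (rule has_derivative_linear)
  let ?D = "\<lambda>b. frechet_derivative (\<lambda>x. frechet_derivative f (at x) b) (at p)"
  note dX = smooth_on_has_derivative[OF X U(2)]
  note df = smooth_on_has_derivative[OF smooth_on_frechet_derivative_const[OF f] U(2)]
  have 1: "((\<lambda>x. \<Sum>b\<in>Basis. (X x \<bullet> b) *\<^sub>R frechet_derivative f (at x) b) has_derivative
      (\<lambda>v. \<Sum>b\<in>Basis. (X p \<bullet> b) *\<^sub>R ?D b v + (frechet_derivative X (at p) v \<bullet> b) *\<^sub>R frechet_derivative f (at p) b)) (at p)"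
    by (intro has_derivative_sum has_derivative_scaleR has_derivative_inner_left dX df)
  have 2: "((\<lambda>x. \<Sum>b\<in>Basis. (X p \<bullet> b) *\<^sub>R frechet_derivative f (at x) b) has_derivative
      (\<lambda>v. \<Sum>b\<in>Basis. (X p \<bullet> b) *\<^sub>R ?D b v)) (at p)"
    by (intro has_derivative_sum has_derivative_scaleR_right df)
  have "((\<lambda>x. frechet_derivative f (at x) (X p)) has_derivative
      (\<lambda>v. \<Sum>b\<in>Basis. (X p \<bullet> b) *\<^sub>R ?D b v)) (at p)"
    by (rule has_derivative_transform_within_open[OF 2 U]) (rule linear_eq_sum_Basis[OF lin, symmetric])
  then have 3: "frechet_derivative (\<lambda>x. frechet_derivative f (at x) (X p)) (at p) v =
      (\<Sum>b\<in>Basis. (X p \<bullet> b) *\<^sub>R ?D b v)" for v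
    by (rule fun_cong[OF frechet_derivative_at[symmetric]])
  have "((\<lambda>x. frechet_derivative f (at x) (X x)) has_derivative
      (\<lambda>v. \<Sum>b\<in>Basis. (X p \<bullet> b) *\<^sub>R ?D b v + (frechet_derivative X (at p) v \<bullet> b) *\<^sub>R frechet_derivative f (at p) b)) (at p)"
    by (rule has_derivative_transform_within_open[OF 1 U]) (rule linear_eq_sum_Basis[OF lin, symmetric])
  then show ?thesis
    by (rule has_derivative_eq_rhs)
      (unfold 3 sum.distrib, intro ext arg_cong2[where f = "(+)"] refl
        linear_eq_sum_Basis[OF lin[OF U(2)], symmetric])
qed

section \<open>Symmetry of second derivatives\<close>

lemma DERIV_along_line:
  assumes "(F has_derivative F') (at (a + s *\<^sub>R u))"
  shows "((\<lambda>s. F (a + s *\<^sub>R u)) has_real_derivative F' u) (at s)"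
proof -
  have "((\<lambda>s. a + s *\<^sub>R u) has_derivative (\<lambda>h. h *\<^sub>R u)) (at s)"
    by (auto intro!: derivative_eq_intros)
  from has_derivative_compose[OF this assms] show ?thesis
    using linear_scale[OF has_derivative_linear[OF assms]]
    by (simp add: has_field_derivative_def mult.commute[of "F' u"] mult_commute_abs)
qed

text \<open>Two applications of the mean value theorem express the second difference as \<open>h\<^sup>2\<close> times the
  mixed second derivative at a point that tends to \<open>p\<close>. The second difference is symmetric
  in \<open>u\<close> and \<open>v\<close>, hence so is the limit.\<close>

lemma second_difference_tendsto:
  fixes F :: "'a::real_normed_vector \<Rightarrow> real"
  assumes U: "open U" "p \<in> U" and F: "smooth_on U F"
  shows "((\<lambda>h. (F (p + h *\<^sub>R u + h *\<^sub>R v) - F (p + h *\<^sub>R u) - F (p + h *\<^sub>R v) + F p) / (h * h)) \<longlongrightarrow>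
    frechet_derivative (\<lambda>q. frechet_derivative F (at q) u) (at p) v) (at_right 0)"
proof (rule tendstoI)
  fix e :: real assume e: "e > 0"
  define D where "D q = frechet_derivative F (at q) u" for q
  define DD where "DD q = frechet_derivative D (at q) v" for q
  have D: "smooth_on U D" and DD: "smooth_on U DD"
    unfolding D_def DD_def by (intro smooth_on_frechet_derivative_const F)+
  have "continuous (at p) DD"
    using smooth_on_continuous_on[OF DD] U continuous_on_eq_continuous_at by blast
  then obtain d1 where d1: "d1 > 0" "\<And>q. dist q p < d1 \<Longrightarrow> dist (DD q) (DD p) < e"
    using e unfolding continuous_at_eps_delta by blast
  obtain d2 where d2: "d2 > 0" "\<And>q. dist q p < d2 \<Longrightarrow> q \<in> U"
    using U unfolding open_dist by blast
  define c where "c = norm u + norm v + 1"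
  have c: "c > 0" by (simp add: c_def add_nonneg_pos)
  have near: "dist (p + s *\<^sub>R u + t *\<^sub>R v) p < min d1 d2"
    if "0 \<le> s" "s \<le> h" "0 \<le> t" "t \<le> h" "0 < h" "h < min d1 d2 / c" for s t h
  proof -
    have "dist (p + s *\<^sub>R u + t *\<^sub>R v) p = norm (s *\<^sub>R u + t *\<^sub>R v)"
      by (simp add: dist_norm algebra_simps)
    also have "\<dots> \<le> s * norm u + t * norm v"
      using that by (metis norm_triangle_ineq norm_scaleR abs_of_nonneg)
    also have "\<dots> \<le> h * norm u + h * norm v"
      using that by (intro add_mono mult_right_mono) auto
    also have "\<dots> < h * c" using that by (simp add: c_def algebra_simps)
    also have "\<dots> < min d1 d2" using that c by (simp add: pos_less_divide_eq)
    finally show ?thesis .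
  qed
  have "dist ((F (p + h *\<^sub>R u + h *\<^sub>R v) - F (p + h *\<^sub>R u) - F (p + h *\<^sub>R v) + F p) / (h * h)) (DD p) < e"
    if h: "0 < h" "h < min d1 d2 / c" for h
  proof -
    have inU: "p + s *\<^sub>R u + t *\<^sub>R v \<in> U" if "0 \<le> s" "s \<le> h" "0 \<le> t" "t \<le> h" for s t
      using near[OF that h] d2 by auto
    let ?\<phi> = "\<lambda>s. F ((p + h *\<^sub>R v) + s *\<^sub>R u) - F (p + s *\<^sub>R u)"
    have "\<exists>s>0. s < h \<and> ?\<phi> h - ?\<phi> 0 = (h - 0) * (D ((p + h *\<^sub>R v) + s *\<^sub>R u) - D (p + s *\<^sub>R u))"
    proof (rule MVT2[OF h(1)])
      fix s assume s: "0 \<le> s" "s \<le> h"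
      have "p + h *\<^sub>R v + s *\<^sub>R u \<in> U" "p + s *\<^sub>R u \<in> U"
        using inU[of s h] inU[of s 0] s h by (auto simp: algebra_simps)
      then show "(?\<phi> has_real_derivative (D ((p + h *\<^sub>R v) + s *\<^sub>R u) - D (p + s *\<^sub>R u))) (at s)"
        unfolding D_def by (intro DERIV_diff DERIV_along_line smooth_on_has_derivative[OF F])
    qed
    then obtain s where s: "0 < s" "s < h"
      and \<phi>: "?\<phi> h - ?\<phi> 0 = h * (D ((p + h *\<^sub>R v) + s *\<^sub>R u) - D (p + s *\<^sub>R u))" by auto
    have "\<exists>t>0. t < h \<and> D ((p + s *\<^sub>R u) + h *\<^sub>R v) - D ((p + s *\<^sub>R u) + 0 *\<^sub>R v) = (h - 0) * DD ((p + s *\<^sub>R u) + t *\<^sub>R v)"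
    proof (rule MVT2[OF h(1)])
      fix t assume t: "0 \<le> t" "t \<le> h"
      show "((\<lambda>t. D ((p + s *\<^sub>R u) + t *\<^sub>R v)) has_real_derivative DD ((p + s *\<^sub>R u) + t *\<^sub>R v)) (at t)"
        unfolding DD_def using inU[of s t] s t by (intro DERIV_along_line smooth_on_has_derivative[OF D]) auto
    qed
    then obtain t where t: "0 < t" "t < h"
      and \<psi>: "D ((p + s *\<^sub>R u) + h *\<^sub>R v) - D (p + s *\<^sub>R u) = h * DD ((p + s *\<^sub>R u) + t *\<^sub>R v)" by auto
    have "F (p + h *\<^sub>R u + h *\<^sub>R v) - F (p + h *\<^sub>R u) - F (p + h *\<^sub>R v) + F p = ?\<phi> h - ?\<phi> 0"
      by (simp add: algebra_simps)
    also have "\<dots> = h * h * DD ((p + s *\<^sub>R u) + t *\<^sub>R v)"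
      unfolding \<phi> using \<psi> by (simp add: algebra_simps)
    finally have "(F (p + h *\<^sub>R u + h *\<^sub>R v) - F (p + h *\<^sub>R u) - F (p + h *\<^sub>R v) + F p) / (h * h) =
        DD ((p + s *\<^sub>R u) + t *\<^sub>R v)"
      using h by simp
    then show ?thesis using near[of s h t] s t h d1 by auto
  qed
  moreover have "min d1 d2 / c > 0" using d1 d2 c by simp
  ultimately show "\<forall>\<^sub>F h in at_right 0. dist ((F (p + h *\<^sub>R u + h *\<^sub>R v) - F (p + h *\<^sub>R u) - F (p + h *\<^sub>R v) + F p) / (h * h))
      (frechet_derivative (\<lambda>q. frechet_derivative F (at q) u) (at p) v) < e"
    unfolding eventually_at_right_field DD_def D_def by blast
qed

lemma second_derivative_symmetric:
  fixes F :: "'a::real_normed_vector \<Rightarrow> 'b::real_inner"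
  assumes U: "open U" "p \<in> U" and F: "smooth_on U F"
  shows "frechet_derivative (\<lambda>q. frechet_derivative F (at q) u) (at p) v =
    frechet_derivative (\<lambda>q. frechet_derivative F (at q) v) (at p) u"
proof -
  have real: "frechet_derivative (\<lambda>q. frechet_derivative f (at q) u) (at p) v =
      frechet_derivative (\<lambda>q. frechet_derivative f (at q) v) (at p) u"
    if f: "smooth_on U f" for f :: "'a \<Rightarrow> real"
  proof (rule tendsto_unique[OF _ second_difference_tendsto[OF U f]])
    have eq: "f (p + h *\<^sub>R v + h *\<^sub>R u) - f (p + h *\<^sub>R v) - f (p + h *\<^sub>R u) + f p =
        f (p + h *\<^sub>R u + h *\<^sub>R v) - f (p + h *\<^sub>R u) - f (p + h *\<^sub>R v) + f p" for h
      by (subst add.assoc, subst add.commute[of "h *\<^sub>R v"], subst add.assoc[symmetric]) simp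
    show "((\<lambda>h. (f (p + h *\<^sub>R u + h *\<^sub>R v) - f (p + h *\<^sub>R u) - f (p + h *\<^sub>R v) + f p) / (h * h)) \<longlongrightarrow>
      frechet_derivative (\<lambda>q. frechet_derivative f (at q) v) (at p) u) (at_right 0)"
      using second_difference_tendsto[OF U f, of v u]
      by (simp only: eq)
  qed simp
  have comp: "frechet_derivative (\<lambda>q. frechet_derivative (\<lambda>x. F x \<bullet> b) (at q) u) (at p) v =
      frechet_derivative (\<lambda>q. frechet_derivative F (at q) u) (at p) v \<bullet> b" for b u v
  proof -
    have 1: "frechet_derivative (\<lambda>x. F x \<bullet> b) (at q) u = frechet_derivative F (at q) u \<bullet> b" if "q \<in> U" for q
      by (rule fun_cong[OF frechet_derivative_at[OF has_derivative_inner_left[OF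
            smooth_on_has_derivative[OF F that], of b], symmetric]])
    have "((\<lambda>q. frechet_derivative F (at q) u \<bullet> b) has_derivative
        (\<lambda>v. frechet_derivative (\<lambda>q. frechet_derivative F (at q) u) (at p) v \<bullet> b)) (at p)"
      by (intro has_derivative_inner_left smooth_on_has_derivative[OF _ U(2)] smooth_on_frechet_derivative_const F)
    then have "((\<lambda>q. frechet_derivative (\<lambda>x. F x \<bullet> b) (at q) u) has_derivative
        (\<lambda>v. frechet_derivative (\<lambda>q. frechet_derivative F (at q) u) (at p) v \<bullet> b)) (at p)"
      by (rule has_derivative_transform_within_open[OF _ U]) (simp add: 1)
    then show ?thesis by (rule fun_cong[OF frechet_derivative_at[symmetric]])
  qed
  have "smooth_on U (\<lambda>x. F x \<bullet> b)" for b
    by (intro smooth_on_comp_bounded_linear[OF U(1) bounded_linear_inner_left] F)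
  then have "(frechet_derivative (\<lambda>q. frechet_derivative F (at q) u) (at p) v -
    frechet_derivative (\<lambda>q. frechet_derivative F (at q) v) (at p) u) \<bullet> b = 0" for b
    using real[of "\<lambda>x. F x \<bullet> b"] unfolding comp inner_diff_left by simp
  from this[of "frechet_derivative (\<lambda>q. frechet_derivative F (at q) u) (at p) v -
      frechet_derivative (\<lambda>q. frechet_derivative F (at q) v) (at p) u"]
  show ?thesis by simp
qed

section \<open>Smooth maps and derivatives on subsets of Euclidean space\<close>

lemma smooth_map_cong:
  "smooth_map M f \<Longrightarrow> (\<And>q. q \<in> M \<Longrightarrow> f q = g q) \<Longrightarrow> smooth_map M g"
  unfolding smooth_map_def by (metis IntD2)

lemma smooth_on_imp_smooth_map: "open U \<Longrightarrow> smooth_on U f \<Longrightarrow> M \<subseteq> U \<Longrightarrow> smooth_map M f"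
  unfolding smooth_map_def by blast

lemma smooth_map_const: "smooth_map M (\<lambda>x. c)"
  by (rule smooth_on_imp_smooth_map[OF open_UNIV smooth_on_const]) simp

lemma smooth_map_bounded_linear: "bounded_linear h \<Longrightarrow> smooth_map M h"
  by (rule smooth_on_imp_smooth_map[OF open_UNIV smooth_on_bounded_linear]) auto

lemma smooth_map_ident: "smooth_map M (\<lambda>x. x)"
  by (rule smooth_map_bounded_linear[OF bounded_linear_ident])

lemma smooth_map_extension:
  assumes "smooth_map M f" "p \<in> M"
  obtains U F where "open U" "p \<in> U" "smooth_on U F" "\<And>q. q \<in> U \<Longrightarrow> q \<in> M \<Longrightarrow> F q = f q"
proof -
  from bspec[OF assms(1)[unfolded smooth_map_def] assms(2)]
  obtain U F where "open U" "p \<in> U" "smooth_on U F" "\<forall>q\<in>U \<inter> M. F q = f q"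
    by (elim exE conjE)
  then show thesis by (intro that[of U F]) auto
qed

lemma smooth_map_extension2:
  assumes "smooth_map M f" "smooth_map M g" "p \<in> M"
  obtains U F G where "open U" "p \<in> U" "smooth_on U F" "smooth_on U G"
    "\<And>q. q \<in> U \<Longrightarrow> q \<in> M \<Longrightarrow> F q = f q" "\<And>q. q \<in> U \<Longrightarrow> q \<in> M \<Longrightarrow> G q = g q"
proof -
  obtain U F where U: "open U" "p \<in> U" "smooth_on U F" "\<And>q. q \<in> U \<Longrightarrow> q \<in> M \<Longrightarrow> F q = f q"
    by (rule smooth_map_extension[OF assms(1,3)]) (rule that)
  obtain W G where W: "open W" "p \<in> W" "smooth_on W G" "\<And>q. q \<in> W \<Longrightarrow> q \<in> M \<Longrightarrow> G q = g q"
    by (rule smooth_map_extension[OF assms(2,3)]) (rule that)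
  show ?thesis
    by (rule that[of "U \<inter> W" F G]) (use U W in \<open>auto intro: smooth_on_subset\<close>)
qed

lemma smooth_map_add:
  assumes "smooth_map M f" "smooth_map M g"
  shows "smooth_map M (\<lambda>x. f x + g x)"
  unfolding smooth_map_def
proof
  fix p assume "p \<in> M"
  obtain U F G where
    "open U" "p \<in> U" "smooth_on U F" "smooth_on U G"
    "\<And>q. q \<in> U \<Longrightarrow> q \<in> M \<Longrightarrow> F q = f q" "\<And>q. q \<in> U \<Longrightarrow> q \<in> M \<Longrightarrow> G q = g q"
    by (rule smooth_map_extension2[OF assms \<open>p \<in> M\<close>]) (rule that)
  then show "\<exists>U H. open U \<and> p \<in> U \<and> smooth_on U H \<and> (\<forall>q\<in>U \<inter> M. H q = f q + g q)"
    by (intro exI[of _ U] exI[of _ "\<lambda>x. F x + G x"]) (auto intro: smooth_on_add)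
qed

lemma smooth_map_bounded_bilinear:
  assumes "bounded_bilinear b" "smooth_map M f" "smooth_map M g"
  shows "smooth_map M (\<lambda>x. b (f x) (g x))"
  unfolding smooth_map_def
proof
  fix p assume "p \<in> M"
  obtain U F G where
    "open U" "p \<in> U" "smooth_on U F" "smooth_on U G"
    "\<And>q. q \<in> U \<Longrightarrow> q \<in> M \<Longrightarrow> F q = f q" "\<And>q. q \<in> U \<Longrightarrow> q \<in> M \<Longrightarrow> G q = g q"
    by (rule smooth_map_extension2[OF assms(2,3) \<open>p \<in> M\<close>]) (rule that)
  then show "\<exists>U H. open U \<and> p \<in> U \<and> smooth_on U H \<and> (\<forall>q\<in>U \<inter> M. H q = b (f q) (g q))"
    by (intro exI[of _ U] exI[of _ "\<lambda>x. b (F x) (G x)"])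
      (auto intro: smooth_on_bounded_bilinear[OF _ assms(1)])
qed

lemmas smooth_map_scaleR = smooth_map_bounded_bilinear[OF bounded_bilinear_scaleR]

lemma smooth_map_diff:
  assumes "smooth_map M f" "smooth_map M g"
  shows "smooth_map M (\<lambda>x. f x - g x)"
  using smooth_map_add[OF assms(1) smooth_map_scaleR[OF smooth_map_const assms(2), of "-1"]] by simp

text \<open>All calculus on \<open>M\<close> is reduced to local smooth extensions through this lemma.\<close>

lemma extension_has_derivative_within:
  assumes "open U" "smooth_on U F" "\<And>q. q \<in> U \<Longrightarrow> q \<in> M \<Longrightarrow> F q = f q" "p \<in> U" "p \<in> M"
  shows "(f has_derivative frechet_derivative F (at p)) (at p within M)"
proof (rule has_derivative_transform_eventually[of F])
  show "(F has_derivative frechet_derivative F (at p)) (at p within M)"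
    using smooth_on_has_derivative[OF assms(2,4)] has_derivative_at_withinI by blast
  show "\<forall>\<^sub>F x' in at p within M. F x' = f x'"
    unfolding eventually_at_topological using assms by blast
qed (use assms in auto)

lemma at_0_within_Icc_neq_bot: "at (0::real) within {0..1} \<noteq> bot"
  by (metis atLeastAtMost_iff less_eq_real_def trivial_limit_within islimpt_Icc zero_less_one)

text \<open>Differentiating along a curve that starts at \<open>p\<close> determines the derivative on its
  velocity; linearity extends this to the span of the velocities.\<close>

lemma has_derivative_within_unique_tangent:
  assumes A: "(f has_derivative A) (at p within M)" and B: "(f has_derivative B) (at p within M)"
    and v: "v \<in> tangent_space M p"
  shows "A v = B v"
proof -
  have *: "((\<lambda>t. f (\<gamma> t)) has_vector_derivative C v) (at 0 within {0..1})"
    if C: "(f has_derivative C) (at p within M)" and \<gamma>: "\<gamma> 0 = p" "\<forall>t\<in>{0..1::real}. \<gamma> t \<in> M"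
      "(\<gamma> has_vector_derivative v) (at 0 within {0..1})" for C \<gamma> v
  proof -
    have "(f has_derivative C) (at (\<gamma> 0) within \<gamma> ` {0..1})"
      using C \<gamma>(1,2) by (auto intro: has_derivative_subset)
    from has_derivative_in_compose[OF \<gamma>(3)[unfolded has_vector_derivative_def] this]
    show ?thesis
      using linear_scale[OF has_derivative_linear[OF C]] by (simp add: has_vector_derivative_def)
  qed
  have eq: "A v = B v" if "v \<in> tangent_cone M p" for v
  proof -
    from that obtain \<gamma> where \<gamma>: "\<gamma> 0 = p" "\<forall>t\<in>{0..1::real}. \<gamma> t \<in> M"
      "(\<gamma> has_vector_derivative v) (at 0 within {0..1})" by (auto simp: tangent_cone_def)
    from vector_derivative_unique_within[OF at_0_within_Icc_neq_bot *[OF A \<gamma>] *[OF B \<gamma>]] show ?thesis .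
  qed
  show ?thesis
    by (rule linear_eq_on_span[OF has_derivative_linear[OF A] has_derivative_linear[OF B] eq])
      (use v in \<open>auto simp: tangent_space_def\<close>)
qed

lemma dir_deriv_eq:
  assumes "(f has_derivative A) (at p within M)" "v \<in> tangent_space M p"
  shows "dir_deriv M f p v = A v"
proof -
  have "(f has_derivative frechet_derivative f (at p within M)) (at p within M)"
    using assms(1) by (auto simp: differentiable_def simp flip: frechet_derivative_works)
  from has_derivative_within_unique_tangent[OF this assms] show ?thesis
    by (simp add: dir_deriv_def)
qed

lemma dir_deriv_cong:
  assumes "\<And>q. q \<in> M \<Longrightarrow> f q = g q" "p \<in> M"
  shows "dir_deriv M f p v = dir_deriv M g p v"
proof -
  have "(f has_derivative A) (at p within M) \<longleftrightarrow> (g has_derivative A) (at p within M)" for A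
    using has_derivative_transform[of p M g f A] has_derivative_transform[of p M f g A] assms by auto
  then show ?thesis by (simp add: dir_deriv_def frechet_derivative_def)
qed

lemma smooth_map_has_derivative:
  assumes "smooth_map M f" "p \<in> M"
  shows "(f has_derivative dir_deriv M f p) (at p within M)"
proof -
  obtain U F where "open U" "p \<in> U" "smooth_on U F" "\<And>q. q \<in> U \<Longrightarrow> q \<in> M \<Longrightarrow> F q = f q"
    by (rule smooth_map_extension[OF assms]) (rule that)
  then have "f differentiable (at p within M)"
    using extension_has_derivative_within assms(2) by (metis differentiable_def)
  then have "(f has_derivative frechet_derivative f (at p within M)) (at p within M)"
    by (simp flip: frechet_derivative_works)
  then show ?thesis by (simp add: dir_deriv_def[abs_def])
qed

lemma linear_dir_deriv: "smooth_map M f \<Longrightarrow> p \<in> M \<Longrightarrow> linear (dir_deriv M f p)"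
  by (rule has_derivative_linear[OF smooth_map_has_derivative])

lemma dir_deriv_add:
  assumes "smooth_map M f" "smooth_map M g" "p \<in> M" "v \<in> tangent_space M p"
  shows "dir_deriv M (\<lambda>q. f q + g q) p v = dir_deriv M f p v + dir_deriv M g p v"
  by (rule dir_deriv_eq[OF has_derivative_add[OF smooth_map_has_derivative smooth_map_has_derivative]])
    (rule assms)+

lemma dir_deriv_bounded_bilinear:
  assumes "bounded_bilinear b" "smooth_map M f" "smooth_map M g" "p \<in> M" "v \<in> tangent_space M p"
  shows "dir_deriv M (\<lambda>q. b (f q) (g q)) p v = b (f p) (dir_deriv M g p v) + b (dir_deriv M f p v) (g p)"
  by (rule dir_deriv_eq[OF bounded_bilinear.FDERIV[OF assms(1) smooth_map_has_derivative smooth_map_has_derivative]])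
    (rule assms)+

lemma dir_deriv_const:
  "v \<in> tangent_space M p \<Longrightarrow> dir_deriv M (\<lambda>q. c) p v = 0"
  by (rule dir_deriv_eq[OF has_derivative_const])

lemma dir_deriv_ident:
  "v \<in> tangent_space M p \<Longrightarrow> dir_deriv M (\<lambda>q. q) p v = v"
  by (rule dir_deriv_eq[OF has_derivative_ident])

lemma dir_deriv_extension:
  assumes "open U" "smooth_on U F" "\<And>q. q \<in> U \<Longrightarrow> q \<in> M \<Longrightarrow> F q = f q" "p \<in> U" "p \<in> M"
    "v \<in> tangent_space M p"
  shows "dir_deriv M f p v = frechet_derivative F (at p) v"
  by (rule dir_deriv_eq[OF extension_has_derivative_within assms(6)]) (use assms in auto)

lemma smooth_map_dir_deriv:
  fixes f :: "'a::euclidean_space \<Rightarrow> 'b::real_normed_vector"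
  assumes "smooth_map M f" "X \<in> vector_fields M"
  shows "smooth_map M (\<lambda>q. dir_deriv M f q (X q))"
  unfolding smooth_map_def
proof
  fix p assume "p \<in> M"
  have X: "smooth_map M X" "\<And>q. q \<in> M \<Longrightarrow> X q \<in> tangent_space M q"
    using assms(2) by (auto simp: vector_fields_def)
  obtain U F G where U:
    "open U" "p \<in> U" "smooth_on U F" "smooth_on U G"
    "\<And>q. q \<in> U \<Longrightarrow> q \<in> M \<Longrightarrow> F q = f q" "\<And>q. q \<in> U \<Longrightarrow> q \<in> M \<Longrightarrow> G q = X q"
    by (rule smooth_map_extension2[OF assms(1) X(1) \<open>p \<in> M\<close>]) (rule that)
  have "frechet_derivative F (at q) (G q) = dir_deriv M f q (X q)" if "q \<in> U" "q \<in> M" for q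
    using dir_deriv_extension[OF U(1,3,5) that X(2)[OF that(2)]] U(6)[OF that] by simp
  then show "\<exists>U H. open U \<and> p \<in> U \<and> smooth_on U H \<and> (\<forall>q\<in>U \<inter> M. H q = dir_deriv M f q (X q))"
    using U smooth_on_frechet_derivative[OF U(1,3,4)]
    by (intro exI[of _ U] exI[of _ "\<lambda>q. frechet_derivative F (at q) (G q)"]) auto
qed

text \<open>Splits the iterated derivative into the Hessian of the extension and a first-order term;
  each depends on the extension \<open>F\<close>, their sum does not.\<close>

lemma dir_deriv_dir_deriv:
  fixes f :: "'a::euclidean_space \<Rightarrow> 'b::real_normed_vector"
  assumes U: "open U" "smooth_on U F" "\<And>q. q \<in> U \<Longrightarrow> q \<in> M \<Longrightarrow> F q = f q" "p \<in> U" "p \<in> M"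
    and Y: "Y \<in> vector_fields M" and v: "v \<in> tangent_space M p"
  shows "dir_deriv M (\<lambda>q. dir_deriv M f q (Y q)) p v =
    frechet_derivative (\<lambda>q. frechet_derivative F (at q) (Y p)) (at p) v +
    frechet_derivative F (at p) (dir_deriv M Y p v)"
proof -
  have Y': "smooth_map M Y" "\<And>q. q \<in> M \<Longrightarrow> Y q \<in> tangent_space M q"
    using Y by (auto simp: vector_fields_def)
  obtain W G where W: "open W" "p \<in> W" "smooth_on W G" "\<And>q. q \<in> W \<Longrightarrow> q \<in> M \<Longrightarrow> G q = Y q"
    by (rule smooth_map_extension[OF Y'(1) \<open>p \<in> M\<close>]) (rule that)
  define U' where "U' = U \<inter> W"
  have U': "open U'" "p \<in> U'" "smooth_on U' F" "smooth_on U' G"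
    using U W by (auto simp: U'_def intro: smooth_on_subset)
  have eq: "frechet_derivative F (at q) (G q) = dir_deriv M f q (Y q)" if "q \<in> U'" "q \<in> M" for q
  proof -
    have "q \<in> U" "q \<in> W" using that by (auto simp: U'_def)
    then show ?thesis
      using dir_deriv_extension[OF U(1-3) \<open>q \<in> U\<close> that(2) Y'(2)[OF that(2)]] W(4)[OF _ that(2)] by simp
  qed
  have "dir_deriv M (\<lambda>q. dir_deriv M f q (Y q)) p v =
      frechet_derivative (\<lambda>q. frechet_derivative F (at q) (G q)) (at p) v"
    by (rule dir_deriv_extension[OF U'(1) smooth_on_frechet_derivative[OF U'(1,3,4)] eq U'(2) U(5) v])
  also have "\<dots> = frechet_derivative (\<lambda>q. frechet_derivative F (at q) (G p)) (at p) v +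
      frechet_derivative F (at p) (frechet_derivative G (at p) v)"
    by (rule fun_cong[OF frechet_derivative_at[OF
      smooth_on_has_derivative_frechet_derivative[OF U'(1-4)], symmetric]])
  also have "frechet_derivative G (at p) v = dir_deriv M Y p v"
    by (rule dir_deriv_extension[OF W(1,3,4,2) U(5) v, symmetric])
  also have "G p = Y p" using W U by simp
  finally show ?thesis .
qed

section \<open>The Levi-Civita connection\<close>

lemma vector_fieldsD:
  assumes "X \<in> vector_fields M"
  shows "smooth_map M X" "p \<in> M \<Longrightarrow> X p \<in> tangent_space M p"
  using assms by (auto simp: vector_fields_def)

lemma vector_fields_diff:
  assumes "X \<in> vector_fields M" "Y \<in> vector_fields M"
  shows "(\<lambda>q. X q - Y q) \<in> vector_fields M"
  using assms by (auto simp: vector_fields_def tangent_space_def intro: smooth_map_diff span_diff)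

lemma subspace_tangent_space: "subspace (tangent_space M p)"
  by (simp add: tangent_space_def subspace_span)

lemma riemannian_metricD:
  assumes "riemannian_metric M g" "p \<in> M" "u \<in> tangent_space M p" "v \<in> tangent_space M p"
  shows "g p u v = g p v u" "w \<in> tangent_space M p \<Longrightarrow> g p (u + w) v = g p u v + g p w v"
    "w \<in> tangent_space M p \<Longrightarrow> g p (u - w) v = g p u v - g p w v"
    "u \<noteq> 0 \<Longrightarrow> g p u u > 0"
proof -
  note sub = subspace_scale[OF subspace_tangent_space]
  have g: "g p u v = g p v u" "g p (u + v) w = g p u w + g p v w" "g p (c *\<^sub>R u) v = c * g p u v"
    if "u \<in> tangent_space M p" "v \<in> tangent_space M p" "w \<in> tangent_space M p" for u v w c
    using assms(1,2) that unfolding riemannian_metric_def by blast+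
  show "g p u v = g p v u" using g assms by blast
  show "g p (u + w) v = g p u v + g p w v" if "w \<in> tangent_space M p"
    using g(2)[of u w v] assms that by blast
  show "g p (u - w) v = g p u v - g p w v" if w: "w \<in> tangent_space M p"
    using g(2)[of u "(-1) *\<^sub>R w" v] g(3)[of w v w "-1"] assms w sub[OF w, of "-1"] by simp
  show "g p u u > 0" if "u \<noteq> 0"
    using assms(1-3) that unfolding riemannian_metric_def by blast
qed

lemma is_levi_civitaD:
  assumes "is_levi_civita M g D" "X \<in> vector_fields M" "Y \<in> vector_fields M"
  shows "D X Y \<in> vector_fields M"
    "p \<in> M \<Longrightarrow> D X Y p - D Y X p = lie_bracket M X Y p"
    "Z \<in> vector_fields M \<Longrightarrow> p \<in> M \<Longrightarrow>
      dir_deriv M (\<lambda>q. g q (Y q) (Z q)) p (X p) = g p (D X Y p) (Z p) + g p (Y p) (D X Z p)"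
proof -
  note * = bspec[OF bspec[OF assms(1)[unfolded is_levi_civita_def] assms(2)] assms(3)]
  show "D X Y \<in> vector_fields M"
    using * by (rule conjunct1)
  show "p \<in> M \<Longrightarrow> D X Y p - D Y X p = lie_bracket M X Y p"
    using *[THEN conjunct2, THEN conjunct2, THEN conjunct2, THEN conjunct1] by simp
  show "Z \<in> vector_fields M \<Longrightarrow> p \<in> M \<Longrightarrow>
      dir_deriv M (\<lambda>q. g q (Y q) (Z q)) p (X p) = g p (D X Y p) (Z p) + g p (Y p) (D X Z p)"
    using *[THEN conjunct2, THEN conjunct2, THEN conjunct2, THEN conjunct2] by simp
qed

text \<open>The difference \<open>T\<close> of two such connections is symmetric because both are torsion-free, and
  \<open>g(T(X,Y),Z)\<close> is skew in \<open>Y\<close>, \<open>Z\<close> because both are metric; an expression with these two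
  symmetries vanishes. This replaces Koszul's formula.\<close>

lemma is_levi_civita_unique:
  assumes g: "riemannian_metric M g" and D: "is_levi_civita M g D" and D': "is_levi_civita M g D'"
    and X: "X \<in> vector_fields M" and Y: "Y \<in> vector_fields M" and p: "p \<in> M"
  shows "D X Y p = D' X Y p"
proof -
  define T where "T X Y q = D X Y q - D' X Y q" for X Y q
  have D_vf: "D X Y \<in> vector_fields M" "D' X Y \<in> vector_fields M"
    if "X \<in> vector_fields M" "Y \<in> vector_fields M" for X Y
    using is_levi_civitaD(1)[OF D that] is_levi_civitaD(1)[OF D' that] .
  have tan: "D X Y p \<in> tangent_space M p" "D' X Y p \<in> tangent_space M p"
    if "X \<in> vector_fields M" "Y \<in> vector_fields M" for X Y
    using D_vf[OF that] p by (auto dest: vector_fieldsD)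
  have T_vf: "T X Y \<in> vector_fields M" if "X \<in> vector_fields M" "Y \<in> vector_fields M" for X Y
    unfolding T_def using D_vf[OF that] by (rule vector_fields_diff)
  have sym: "T X Y p = T Y X p" if "X \<in> vector_fields M" "Y \<in> vector_fields M" for X Y
  proof -
    have "D X Y p - D Y X p = lie_bracket M X Y p" "D' X Y p - D' Y X p = lie_bracket M X Y p"
      using is_levi_civitaD(2)[OF D that p] is_levi_civitaD(2)[OF D' that p] .
    then show ?thesis unfolding T_def by (simp add: algebra_simps)
  qed
  have skew: "g p (T X Y p) (Z p) = - g p (T X Z p) (Y p)"
    if "X \<in> vector_fields M" "Y \<in> vector_fields M" "Z \<in> vector_fields M" for X Y Z
  proof -
    have *: "g p (D X Y p) (Z p) + g p (Y p) (D X Z p) = g p (D' X Y p) (Z p) + g p (Y p) (D' X Z p)"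
      using is_levi_civitaD(3)[OF D that p] is_levi_civitaD(3)[OF D' that p] by simp
    note t = vector_fieldsD(2)[OF that(2) p] vector_fieldsD(2)[OF that(3) p]
      tan[OF that(1,2)] tan[OF that(1,3)]
    show ?thesis
      unfolding T_def using * riemannian_metricD(1)[OF g p t(1) t(5)] riemannian_metricD(1)[OF g p t(1) t(6)]
        riemannian_metricD(3)[OF g p t(3,2,4)] riemannian_metricD(3)[OF g p t(5,1,6)] by linarith
  qed
  (* Writing XYZ for g(T(X,Y),Z): XYZ = - XZY = - ZXY = ZYX = YZX = - YXZ = - XYZ. *)
  have zero: "g p (T X Y p) (Z p) = 0"
    if V: "X \<in> vector_fields M" "Y \<in> vector_fields M" "Z \<in> vector_fields M" for X Y Z
    using skew[OF V] sym[OF V(1,3)] skew[OF V(3,1,2)] sym[OF V(3,2)] skew[OF V(2,3,1)] sym[OF V(2,1)]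
    by simp
  have "g p (T X Y p) (T X Y p) = 0"
    using zero[OF X Y T_vf[OF X Y]] by simp
  then have "T X Y p = 0"
    using riemannian_metricD(4)[OF g p] vector_fieldsD(2)[OF T_vf[OF X Y] p] by force
  then show ?thesis by (simp add: T_def)
qed

lemma levi_civita_eq:
  assumes "riemannian_metric M g" "is_levi_civita M g D"
    "X \<in> vector_fields M" "Y \<in> vector_fields M" "p \<in> M"
  shows "levi_civita M g X Y p = D X Y p"
  using assms is_levi_civita_unique[of M g "levi_civita M g" D]
  unfolding levi_civita_def by (metis someI)

section \<open>The Lorentz form\<close>

lemma lorentz_eq: "lorentz x y = snd x \<bullet> snd y - fst x * fst y"
  by (simp add: lorentz_def inner_vec_def)

lemma bounded_bilinear_lorentz: "bounded_bilinear lorentz"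
proof -
  have "bounded_linear (\<lambda>y::'a minkowski. (- fst y, snd y))"
    by (intro bounded_linear_Pair bounded_linear_minus bounded_linear_fst bounded_linear_snd)
  from bounded_bilinear.comp[OF bounded_bilinear_inner bounded_linear_ident this]
  show ?thesis by (simp add: inner_prod_def lorentz_eq[abs_def])
qed

interpretation lorentz: bounded_bilinear lorentz
  by (rule bounded_bilinear_lorentz)

lemma lorentz_commute: "lorentz x y = lorentz y x"
  by (simp add: lorentz_eq inner_commute mult.commute)

lemmas lorentz_simps = lorentz.add_left lorentz.add_right lorentz.diff_left lorentz.diff_right
  lorentz.scaleR_left lorentz.scaleR_right lorentz.minus_left lorentz.minus_right
  lorentz.zero_left lorentz.zero_right

lemma hyperboloid_lorentz: "p \<in> hyperboloid \<Longrightarrow> lorentz p p = -1"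
  by (simp add: hyperboloid_def)

text \<open>The orthogonal complement of a timelike vector is spacelike, by the Cauchy--Schwarz
  inequality for the spatial parts.\<close>

lemma lorentz_pos:
  assumes "lorentz p p = -1" "lorentz p u = 0" "u \<noteq> 0"
  shows "lorentz u u > 0"
proof (rule ccontr)
  assume "\<not> lorentz u u > 0"
  then have 1: "(norm (snd u))\<^sup>2 \<le> (fst u)\<^sup>2"
    by (simp add: lorentz_eq power2_norm_eq_inner flip: power2_eq_square)
  have p: "(fst p)\<^sup>2 = 1 + (norm (snd p))\<^sup>2"
    using assms(1) by (simp add: lorentz_eq power2_norm_eq_inner flip: power2_eq_square)
  have "(fst p)\<^sup>2 * (fst u)\<^sup>2 = (snd p \<bullet> snd u)\<^sup>2"
    using assms(2) by (simp add: lorentz_eq flip: power_mult_distrib)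
  also have "\<dots> \<le> (norm (snd p))\<^sup>2 * (norm (snd u))\<^sup>2"
    using Cauchy_Schwarz_ineq[of "snd p" "snd u"] by (simp add: power2_norm_eq_inner)
  also have "\<dots> \<le> (norm (snd p))\<^sup>2 * (fst u)\<^sup>2"
    using 1 by (simp add: mult_left_mono)
  finally have "(fst u)\<^sup>2 \<le> 0" unfolding p by (simp add: algebra_simps)
  then have "fst u = 0" by simp
  moreover from this 1 have "snd u = 0" by simp
  ultimately show False using assms(3) by (simp add: prod_eq_iff)
qed

lemma sum_mult_delta:
  fixes f :: "'b \<Rightarrow> real"
  assumes "finite A" "k \<in> A"
  shows "(\<Sum>x\<in>A. f x * (if x = k then 1 else 0)) = f k"
proof -
  have "(\<Sum>x\<in>A. f x * (if x = k then 1 else 0)) = (\<Sum>x\<in>A. if x = k then f x else 0)"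
    by (intro sum.cong) auto
  then show ?thesis using assms by simp
qed

text \<open>The ideal point of the horoballs \<open>V_h \<le> c\<close>, represented by a null vector.\<close>

definition null_vec :: "'n::finite \<Rightarrow> 'n minkowski" where
  "null_vec i = (1, axis i 1)"

lemma lorentz_null_vec: "lorentz x (null_vec i) = - V_h i x" "lorentz (null_vec i) x = - V_h i x"
  by (simp_all add: lorentz_eq null_vec_def V_h_def V0_def V_coord_def inner_axis inner_axis')

lemma V_h_null_vec [simp]: "V_h i (null_vec i) = 0"
  by (simp add: null_vec_def V_h_def V0_def V_coord_def)

lemma linear_V_h: "linear (V_h i)"
  by (auto simp: linear_iff V_h_def V0_def V_coord_def algebra_simps)

lemmas V_h_simps = linear_add[OF linear_V_h] linear_diff[OF linear_V_h]
  linear_scale[OF linear_V_h] linear_neg[OF linear_V_h] linear_0[OF linear_V_h]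

lemma linear_V_coord: "linear (V_coord i)"
  by (auto simp: linear_iff V_coord_def)

lemma V_coord_null_vec: "j \<noteq> i \<Longrightarrow> V_coord j (null_vec i) = 0"
  by (simp add: V_coord_def null_vec_def axis_def)

definition spatial :: "'n::finite \<Rightarrow> 'n minkowski" where
  "spatial i = (0, axis i 1)"

lemma lorentz_spatial: "lorentz x (spatial i) = V_coord i x" "lorentz (spatial i) x = V_coord i x"
  by (simp_all add: lorentz_eq spatial_def V_coord_def inner_axis inner_axis')

lemma V_h_spatial: "j \<noteq> i \<Longrightarrow> V_h i (spatial j) = 0"
  by (simp add: spatial_def V_h_def V0_def V_coord_def axis_def)

lemma V_spatial [simp]: "V0 (spatial j) = 0" "V_coord i (spatial j) = (if i = j then 1 else 0)"
  by (simp_all add: spatial_def V0_def V_coord_def axis_def)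

definition time_vec :: "'n::finite minkowski" where
  "time_vec = (1, 0)"

lemma V_time_vec [simp]: "V0 time_vec = 1" "V_coord j time_vec = 0" "V_h i time_vec = 1"
  by (simp_all add: time_vec_def V0_def V_coord_def V_h_def)

lemma linear_V0: "linear V0"
  by (auto simp: linear_iff V0_def)

lemmas coord_simps = linear_add[OF linear_V0] linear_diff[OF linear_V0] linear_scale[OF linear_V0]
  linear_add[OF linear_V_coord] linear_diff[OF linear_V_coord] linear_scale[OF linear_V_coord]

lemma minkowski_eqI: "V0 x = V0 y \<Longrightarrow> (\<And>j. V_coord j x = V_coord j y) \<Longrightarrow> x = y"
  by (auto simp: V0_def V_coord_def prod_eq_iff vec_eq_iff)

lemma lorentz_time_vec: "lorentz x time_vec = - V0 x" "lorentz time_vec x = - V0 x"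
  by (simp_all add: lorentz_eq time_vec_def V0_def)

text \<open>In the coordinates \<open>s = x\<^sub>0 - x\<^sub>1\<close>, \<open>w = x\<^sub>0 + x\<^sub>1\<close> the hyperboloid is \<open>s w = 1 + \<bar>z\<bar>\<^sup>2\<close>.\<close>

lemma lorentz_self_light_cone:
  "lorentz x x = (\<Sum>j\<in>UNIV - {i}. (V_coord j x)\<^sup>2) - V_h i x * (V0 x + V_coord i x)"
proof -
  have "(\<Sum>j\<in>UNIV. snd x $ j * snd x $ j) = snd x $ i * snd x $ i + (\<Sum>j\<in>UNIV - {i}. (V_coord j x)\<^sup>2)"
    by (subst sum.remove[of _ i]) (auto simp: V_coord_def power2_eq_square)
  then show ?thesis
    by (simp add: lorentz_def V_h_def V0_def V_coord_def algebra_simps)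
qed

text \<open>As \<open>s w = 1 + \<bar>z\<bar>\<^sup>2\<close> is positive, \<open>s\<close> and \<open>w\<close> have the same sign, which is that of
  \<open>2 x\<^sub>0 = s + w\<close>: the function \<open>V_h\<close> selects the upper sheet.\<close>

lemma hyperboloid_iff_V_h:
  "x \<in> hyperboloid \<longleftrightarrow> lorentz x x = -1 \<and> V_h i x > 0"
proof (cases "lorentz x x = -1")
  case True
  have "(\<Sum>j\<in>UNIV - {i}. (V_coord j x)\<^sup>2) \<ge> 0" by (intro sum_nonneg) auto
  then have *: "V_h i x * (V0 x + V_coord i x) > 0"
    using True lorentz_self_light_cone[of x i] by linarith
  then have "V_h i x > 0 \<longleftrightarrow> V0 x + V_coord i x > 0"
    by (metis mult.commute zero_less_mult_pos)
  moreover have "2 * fst x = V_h i x + (V0 x + V_coord i x)" by (simp add: V_h_def V0_def)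
  moreover have "V_h i x \<noteq> 0" "V0 x + V_coord i x \<noteq> 0" using * by auto
  ultimately show ?thesis using True by (auto simp: hyperboloid_def)
qed (auto simp: hyperboloid_def)

lemma V_h_pos: "x \<in> hyperboloid \<Longrightarrow> V_h i x > 0"
  by (simp add: hyperboloid_iff_V_h[of _ i])

section \<open>Riemannian geometry of pieces of hyperbolic space\<close>

text \<open>The unit vector in the direction of the gradient of \<open>V_h\<close>. The gradient is the tangential
  part of \<open>- N\<close>, namely \<open>V_h(p) p - N\<close>, and has length \<open>V_h(p)\<close>.\<close>

definition horo_normal :: "'n::finite \<Rightarrow> 'n minkowski \<Rightarrow> 'n minkowski" where
  "horo_normal i p = p - (1 / V_h i p) *\<^sub>R null_vec i"

text \<open>An orthonormal frame adapted to the horospheres: the normal, and the coordinate vectors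
  \<open>e\<^sub>j\<close> made tangent by a multiple of the null vector, which changes no inner product among
  them.\<close>

definition horo_frame :: "'n::finite \<Rightarrow> 'n minkowski \<Rightarrow> 'n \<Rightarrow> 'n minkowski" where
  "horo_frame i p j = (if j = i then horo_normal i p else spatial j + (V_coord j p / V_h i p) *\<^sub>R null_vec i)"

lemma horo_normal:
  assumes "p \<in> hyperboloid"
  shows "lorentz p (horo_normal i p) = 0" "lorentz (horo_normal i p) (horo_normal i p) = 1"
    "V_h i (horo_normal i p) = V_h i p"
    "lorentz p v = 0 \<Longrightarrow> lorentz (horo_normal i p) v = V_h i v / V_h i p"
  using V_h_pos[OF assms, of i] hyperboloid_lorentz[OF assms]
  by (simp_all add: horo_normal_def lorentz_simps lorentz_null_vec V_h_simps)

lemma horo_frame: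
  assumes p: "p \<in> hyperboloid"
  shows "lorentz p (horo_frame i p j) = 0"
    "lorentz (horo_frame i p j) (horo_frame i p k) = (if j = k then 1 else 0)"
proof -
  have s: "V_h i p \<noteq> 0" using V_h_pos[OF p, of i] by simp
  show "lorentz p (horo_frame i p j) = 0"
    using s horo_normal(1)[OF p] by (simp add: horo_frame_def lorentz_simps lorentz_null_vec lorentz_spatial)
  have *: "lorentz p (spatial j + (V_coord j p / V_h i p) *\<^sub>R null_vec i) = 0" for j
    using s by (simp add: lorentz_simps lorentz_null_vec lorentz_spatial)
  have normal: "lorentz (horo_normal i p) (horo_frame i p j) = 0" if "j \<noteq> i" for j
    using horo_normal(4)[OF p *[of j], of i] that by (simp add: horo_frame_def V_h_simps V_h_spatial)
  show "lorentz (horo_frame i p j) (horo_frame i p k) = (if j = k then 1 else 0)"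
  proof (cases "j = i \<or> k = i")
    case True
    then show ?thesis
    proof
      assume "j = i"
      then show ?thesis
        using horo_normal(2)[OF p] normal[of k] by (cases "k = i") (auto simp: horo_frame_def)
    next
      assume "k = i"
      then show ?thesis
        using horo_normal(2)[OF p] normal[of j]
        by (subst lorentz_commute, cases "j = i") (auto simp: horo_frame_def)
    qed
  next
    case False
    then show ?thesis
      by (simp add: horo_frame_def lorentz_simps lorentz_null_vec lorentz_spatial V_h_spatial
          V_h_simps linear_add[OF linear_V_coord] linear_scale[OF linear_V_coord] V_coord_null_vec)
  qed
qed

lemma inj_horo_frame: "p \<in> hyperboloid \<Longrightarrow> inj (horo_frame i p)"
  by (rule injI) (metis horo_frame(2) zero_neq_one)

lemma horo_frame_span:
  assumes p: "p \<in> hyperboloid"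
  shows "span (range (horo_frame i p)) = {v. lorentz p v = 0}" (is "?S = ?T")
proof
  have "subspace ?T" by (auto simp: subspace_def lorentz_simps)
  then show "?S \<subseteq> ?T" by (intro span_minimal) (auto simp: horo_frame[OF p])
next
  show "?T \<subseteq> ?S"
  proof
    fix v assume "v \<in> ?T"
    then have v: "lorentz p v = 0" by simp
    define r where "r = v - (\<Sum>j\<in>UNIV. lorentz v (horo_frame i p j) *\<^sub>R horo_frame i p j)"
    have rp: "lorentz p r = 0"
      using v by (simp add: r_def lorentz_simps lorentz.sum_right horo_frame[OF p])
    have r: "lorentz r (horo_frame i p k) = 0" for k
      unfolding r_def lorentz.diff_left lorentz.sum_left lorentz.scaleR_left horo_frame(2)[OF p] by (simp add: sum_mult_delta)
    have s: "V_h i p > 0" using V_h_pos[OF p] .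
    have rh: "V_h i r = 0"
      using r[of i] horo_normal(4)[OF p rp, of i] s
      by (simp add: horo_frame_def lorentz_commute[of r])
    have rj: "V_coord j r = 0" if "j \<noteq> i" for j
      using r[of j] that rh by (simp add: horo_frame_def lorentz_simps lorentz_spatial lorentz_null_vec)
    have "lorentz r r = 0"
      using rh rj by (simp add: lorentz_self_light_cone[of r i])
    then have "r = 0"
      using lorentz_pos[OF hyperboloid_lorentz[OF p] rp] by fastforce
    then have "v = (\<Sum>j\<in>UNIV. lorentz v (horo_frame i p j) *\<^sub>R horo_frame i p j)"
      by (simp add: r_def)
    also have "\<dots> \<in> ?S" by (intro span_sum span_scale span_base) auto
    finally show "v \<in> ?S" .
  qed
qed

text \<open>A subset of the hyperboloid that has full tangent spaces, with or without boundary. Everything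
  of the Riemannian geometry that is local takes place here.\<close>

locale hyperbolic_piece =
  fixes M :: "'n::finite minkowski set"
  assumes subset_hyperboloid: "M \<subseteq> hyperboloid"
    and tangent_space_eq: "\<And>p. p \<in> M \<Longrightarrow> tangent_space M p = {v. lorentz p v = 0}"
begin

lemma lorentz_self: "p \<in> M \<Longrightarrow> lorentz p p = -1"
  using subset_hyperboloid hyperboloid_lorentz by blast

lemma tangent_iff: "p \<in> M \<Longrightarrow> v \<in> tangent_space M p \<longleftrightarrow> lorentz p v = 0"
  by (simp add: tangent_space_eq)

lemma vector_fields_iff:
  "X \<in> vector_fields M \<longleftrightarrow> smooth_map M X \<and> (\<forall>p\<in>M. lorentz p (X p) = 0)"
  by (auto simp: vector_fields_def tangent_iff)

lemma vector_field_tangent: "X \<in> vector_fields M \<Longrightarrow> p \<in> M \<Longrightarrow> lorentz p (X p) = 0"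
  by (simp add: vector_fields_iff)

text \<open>The tangential projection of a constant vector: it extends any given tangent vector to a
  vector field.\<close>

lemma projected_constant_vector_field:
  "(\<lambda>q. v + lorentz v q *\<^sub>R q) \<in> vector_fields M"
  unfolding vector_fields_iff
proof (intro conjI ballI)
  show "smooth_map M (\<lambda>q. v + lorentz v q *\<^sub>R q)"
    by (intro smooth_map_add smooth_map_const smooth_map_scaleR smooth_map_ident
        smooth_map_bounded_bilinear[OF bounded_bilinear_lorentz])
  show "lorentz p (v + lorentz v p *\<^sub>R p) = 0" if "p \<in> M" for p
    using lorentz_self[OF that] by (simp add: lorentz_simps lorentz_commute)
qed

lemma field_ext:
  assumes "p \<in> M" "lorentz p v = 0"
  shows "field_ext M p v \<in> vector_fields M" "field_ext M p v p = v"
proof -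
  have "(\<lambda>q. v + lorentz v q *\<^sub>R q) \<in> vector_fields M \<and> v + lorentz v p *\<^sub>R p = v"
    using projected_constant_vector_field[of v] assms(2) by (simp add: lorentz_commute[of v p])
  then have "\<exists>X. X \<in> vector_fields M \<and> X p = v" by (intro exI) auto
  from someI_ex[OF this] show "field_ext M p v \<in> vector_fields M" "field_ext M p v p = v"
    unfolding field_ext_def by blast+
qed

lemma riemannian_metric: "riemannian_metric M hyp_metric"
  unfolding riemannian_metric_def hyp_metric_def
proof (intro conjI ballI allI impI)
  fix p u assume p: "p \<in> M" "u \<in> tangent_space M p" "u \<noteq> 0"
  then show "lorentz u u > 0" using lorentz_pos[OF lorentz_self[OF p(1)]] tangent_iff by blast
next
  fix X Y assume "X \<in> vector_fields M" "Y \<in> vector_fields M"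
  then show "smooth_map M (\<lambda>p. lorentz (X p) (Y p))"
    by (intro smooth_map_bounded_bilinear[OF bounded_bilinear_lorentz]) (auto simp: vector_fields_iff)
qed (auto simp: lorentz_simps intro: lorentz_commute)

text \<open>Derivatives of tangent fields leave the tangent space; the normal part is given by
  differentiating \<open>\<langle>q, Y q\<rangle> = 0\<close>.\<close>

lemma lorentz_dir_deriv:
  assumes Y: "Y \<in> vector_fields M" and p: "p \<in> M" and v: "lorentz p v = 0"
  shows "lorentz p (dir_deriv M Y p v) = - lorentz v (Y p)"
proof -
  have v': "v \<in> tangent_space M p" using p v by (simp add: tangent_iff)
  have "dir_deriv M (\<lambda>q. lorentz q (Y q)) p v = dir_deriv M (\<lambda>q. 0) p v"
    by (rule dir_deriv_cong[OF vector_field_tangent[OF Y] p])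
  also have "\<dots> = 0" by (rule dir_deriv_const[OF v'])
  finally show ?thesis
    using dir_deriv_bounded_bilinear[OF bounded_bilinear_lorentz smooth_map_ident vector_fieldsD(1)[OF Y] p v']
    by (simp add: dir_deriv_ident[OF v'])
qed

text \<open>The tangential part of the flat derivative.\<close>

definition hyp_connection where
  "hyp_connection X Y p = dir_deriv M Y p (X p) - lorentz (X p) (Y p) *\<^sub>R p"

lemma hyp_connection_cong:
  assumes "\<And>q. q \<in> M \<Longrightarrow> Y q = Z q" "p \<in> M"
  shows "hyp_connection X Y p = hyp_connection X Z p"
  using dir_deriv_cong[OF assms] assms by (simp add: hyp_connection_def)

lemma hyp_connection_vector_field:
  assumes "X \<in> vector_fields M" "Y \<in> vector_fields M"
  shows "hyp_connection X Y \<in> vector_fields M"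
  unfolding vector_fields_iff
proof (intro conjI ballI)
  show "smooth_map M (hyp_connection X Y)"
    unfolding hyp_connection_def[abs_def]
    by (intro smooth_map_diff smooth_map_dir_deriv smooth_map_scaleR smooth_map_ident
        smooth_map_bounded_bilinear[OF bounded_bilinear_lorentz] vector_fieldsD assms)
  show "lorentz p (hyp_connection X Y p) = 0" if p: "p \<in> M" for p
    using lorentz_dir_deriv[OF assms(2) p vector_field_tangent[OF assms(1) p]] lorentz_self[OF p]
    by (simp add: hyp_connection_def lorentz_simps)
qed

lemma is_levi_civita_hyp_connection: "is_levi_civita M hyp_metric hyp_connection"
  unfolding is_levi_civita_def hyp_metric_def
proof (intro ballI conjI allI impI)
  fix X Y assume X: "X \<in> vector_fields M" and Y: "Y \<in> vector_fields M"
  note sX = vector_fieldsD(1)[OF X] and sY = vector_fieldsD(1)[OF Y]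
  show "hyp_connection X Y \<in> vector_fields M" by (rule hyp_connection_vector_field[OF X Y])
  fix p assume p: "p \<in> M"
  note tX = vector_fieldsD(2)[OF X p] and tY = vector_fieldsD(2)[OF Y p]
  show "hyp_connection X Y p - hyp_connection Y X p = lie_bracket M X Y p"
    by (simp add: hyp_connection_def lie_bracket_def lorentz_commute)
  {
    fix Z assume Z: "Z \<in> vector_fields M"
    note sZ = vector_fieldsD(1)[OF Z]
    show "hyp_connection (\<lambda>q. X q + Z q) Y p = hyp_connection X Y p + hyp_connection Z Y p"
      by (simp add: hyp_connection_def linear_add[OF linear_dir_deriv[OF sY p]] lorentz_simps algebra_simps)
    show "hyp_connection X (\<lambda>q. Y q + Z q) p = hyp_connection X Y p + hyp_connection X Z p"
      by (simp add: hyp_connection_def dir_deriv_add[OF sY sZ p tX] lorentz_simps algebra_simps)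
    show "dir_deriv M (\<lambda>q. lorentz (Y q) (Z q)) p (X p) =
        lorentz (hyp_connection X Y p) (Z p) + lorentz (Y p) (hyp_connection X Z p)"
      using vector_field_tangent[OF Z p] vector_field_tangent[OF Y p]
      by (simp add: hyp_connection_def dir_deriv_bounded_bilinear[OF bounded_bilinear_lorentz sY sZ p tX]
          lorentz_simps lorentz_commute[of "Y p" p])
  }
  fix f assume f: "smooth_map M (f :: 'n minkowski \<Rightarrow> real)"
  show "hyp_connection (\<lambda>q. f q *\<^sub>R X q) Y p = f p *\<^sub>R hyp_connection X Y p"
    by (simp add: hyp_connection_def linear_scale[OF linear_dir_deriv[OF sY p]] lorentz_simps algebra_simps)
  show "hyp_connection X (\<lambda>q. f q *\<^sub>R Y q) p =
      dir_deriv M f p (X p) *\<^sub>R Y p + f p *\<^sub>R hyp_connection X Y p"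
    by (simp add: hyp_connection_def dir_deriv_bounded_bilinear[OF bounded_bilinear_scaleR f sY p tX]
        lorentz_simps algebra_simps)
qed

lemma levi_civita_eq_hyp_connection:
  "X \<in> vector_fields M \<Longrightarrow> Y \<in> vector_fields M \<Longrightarrow> p \<in> M \<Longrightarrow>
    levi_civita M hyp_metric X Y p = hyp_connection X Y p"
  by (rule levi_civita_eq[OF riemannian_metric is_levi_civita_hyp_connection])

lemma dir_deriv_hyp_connection:
  assumes Y: "Y \<in> vector_fields M" and Z: "Z \<in> vector_fields M" and p: "p \<in> M"
    and u: "u \<in> tangent_space M p"
  shows "dir_deriv M (hyp_connection Y Z) p u = dir_deriv M (\<lambda>q. dir_deriv M Z q (Y q)) p u
    - (lorentz (Y p) (dir_deriv M Z p u) + lorentz (dir_deriv M Y p u) (Z p)) *\<^sub>R p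
    - lorentz (Y p) (Z p) *\<^sub>R u"
proof -
  note sY = vector_fieldsD(1)[OF Y] and sZ = vector_fieldsD(1)[OF Z]
  note l = smooth_map_bounded_bilinear[OF bounded_bilinear_lorentz sY sZ]
  note d = has_derivative_diff[OF smooth_map_has_derivative[OF smooth_map_dir_deriv[OF sZ Y] p]
      bounded_bilinear.FDERIV[OF bounded_bilinear_scaleR
        bounded_bilinear.FDERIV[OF bounded_bilinear_lorentz smooth_map_has_derivative[OF sY p]
          smooth_map_has_derivative[OF sZ p]] has_derivative_ident]]
  show ?thesis
    unfolding hyp_connection_def[abs_def] dir_deriv_eq[OF d u] by (simp add: algebra_simps)
qed

text \<open>Hyperbolic space has constant curvature \<open>-1\<close>. The second derivatives of \<open>Z\<close> cancel by
  symmetry, and the terms normal to the hyperboloid cancel because the result is tangent.\<close>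

lemma riemann_curvature_eq:
  assumes p: "p \<in> M" and u: "lorentz p u = 0" and v: "lorentz p v = 0" and w: "lorentz p w = 0"
  shows "riemann_curvature M hyp_metric p u v w = lorentz u w *\<^sub>R v - lorentz v w *\<^sub>R u"
proof -
  define D where "D = levi_civita M hyp_metric"
  define X where "X = field_ext M p u"
  define Y where "Y = field_ext M p v"
  define Z where "Z = field_ext M p w"
  have X: "X \<in> vector_fields M" "X p = u" and Y: "Y \<in> vector_fields M" "Y p = v"
    and Z: "Z \<in> vector_fields M" "Z p = w"
    unfolding X_def Y_def Z_def using field_ext[OF p] u v w by auto
  have D_eq: "D A B q = hyp_connection A B q"
    if "A \<in> vector_fields M" "B \<in> vector_fields M" "q \<in> M" for A B q
    unfolding D_def by (rule levi_civita_eq_hyp_connection[OF that])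
  have D_vf: "D A B \<in> vector_fields M" if "A \<in> vector_fields M" "B \<in> vector_fields M" for A B
    using hyp_connection_vector_field[OF that] D_eq[OF that]
    by (auto simp: vector_fields_iff intro: smooth_map_cong)
  have DD: "D A (D B C) p = hyp_connection A (hyp_connection B C) p"
    if "A \<in> vector_fields M" "B \<in> vector_fields M" "C \<in> vector_fields M" for A B C
    using D_eq[OF that(1) D_vf[OF that(2,3)] p] hyp_connection_cong[OF D_eq[OF that(2,3)] p] by simp
  have br: "lie_bracket M X Y \<in> vector_fields M"
  proof -
    have "lie_bracket M X Y = (\<lambda>q. hyp_connection X Y q - hyp_connection Y X q)"
      by (rule ext) (simp add: hyp_connection_def lie_bracket_def lorentz_commute)
    then show ?thesis
      using vector_fields_diff[OF hyp_connection_vector_field[OF X(1) Y(1)]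
          hyp_connection_vector_field[OF Y(1) X(1)]] by simp
  qed
  obtain U F where U: "open U" "p \<in> U" "smooth_on U F" "\<And>q. q \<in> U \<Longrightarrow> q \<in> M \<Longrightarrow> F q = Z q"
    by (rule smooth_map_extension[OF vector_fieldsD(1)[OF Z(1)] p]) (rule that)
  define A where "A = frechet_derivative F (at p)"
  define B where "B a b = frechet_derivative (\<lambda>q. frechet_derivative F (at q) a) (at p) b" for a b
  have lin: "linear A"
    unfolding A_def using smooth_on_has_derivative[OF U(3,2)] by (rule has_derivative_linear)
  have B: "B u v = B v u"
    unfolding B_def by (rule second_derivative_symmetric[OF U(1-3)])
  have tu: "u \<in> tangent_space M p" "v \<in> tangent_space M p"
    using u v p by (simp_all add: tangent_iff)
  have br_t: "lie_bracket M X Y p \<in> tangent_space M p" using vector_fieldsD(2)[OF br p] .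
  have A: "dir_deriv M Z p a = A a" if "a \<in> tangent_space M p" for a
    unfolding A_def by (rule dir_deriv_extension[OF U(1,3,4,2) p that])
  have YZ: "dir_deriv M (\<lambda>q. dir_deriv M Z q (Y q)) p u = B v u + A (dir_deriv M Y p u)"
    using dir_deriv_dir_deriv[OF U(1,3,4,2) p Y(1) tu(1)] by (simp add: A_def B_def Y(2))
  have XZ: "dir_deriv M (\<lambda>q. dir_deriv M Z q (X q)) p v = B u v + A (dir_deriv M X p v)"
    using dir_deriv_dir_deriv[OF U(1,3,4,2) p X(1) tu(2)] by (simp add: A_def B_def X(2))
  have br_p: "lie_bracket M X Y p = dir_deriv M Y p u - dir_deriv M X p v"
    by (simp add: lie_bracket_def X(2) Y(2))
  have 1: "D X (D Y Z) p = B v u + A (dir_deriv M Y p u) - (lorentz v (A u) + lorentz (dir_deriv M Y p u) w) *\<^sub>R p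
      - lorentz v w *\<^sub>R u - lorentz u (A v) *\<^sub>R p"
    unfolding DD[OF X(1) Y(1) Z(1)] hyp_connection_def[of X] X(2)
      dir_deriv_hyp_connection[OF Y(1) Z(1) p tu(1)] YZ
    using u by (simp add: hyp_connection_def Y(2) Z(2) A tu lorentz_simps lorentz_commute[of u p])
  have 2: "D Y (D X Z) p = B u v + A (dir_deriv M X p v) - (lorentz u (A v) + lorentz (dir_deriv M X p v) w) *\<^sub>R p
      - lorentz u w *\<^sub>R v - lorentz v (A u) *\<^sub>R p"
    unfolding DD[OF Y(1) X(1) Z(1)] hyp_connection_def[of Y] Y(2)
      dir_deriv_hyp_connection[OF X(1) Z(1) p tu(2)] XZ
    using v by (simp add: hyp_connection_def X(2) Z(2) A tu lorentz_simps lorentz_commute[of v p])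
  have 3: "D (lie_bracket M X Y) Z p = A (dir_deriv M Y p u) - A (dir_deriv M X p v) -
      (lorentz (dir_deriv M Y p u) w - lorentz (dir_deriv M X p v) w) *\<^sub>R p"
    unfolding D_eq[OF br Z(1) p] hyp_connection_def Z(2) A[OF br_t]
    unfolding br_p by (simp add: linear_diff[OF lin] lorentz_simps)
  have "riemann_curvature M hyp_metric p u v w = D X (D Y Z) p - D Y (D X Z) p - D (lie_bracket M X Y) Z p"
    by (simp add: riemann_curvature_def Let_def D_def X_def Y_def Z_def)
  also have "\<dots> = lorentz u w *\<^sub>R v - lorentz v w *\<^sub>R u"
    unfolding 1 2 3 B by (simp add: algebra_simps)
  finally show ?thesis .
qed

lemma orthonormal_basis_expansion:
  assumes "orthonormal_basis M hyp_metric p B" "v \<in> tangent_space M p"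
  shows "(\<Sum>e\<in>B. lorentz v e *\<^sub>R e) = v"
proof -
  have B: "finite B" "span B = tangent_space M p"
    "\<And>u v. u \<in> B \<Longrightarrow> v \<in> B \<Longrightarrow> lorentz u v = (if u = v then 1 else 0)"
    using assms(1) by (auto simp: orthonormal_basis_def hyp_metric_def)
  have "v \<in> span B" using assms(2) B by simp
  then obtain c where c: "v = (\<Sum>e\<in>B. c e *\<^sub>R e)"
    unfolding span_finite[OF B(1)] by auto
  have "lorentz v e = c e" if "e \<in> B" for e
  proof -
    have "lorentz v e = (\<Sum>b\<in>B. c b * (if b = e then 1 else 0))"
      unfolding c lorentz.sum_left using that by (intro sum.cong) (auto simp: lorentz_simps B)
    then show ?thesis using B(1) that by (simp add: sum_mult_delta)
  qed
  then show ?thesis unfolding c by (intro sum.cong) (auto simp: c)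
qed

text \<open>The trace is defined with an unspecified orthonormal basis, so its size has to be compared
  with that of the explicit frame.\<close>

lemma orthonormal_basis_card:
  assumes p: "p \<in> M" and B: "orthonormal_basis M hyp_metric p B"
  shows "card B = CARD('n)"
proof -
  have indep: "independent C" if "finite C" "\<And>u v. u \<in> C \<Longrightarrow> v \<in> C \<Longrightarrow> lorentz u v = (if u = v then 1 else 0)"
    for C :: "'n minkowski set"
  proof (rule independent_if_scalars_zero[OF that(1)])
    fix f x assume "(\<Sum>x\<in>C. f x *\<^sub>R x) = 0" "x \<in> C"
    then have "0 = lorentz (\<Sum>b\<in>C. f b *\<^sub>R b) x" by (simp add: lorentz_simps)
    also have "\<dots> = (\<Sum>b\<in>C. f b * (if b = x then 1 else 0))"
      unfolding lorentz.sum_left using that \<open>x \<in> C\<close> by (intro sum.cong) (auto simp: lorentz_simps)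
    also have "\<dots> = f x" using that(1) \<open>x \<in> C\<close> by (simp add: sum_mult_delta)
    finally show "f x = 0" by simp
  qed
  have p': "p \<in> hyperboloid" using p subset_hyperboloid by blast
  obtain i :: 'n where True by simp
  note inj = inj_horo_frame[OF p', of i]
  have "card (range (horo_frame i p)) = dim (range (horo_frame i p))"
    by (rule dim_eq_card_independent[symmetric], rule indep)
      (simp, elim rangeE, simp add: horo_frame(2)[OF p'] inj_eq[OF inj])
  also have "\<dots> = dim (span B)"
    using B horo_frame_span[OF p', of i] by (metis dim_span orthonormal_basis_def tangent_space_eq[OF p])
  also have "\<dots> = card B"
    unfolding dim_span
    by (rule dim_eq_card_independent, rule indep)
      (use B in \<open>auto simp: orthonormal_basis_def hyp_metric_def\<close>)
  finally show ?thesis by (simp add: card_image[OF inj])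
qed

lemma metric_trace_eq:
  assumes p: "p \<in> M"
  obtains B where "orthonormal_basis M hyp_metric p B"
    "\<And>\<beta>. metric_trace M hyp_metric p \<beta> = (\<Sum>e\<in>B. \<beta> e e)"
proof -
  have p': "p \<in> hyperboloid" using p subset_hyperboloid by blast
  obtain i :: 'n where True by simp
  have "orthonormal_basis M hyp_metric p (range (horo_frame i p))"
    unfolding orthonormal_basis_def hyp_metric_def
    using horo_frame_span[OF p'] tangent_space_eq[OF p]
    by (simp add: horo_frame(2)[OF p'] inj_eq[OF inj_horo_frame[OF p']])
  from someI[of "orthonormal_basis M hyp_metric p", OF this] show ?thesis
    by (intro that[of "SOME B. orthonormal_basis M hyp_metric p B"]) (auto simp: metric_trace_def)
qed

lemma orthonormal_basis_tangent:
  "orthonormal_basis M hyp_metric p B \<Longrightarrow> e \<in> B \<Longrightarrow> e \<in> tangent_space M p"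
  by (metis orthonormal_basis_def span_base)

text \<open>Tracing \<open>R(e,v)w = \<langle>e,w\<rangle> v - \<langle>v,w\<rangle> e\<close> gives \<open>\<langle>v,w\<rangle> - n \<langle>v,w\<rangle>\<close>.\<close>

lemma ricci_eq:
  assumes p: "p \<in> M" and v: "lorentz p v = 0" and w: "lorentz p w = 0"
  shows "ricci M hyp_metric p v w = - (real CARD('n) - 1) * lorentz v w"
proof -
  obtain B where B: "orthonormal_basis M hyp_metric p B"
    "\<And>\<beta>. metric_trace M hyp_metric p \<beta> = (\<Sum>e\<in>B. \<beta> e e)"
    by (rule metric_trace_eq[OF p]) (rule that)
  have e: "lorentz p e = 0" "lorentz e e = 1" if "e \<in> B" for e
    using orthonormal_basis_tangent[OF B(1) that] B(1) that p
    by (auto simp: tangent_iff orthonormal_basis_def hyp_metric_def)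
  have "ricci M hyp_metric p v w =
      (\<Sum>e\<in>B. lorentz (riemann_curvature M hyp_metric p e v w) e)"
    by (simp add: ricci_def B(2) hyp_metric_def)
  also have "\<dots> = (\<Sum>e\<in>B. lorentz (lorentz v e *\<^sub>R e) w - lorentz v w)"
    using e by (intro sum.cong refl) (simp add: riemann_curvature_eq[OF p _ v w] lorentz_simps)
  also have "\<dots> = lorentz (\<Sum>e\<in>B. lorentz v e *\<^sub>R e) w - card B * lorentz v w"
    by (simp add: sum_subtractf lorentz.sum_left)
  also have "(\<Sum>e\<in>B. lorentz v e *\<^sub>R e) = v"
    using orthonormal_basis_expansion[OF B(1)] v p by (simp add: tangent_iff)
  finally show ?thesis
    by (simp add: orthonormal_basis_card[OF p B(1)] algebra_simps)
qed

text \<open>The second term comes from the normal part of the flat derivative: \<open>F\<close> is differentiated in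
  the radial direction \<open>p\<close>, which is normal to the hyperboloid. For a linear \<open>F\<close> the first term
  vanishes and the radial derivative is \<open>F p\<close>.\<close>

lemma hessian_eq:
  assumes U: "open U" "smooth_on U F" "\<And>q. q \<in> U \<Longrightarrow> q \<in> M \<Longrightarrow> F q = V q" "p \<in> U" "p \<in> M"
    and u: "lorentz p u = 0" and v: "lorentz p v = 0"
  shows "hessian M hyp_metric V p u v =
    frechet_derivative (\<lambda>q. frechet_derivative F (at q) v) (at p) u +
    lorentz u v * frechet_derivative F (at p) p"
proof -
  define X where "X = field_ext M p u"
  define Y where "Y = field_ext M p v"
  have X: "X \<in> vector_fields M" "X p = u" and Y: "Y \<in> vector_fields M" "Y p = v"
    unfolding X_def Y_def using field_ext[OF U(5)] u v by auto
  have tu: "u \<in> tangent_space M p" using u U(5) by (simp add: tangent_iff)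
  have lin: "linear (frechet_derivative F (at p))"
    using smooth_on_has_derivative[OF U(2,4)] by (rule has_derivative_linear)
  have "hyp_connection X Y p \<in> tangent_space M p"
    using hyp_connection_vector_field[OF X(1) Y(1)] U(5) by (rule vector_fieldsD)
  then have 1: "dir_deriv M V p (hyp_connection X Y p) = frechet_derivative F (at p) (hyp_connection X Y p)"
    using dir_deriv_extension[OF U] by blast
  have 2: "dir_deriv M (\<lambda>q. dir_deriv M V q (Y q)) p u =
      frechet_derivative (\<lambda>q. frechet_derivative F (at q) v) (at p) u +
      frechet_derivative F (at p) (dir_deriv M Y p u)"
    using dir_deriv_dir_deriv[OF U Y(1) tu] by (simp add: Y(2))
  have "hessian M hyp_metric V p u v =
      dir_deriv M (\<lambda>q. dir_deriv M V q (Y q)) p u - dir_deriv M V p (hyp_connection X Y p)"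
    using levi_civita_eq_hyp_connection[OF X(1) Y(1) U(5)] X(2)
    by (simp add: hessian_def Let_def X_def Y_def)
  then show ?thesis
    unfolding 2 unfolding 1 by (simp add: hyp_connection_def X(2) Y(2) linear_diff[OF lin] linear_scale[OF lin])
qed

lemma hessian_linear:
  assumes l: "linear l" and V: "\<And>q. q \<in> M \<Longrightarrow> V q = l q" and p: "p \<in> M"
    and u: "lorentz p u = 0" and v: "lorentz p v = 0"
  shows "hessian M hyp_metric V p u v = V p * lorentz u v"
proof -
  have bl: "bounded_linear l" using l by (simp add: linear_conv_bounded_linear)
  have d: "frechet_derivative l (at q) = l" for q
    using frechet_derivative_at[OF bounded_linear_imp_has_derivative[OF bl]] by metis
  have "hessian M hyp_metric V p u v = frechet_derivative (\<lambda>q. frechet_derivative l (at q) v) (at p) u +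
    lorentz u v * frechet_derivative l (at p) p"
    by (rule hessian_eq[OF open_UNIV smooth_on_bounded_linear[OF open_UNIV bl] _ UNIV_I p u v])
      (simp add: V)
  then show ?thesis unfolding d using V[OF p] by simp
qed

lemma laplacian_eq:
  assumes p: "p \<in> M"
    and H: "\<And>u v. lorentz p u = 0 \<Longrightarrow> lorentz p v = 0 \<Longrightarrow> hessian M hyp_metric V p u v = V p * lorentz u v"
  shows "laplacian M hyp_metric V p = real CARD('n) * V p"
proof -
  obtain B where B: "orthonormal_basis M hyp_metric p B"
    "\<And>\<beta>. metric_trace M hyp_metric p \<beta> = (\<Sum>e\<in>B. \<beta> e e)"
    by (rule metric_trace_eq[OF p]) (rule that)
  have "(\<Sum>e\<in>B. hessian M hyp_metric V p e e) = (\<Sum>e\<in>B. V p)"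
  proof (intro sum.cong refl)
    fix e assume "e \<in> B"
    then have "lorentz p e = 0" "lorentz e e = 1"
      using orthonormal_basis_tangent[OF B(1)] B(1) p
      by (auto simp: tangent_iff orthonormal_basis_def hyp_metric_def)
    then show "hessian M hyp_metric V p e e = V p" by (simp add: H)
  qed
  then show ?thesis
    by (simp add: laplacian_def B(2) orthonormal_basis_card[OF p B(1)])
qed

end

section \<open>Tangent cones\<close>

text \<open>It suffices that the curve stays in \<open>M\<close> for a short time: afterwards it may be replaced by
  the constant \<open>p\<close>, without effect on the velocity at \<open>0\<close>.\<close>

lemma tangent_coneI:
  assumes "\<gamma> 0 = p" "\<epsilon> > 0" "\<And>t. 0 \<le> t \<Longrightarrow> t < \<epsilon> \<Longrightarrow> \<gamma> t \<in> M"
    "(\<gamma> has_vector_derivative v) (at 0 within {0..1})"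
  shows "v \<in> tangent_cone M p"
proof -
  define \<gamma>' where "\<gamma>' t = (if t < \<epsilon> then \<gamma> t else p)" for t
  have "p \<in> M" using assms(1,2) assms(3)[of 0] by simp
  then have "\<forall>t\<in>{0..1}. \<gamma>' t \<in> M" using assms(3) by (auto simp: \<gamma>'_def)
  moreover have "(\<gamma>' has_vector_derivative v) (at 0 within {0..1})"
    using assms(4) unfolding has_vector_derivative_def
    by (rule has_derivative_transform_within[OF _ assms(2)]) (auto simp: \<gamma>'_def dist_real_def)
  moreover have "\<gamma>' 0 = p" using assms(1,2) by (simp add: \<gamma>'_def)
  ultimately show ?thesis unfolding tangent_cone_def by blast
qed

lemma one_sided_max_imp_derivative_le_0:
  assumes "(f has_real_derivative d) (at 0 within {0..1})"
    "\<forall>\<^sub>F t in at 0 within {0..1}. f t \<le> f 0"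
  shows "d \<le> 0"
proof (rule tendsto_upperbound)
  show "((\<lambda>t. (f t - f 0) / (t - 0)) \<longlongrightarrow> d) (at 0 within {0..1})"
    using assms(1) by (simp add: has_field_derivative_iff)
  have "\<forall>\<^sub>F t in at 0 within {0..1::real}. t \<in> {0..1}"
    by (auto simp: eventually_at_topological)
  with assms(2) show "\<forall>\<^sub>F t in at 0 within {0..1}. (f t - f 0) / (t - 0) \<le> 0"
    by eventually_elim (auto simp: divide_nonpos_nonneg)
qed (rule at_0_within_Icc_neq_bot)

text \<open>This makes being a boundary point independent of the chart: in a half-space chart the inward
  direction \<open>e\<close> is the velocity of a curve in \<open>M\<close>, whereas a curve with velocity \<open>- e\<close> leaves the
  half-space. Where the tangent cone is a linear space there is no such chart.\<close>

lemma boundary_point_tangent_cone: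
  fixes M :: "'a::euclidean_space set"
  assumes "boundary_point n M p" "p \<in> M"
  obtains v where "v \<in> tangent_cone M p" "- v \<notin> tangent_cone M p"
proof -
  obtain U \<psi> L e where U: "p \<in> U" "diffeo_on U \<psi>" "subspace L" "e \<in> L" "e \<noteq> 0" "\<psi> p \<bullet> e = 0"
    and M: "\<psi> ` (U \<inter> M) = \<psi> ` U \<inter> {z \<in> L. z \<bullet> e \<ge> 0}"
    using assms(1) unfolding boundary_point_def by blast
  define \<phi> where "\<phi> = inv_into U \<psi>"
  have \<psi>: "open U" "open (\<psi> ` U)" "inj_on \<psi> U" "smooth_on U \<psi>" "smooth_on (\<psi> ` U) \<phi>"
    using U(2) by (auto simp: diffeo_on_def \<phi>_def)
  have inv: "\<phi> (\<psi> x) = x" if "x \<in> U" for x using \<psi>(3) that by (simp add: \<phi>_def)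
  have p: "\<psi> p \<in> \<psi> ` U" using U(1) by blast
  define A where "A = frechet_derivative \<phi> (at (\<psi> p))"
  define B where "B = frechet_derivative \<psi> (at p)"
  have A: "(\<phi> has_derivative A) (at (\<psi> p))" unfolding A_def by (rule smooth_on_has_derivative[OF \<psi>(5) p])
  have B: "(\<psi> has_derivative B) (at p)" unfolding B_def by (rule smooth_on_has_derivative[OF \<psi>(4) U(1)])
  have BA: "B (A x) = x" for x
  proof -
    have "((\<lambda>z. \<psi> (\<phi> z)) has_derivative (\<lambda>x. B (A x))) (at (\<psi> p))"
      using has_derivative_compose[OF A, of \<psi> B] B inv[OF U(1)] by simp
    then have "((\<lambda>z. z) has_derivative (\<lambda>x. B (A x))) (at (\<psi> p))"
      by (rule has_derivative_transform_within_open[OF _ \<psi>(2) p]) (auto simp: \<phi>_def f_inv_into_f)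
    from has_derivative_unique[OF this has_derivative_ident] show ?thesis by metis
  qed
  have lin: "linear A" "linear B" using A B by (auto intro: has_derivative_linear)
  have "A e \<in> tangent_cone M p"
  proof -
    have "((\<lambda>t::real. \<psi> p + t *\<^sub>R e) \<longlongrightarrow> \<psi> p + 0 *\<^sub>R e) (at 0)"
      by (intro tendsto_intros)
    then have "\<forall>\<^sub>F t::real in at 0. \<psi> p + t *\<^sub>R e \<in> \<psi> ` U"
      by (rule topological_tendstoD[OF _ \<psi>(2)]) (use p in simp)
    then obtain \<epsilon> where \<epsilon>: "\<epsilon> > 0" "\<And>t::real. t \<noteq> 0 \<Longrightarrow> dist t 0 < \<epsilon> \<Longrightarrow> \<psi> p + t *\<^sub>R e \<in> \<psi> ` U"
      unfolding eventually_at by auto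
    show ?thesis
    proof (rule tangent_coneI[of "\<lambda>t. \<phi> (\<psi> p + t *\<^sub>R e)" p \<epsilon>])
      show "\<phi> (\<psi> p + t *\<^sub>R e) \<in> M" if "0 \<le> t" "t < \<epsilon>" for t
      proof -
        have "\<psi> p + t *\<^sub>R e \<in> \<psi> ` U"
          using \<epsilon>(2)[of t] that p by (cases "t = 0") auto
        moreover have "\<psi> p \<in> L" using M U(1) assms(2) by blast
        then have "\<psi> p + t *\<^sub>R e \<in> L" using U(3,4) by (intro subspace_add subspace_scale)
        moreover have "(\<psi> p + t *\<^sub>R e) \<bullet> e \<ge> 0" using U(6) that by (simp add: inner_add_left)
        ultimately have "\<psi> p + t *\<^sub>R e \<in> \<psi> ` (U \<inter> M)" using M by blast
        then obtain x where "x \<in> U" "x \<in> M" "\<psi> p + t *\<^sub>R e = \<psi> x" by auto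
        then show ?thesis using inv by simp
      qed
      have "((\<lambda>t::real. \<psi> p + t *\<^sub>R e) has_derivative (\<lambda>t. t *\<^sub>R e)) (at 0 within {0..1})"
        by (auto intro!: derivative_eq_intros)
      from has_derivative_compose[OF this, of \<phi> A] A
      show "((\<lambda>t. \<phi> (\<psi> p + t *\<^sub>R e)) has_vector_derivative A e) (at 0 within {0..1})"
        by (simp add: has_vector_derivative_def linear_scale[OF lin(1)])
    qed (use \<epsilon> inv U in auto)
  qed
  moreover have "- A e \<notin> tangent_cone M p"
  proof
    assume "- A e \<in> tangent_cone M p"
    then obtain \<gamma> where \<gamma>: "\<gamma> 0 = p" "\<forall>t\<in>{0..1::real}. \<gamma> t \<in> M"
      and d: "(\<gamma> has_derivative (\<lambda>t. t *\<^sub>R (- A e))) (at 0 within {0..1})"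
      by (auto simp: tangent_cone_def has_vector_derivative_def)
    have "((\<lambda>t. \<psi> (\<gamma> t)) has_derivative (\<lambda>t. B (t *\<^sub>R (- A e)))) (at 0 within {0..1})"
      using has_derivative_compose[OF d, of \<psi> B] B \<gamma>(1) by simp
    from has_derivative_minus[OF has_derivative_inner_left[OF this, of e]]
    have "((\<lambda>t. - (\<psi> (\<gamma> t) \<bullet> e)) has_real_derivative (e \<bullet> e)) (at 0 within {0..1})"
      by (simp add: has_field_derivative_def linear_scale[OF lin(2)] linear_neg[OF lin(2)] BA
          mult.commute mult_commute_abs)
    moreover have "\<forall>\<^sub>F t in at 0 within {0..1}. - (\<psi> (\<gamma> t) \<bullet> e) \<le> - (\<psi> (\<gamma> 0) \<bullet> e)"
    proof -
      have "continuous (at 0 within {0..1}) \<gamma>" using d by (rule has_derivative_continuous)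
      then have "(\<gamma> \<longlongrightarrow> p) (at 0 within {0..1})" using \<gamma>(1) by (simp add: continuous_within)
      then have "\<forall>\<^sub>F t in at 0 within {0..1}. \<gamma> t \<in> U"
        by (rule topological_tendstoD[OF _ \<psi>(1) U(1)])
      moreover have "\<forall>\<^sub>F t in at 0 within {0..1::real}. t \<in> {0..1}"
        by (auto simp: eventually_at_topological)
      ultimately show ?thesis
      proof eventually_elim
        case (elim t)
        then have "\<psi> (\<gamma> t) \<in> \<psi> ` (U \<inter> M)" using \<gamma>(2) by blast
        then show ?case using M \<gamma>(1) U(6) by simp
      qed
    qed
    ultimately have "e \<bullet> e \<le> 0" by (rule one_sided_max_imp_derivative_le_0)
    then show False using U(5) by (metis inner_gt_zero_iff not_le)
  qed
  ultimately show ?thesis by (rule that)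
qed

text \<open>Adding a multiple of the null vector brings the line \<open>p + t v\<close> back to the hyperboloid
  without changing \<open>V_h\<close>. So \<open>V_h\<close> is affine along these curves, and they stay in a horosphere
  if \<open>v\<close> is tangent to it.\<close>

definition horo_curve :: "'n::finite \<Rightarrow> 'n minkowski \<Rightarrow> 'n minkowski \<Rightarrow> real \<Rightarrow> 'n minkowski" where
  "horo_curve i p v t = p + t *\<^sub>R v + (t\<^sup>2 * lorentz v v / (2 * (V_h i p + t * V_h i v))) *\<^sub>R null_vec i"

lemma V_h_horo_curve: "V_h i (horo_curve i p v t) = V_h i p + t * V_h i v"
  by (simp add: horo_curve_def V_h_simps)

lemma horo_curve_hyperboloid:
  assumes "p \<in> hyperboloid" "lorentz p v = 0" "V_h i p + t * V_h i v > 0"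
  shows "horo_curve i p v t \<in> hyperboloid"
proof -
  define f where "f = t\<^sup>2 * lorentz v v / (2 * (V_h i p + t * V_h i v))"
  have *: "a / (2 * D) * D = a / 2" if "D > 0" for a D :: real
    using that by simp
  have f: "f * (V_h i p + t * V_h i v) = t\<^sup>2 * lorentz v v / 2"
    using * [OF assms(3)] by (simp only: f_def)
  have "lorentz (horo_curve i p v t) (horo_curve i p v t) =
      -1 + t\<^sup>2 * lorentz v v - 2 * (f * (V_h i p + t * V_h i v))"
    using hyperboloid_lorentz[OF assms(1)] assms(2)
    unfolding horo_curve_def f_def[symmetric]
    by (simp add: lorentz_simps lorentz_null_vec V_h_simps lorentz_commute[of v p] power2_eq_square
        algebra_simps)
  also have "\<dots> = -1" unfolding f by simp
  finally show ?thesis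
    using assms(3) by (simp add: hyperboloid_iff_V_h[of _ i] V_h_horo_curve)
qed

lemma horo_curve_derivative:
  assumes "p \<in> hyperboloid"
  shows "(horo_curve i p v has_vector_derivative v) (at 0 within {0..1})"
proof -
  have "((\<lambda>t. t\<^sup>2 * lorentz v v / (2 * (V_h i p + t * V_h i v))) has_real_derivative 0) (at 0 within {0..1})"
    using V_h_pos[OF assms, of i] by (auto intro!: derivative_eq_intros)
  then have "((\<lambda>t. (t\<^sup>2 * lorentz v v / (2 * (V_h i p + t * V_h i v))) *\<^sub>R null_vec i)
      has_vector_derivative 0 *\<^sub>R null_vec i) (at 0 within {0..1})"
    unfolding has_real_derivative_iff_has_vector_derivative
    by (rule bounded_linear.has_vector_derivative[OF bounded_linear_scaleR_left])
  moreover have "((\<lambda>t. p + t *\<^sub>R v) has_vector_derivative v) (at 0 within {0..1})"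
    by (auto intro!: derivative_eq_intros)
  ultimately show ?thesis
    unfolding horo_curve_def[abs_def] using has_vector_derivative_add by fastforce
qed

lemma tangent_cone_lorentz_0:
  assumes "M \<subseteq> hyperboloid" "v \<in> tangent_cone M p"
  shows "lorentz p v = 0"
proof -
  obtain \<gamma> where \<gamma>: "\<gamma> 0 = p" "\<forall>t\<in>{0..1::real}. \<gamma> t \<in> M"
    and d: "(\<gamma> has_derivative (\<lambda>t. t *\<^sub>R v)) (at 0 within {0..1})"
    using assms(2) by (auto simp: tangent_cone_def has_vector_derivative_def)
  have "((\<lambda>t. lorentz (\<gamma> t) (\<gamma> t)) has_vector_derivative 2 * lorentz p v) (at 0 within {0..1})"
    using bounded_bilinear.FDERIV[OF bounded_bilinear_lorentz d d] \<gamma>(1)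
    by (simp add: has_vector_derivative_def lorentz_simps lorentz_commute[of v p] algebra_simps)
  moreover have "((\<lambda>t. lorentz (\<gamma> t) (\<gamma> t)) has_vector_derivative 0) (at 0 within {0..1})"
    unfolding has_vector_derivative_def
  proof (rule has_derivative_transform[where f = "\<lambda>t. -1"])
    show "lorentz (\<gamma> t) (\<gamma> t) = -1" if "t \<in> {0..1}" for t
      using \<gamma>(2) assms(1) that hyperboloid_lorentz[of "\<gamma> t"] by blast
  qed simp_all
  ultimately show ?thesis
    using vector_derivative_unique_within[OF at_0_within_Icc_neq_bot] by fastforce
qed

section \<open>The horoball as a manifold with boundary\<close>

locale horo_domain =
  fixes i1 :: "'n::finite" and chi :: real
  assumes chi_pos: "chi > 0"
begin

abbreviation "M \<equiv> hyp_horo_domain i1 chi"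

definition S :: "'n minkowski set" where
  "S = {x \<in> hyperboloid. V_h i1 x = chi}"

lemma M_iff: "x \<in> M \<longleftrightarrow> lorentz x x = -1 \<and> 0 < V_h i1 x \<and> V_h i1 x \<le> chi"
  by (auto simp: hyp_horo_domain_def hyperboloid_iff_V_h[of _ i1])

lemma M_hyperboloid: "x \<in> M \<Longrightarrow> x \<in> hyperboloid"
  by (simp add: hyp_horo_domain_def)

lemma S_subset_M: "S \<subseteq> M"
  by (auto simp: S_def hyp_horo_domain_def)

text \<open>Along a curve that starts on the boundary, \<open>V_h\<close> is maximal at time \<open>0\<close>; along a curve in the
  boundary it is constant.\<close>

lemma tangent_cone_V_h:
  assumes "v \<in> tangent_cone A p"
  shows "A \<subseteq> M \<Longrightarrow> V_h i1 p = chi \<Longrightarrow> V_h i1 v \<le> 0"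
    "A \<subseteq> S \<Longrightarrow> V_h i1 v = 0"
proof -
  obtain \<gamma> where \<gamma>: "\<gamma> 0 = p" "\<forall>t\<in>{0..1::real}. \<gamma> t \<in> A"
    and d: "(\<gamma> has_derivative (\<lambda>t. t *\<^sub>R v)) (at 0 within {0..1})"
    using assms by (auto simp: tangent_cone_def has_vector_derivative_def)
  have bl: "bounded_linear (V_h i1)" using linear_V_h by (simp add: linear_conv_bounded_linear)
  have D: "((\<lambda>t. V_h i1 (\<gamma> t)) has_real_derivative V_h i1 v) (at 0 within {0..1})"
    using bounded_linear.has_derivative[OF bl d]
    by (simp add: has_field_derivative_def V_h_simps mult.commute[of "V_h i1 v"] mult_commute_abs)
  have ev: "\<forall>\<^sub>F t in at 0 within {0..1::real}. t \<in> {0..1}"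
    by (auto simp: eventually_at_topological)
  show "V_h i1 v \<le> 0" if "A \<subseteq> M" "V_h i1 p = chi"
    by (rule one_sided_max_imp_derivative_le_0[OF D], use ev in eventually_elim)
      (use \<gamma> that in \<open>auto simp: hyp_horo_domain_def\<close>)
  show "V_h i1 v = 0" if "A \<subseteq> S"
  proof -
    have "((\<lambda>t. V_h i1 (\<gamma> t)) has_vector_derivative 0) (at 0 within {0..1})"
      unfolding has_vector_derivative_def
      by (rule has_derivative_transform[where f = "\<lambda>t. chi"]) (use \<gamma>(2) that in \<open>auto simp: S_def\<close>)
    with D show ?thesis
      using vector_derivative_unique_within[OF at_0_within_Icc_neq_bot]
      by (auto simp: has_real_derivative_iff_has_vector_derivative)
  qed
qed

lemma tangent_cone_M:
  assumes p: "p \<in> M"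
  shows "tangent_cone M p = {v. lorentz p v = 0 \<and> (V_h i1 p = chi \<longrightarrow> V_h i1 v \<le> 0)}"
proof (intro subset_antisym subsetI CollectI conjI impI)
  fix v assume "v \<in> {v. lorentz p v = 0 \<and> (V_h i1 p = chi \<longrightarrow> V_h i1 v \<le> 0)}"
  then have v: "lorentz p v = 0" "V_h i1 p = chi \<Longrightarrow> V_h i1 v \<le> 0" by auto
  have s: "0 < V_h i1 p" "V_h i1 p \<le> chi" using p by (auto simp: M_iff)
  (* V_h is affine along the curve, so it stays in the required range for a short time. *)
  obtain \<epsilon> where \<epsilon>: "\<epsilon> > 0"
    "\<And>t. 0 \<le> t \<Longrightarrow> t < \<epsilon> \<Longrightarrow> 0 < V_h i1 p + t * V_h i1 v \<and> V_h i1 p + t * V_h i1 v \<le> chi"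
  proof -
    have lim: "((\<lambda>t. V_h i1 p + t * V_h i1 v) \<longlongrightarrow> V_h i1 p + 0 * V_h i1 v) (at 0)"
      by (intro tendsto_intros)
    then have "\<forall>\<^sub>F t in at 0. V_h i1 p + t * V_h i1 v > 0"
      by (rule order_tendstoD) (use s in simp)
    then obtain \<epsilon>1 where 1: "\<epsilon>1 > 0" "\<And>t. t \<noteq> 0 \<Longrightarrow> dist t 0 < \<epsilon>1 \<Longrightarrow> V_h i1 p + t * V_h i1 v > 0"
      unfolding eventually_at by auto
    obtain \<epsilon>2 where 2: "\<epsilon>2 > 0" "\<And>t. 0 < t \<Longrightarrow> t < \<epsilon>2 \<Longrightarrow> V_h i1 p + t * V_h i1 v \<le> chi"
    proof (cases "V_h i1 p = chi")
      case True
      show ?thesis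
        by (rule that[of 1]) (use True v(2) in \<open>auto simp: mult_nonneg_nonpos\<close>)
    next
      case False
      then have "\<forall>\<^sub>F t in at 0. V_h i1 p + t * V_h i1 v < chi"
        using lim s by (intro order_tendstoD) auto
      then obtain \<epsilon>2 where 2: "\<epsilon>2 > 0" "\<And>t. t \<noteq> 0 \<Longrightarrow> dist t 0 < \<epsilon>2 \<Longrightarrow> V_h i1 p + t * V_h i1 v < chi"
        unfolding eventually_at by auto
      show ?thesis
      proof (rule that[OF 2(1)])
        show "V_h i1 p + t * V_h i1 v \<le> chi" if "0 < t" "t < \<epsilon>2" for t
          using 2(2)[of t] that by simp
      qed
    qed
    show ?thesis
    proof (rule that[of "min \<epsilon>1 \<epsilon>2"])
      show "0 < V_h i1 p + t * V_h i1 v \<and> V_h i1 p + t * V_h i1 v \<le> chi"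
        if "0 \<le> t" "t < min \<epsilon>1 \<epsilon>2" for t
        using 1(2)[of t] 2(2)[of t] that s by (cases "t = 0") auto
    qed (use 1 2 in auto)
  qed
  show "v \<in> tangent_cone M p"
  proof (rule tangent_coneI[OF _ \<epsilon>(1) _ horo_curve_derivative[OF M_hyperboloid[OF p]]])
    show "horo_curve i1 p v t \<in> M" if "0 \<le> t" "t < \<epsilon>" for t
      using horo_curve_hyperboloid[OF M_hyperboloid[OF p] v(1)] \<epsilon>(2)[OF that]
      by (simp add: hyp_horo_domain_def V_h_horo_curve)
  qed (simp add: horo_curve_def)
qed (auto dest: tangent_cone_lorentz_0[rotated] tangent_cone_V_h(1) simp: hyp_horo_domain_def)

lemma tangent_space_M:
  assumes p: "p \<in> M"
  shows "tangent_space M p = {v. lorentz p v = 0}"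
proof
  have "subspace {v. lorentz p v = 0}" by (auto simp: subspace_def lorentz_simps)
  then show "tangent_space M p \<subseteq> {v. lorentz p v = 0}"
    unfolding tangent_space_def by (intro span_minimal) (auto simp: tangent_cone_M[OF p])
  show "{v. lorentz p v = 0} \<subseteq> tangent_space M p"
  proof
    fix v assume "v \<in> {v. lorentz p v = 0}"
    then have "v \<in> tangent_cone M p \<or> - v \<in> tangent_cone M p"
      by (auto simp: tangent_cone_M[OF p] lorentz_simps V_h_simps)
    then show "v \<in> tangent_space M p"
      unfolding tangent_space_def by (metis minus_minus span_base span_neg)
  qed
qed

lemma tangent_space_S:
  assumes p: "p \<in> S"
  shows "tangent_space S p = {v. lorentz p v = 0 \<and> V_h i1 v = 0}"
proof
  have p': "p \<in> hyperboloid" "V_h i1 p = chi" using p by (auto simp: S_def)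
  have "subspace {v. lorentz p v = 0 \<and> V_h i1 v = 0}" by (auto simp: subspace_def lorentz_simps V_h_simps)
  then show "tangent_space S p \<subseteq> {v. lorentz p v = 0 \<and> V_h i1 v = 0}"
    unfolding tangent_space_def
    using tangent_cone_V_h(2)[OF _ subset_refl] tangent_cone_lorentz_0[of S] S_subset_M M_hyperboloid
    by (intro span_minimal subsetI) blast+
  show "{v. lorentz p v = 0 \<and> V_h i1 v = 0} \<subseteq> tangent_space S p"
  proof
    fix v assume "v \<in> {v. lorentz p v = 0 \<and> V_h i1 v = 0}"
    then have v: "lorentz p v = 0" "V_h i1 v = 0" by auto
    have "v \<in> tangent_cone S p"
    proof (rule tangent_coneI[OF _ zero_less_one _ horo_curve_derivative[OF p'(1)]])
      show "horo_curve i1 p v t \<in> S" for t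
        using horo_curve_hyperboloid[OF p'(1) v(1), of i1] p'(2) v chi_pos
        by (simp add: S_def V_h_horo_curve)
    qed (simp add: horo_curve_def)
    then show "v \<in> tangent_space S p" unfolding tangent_space_def by (rule span_base)
  qed
qed

sublocale hyperbolic_piece M
  by unfold_locales (auto simp: tangent_space_M M_hyperboloid)

end

section \<open>Charts of the horoball\<close>

context horo_domain
begin

text \<open>In coordinates, \<open>x \<mapsto> (\<langle>x,x\<rangle> + 1, \<chi> - V_h x, x\<^sub>2, \<dots>, x\<^sub>n)\<close>: the hyperboloid becomes the
  hyperplane where the first coordinate is \<open>0\<close>, and the horoball becomes the half-space where
  the second one is nonnegative.\<close>

definition chart :: "'n minkowski \<Rightarrow> 'n minkowski" where
  "chart x = x + (lorentz x x + 1 - V0 x) *\<^sub>R time_vec + (chi - V_h i1 x - V_coord i1 x) *\<^sub>R spatial i1"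

text \<open>The coordinate \<open>x\<^sub>0 + x\<^sub>1\<close> of the preimage of \<open>z\<close> under the chart, from \<open>\<langle>x,x\<rangle> = \<bar>z\<bar>\<^sup>2 - s w\<close> with
  \<open>s = \<chi> - z\<^sub>1\<close>.\<close>

definition light_coord :: "'n minkowski \<Rightarrow> real" where
  "light_coord z = ((\<Sum>j\<in>UNIV - {i1}. V_coord j z * V_coord j z) + 1 - V0 z) * inverse (chi - V_coord i1 z)"

definition chart_inv :: "'n minkowski \<Rightarrow> 'n minkowski" where
  "chart_inv z = z + ((1/2) * (chi - V_coord i1 z + light_coord z) - V0 z) *\<^sub>R time_vec
     + ((1/2) * (light_coord z - (chi - V_coord i1 z)) - V_coord i1 z) *\<^sub>R spatial i1"

lemma chart_coords:
  "V0 (chart x) = lorentz x x + 1" "V_coord i1 (chart x) = chi - V_h i1 x"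
  "j \<noteq> i1 \<Longrightarrow> V_coord j (chart x) = V_coord j x"
  by (simp_all add: chart_def coord_simps)

lemma chart_inv_coords:
  "V0 (chart_inv z) = (chi - V_coord i1 z + light_coord z) / 2"
  "V_coord i1 (chart_inv z) = (light_coord z - (chi - V_coord i1 z)) / 2"
  "j \<noteq> i1 \<Longrightarrow> V_coord j (chart_inv z) = V_coord j z"
  by (simp_all add: chart_inv_def coord_simps)

lemma V_h_chart_inv: "V_h i1 (chart_inv z) = chi - V_coord i1 z"
  unfolding V_h_def chart_inv_coords by (simp add: field_simps)

lemma chart_inv_chart:
  assumes "V_h i1 x \<noteq> 0"
  shows "chart_inv (chart x) = x"
proof -
  have l: "light_coord (chart x) = V0 x + V_coord i1 x"
  proof -
    have sq: "(\<Sum>j\<in>UNIV - {i1}. V_coord j (chart x) * V_coord j (chart x)) =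
        (\<Sum>j\<in>UNIV - {i1}. V_coord j x * V_coord j x)"
      by (intro sum.cong) (auto simp: chart_coords)
    have "light_coord (chart x) = (V_h i1 x * (V0 x + V_coord i1 x)) * inverse (V_h i1 x)"
      unfolding light_coord_def sq
      by (simp add: chart_coords lorentz_self_light_cone[of x i1] power2_eq_square)
    then show ?thesis using assms by simp
  qed
  show ?thesis
  proof (rule minkowski_eqI)
    show "V0 (chart_inv (chart x)) = V0 x"
      unfolding chart_inv_coords l chart_coords by (simp add: V_h_def)
    show "V_coord j (chart_inv (chart x)) = V_coord j x" for j
      by (cases "j = i1") (simp_all add: chart_inv_coords l chart_coords V_h_def)
  qed
qed

lemma chart_chart_inv:
  assumes "V_coord i1 z \<noteq> chi"
  shows "chart (chart_inv z) = z"
proof (rule minkowski_eqI)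
  have sum: "V0 (chart_inv z) + V_coord i1 (chart_inv z) = light_coord z"
    unfolding chart_inv_coords by (simp add: field_simps)
  have "(chi - V_coord i1 z) * light_coord z = (\<Sum>j\<in>UNIV - {i1}. V_coord j z * V_coord j z) + 1 - V0 z"
    unfolding light_coord_def using assms by (simp add: field_simps)
  moreover have "(\<Sum>j\<in>UNIV - {i1}. V_coord j (chart_inv z) * V_coord j (chart_inv z)) =
      (\<Sum>j\<in>UNIV - {i1}. V_coord j z * V_coord j z)"
    by (intro sum.cong) (auto simp: chart_inv_coords)
  ultimately show "V0 (chart (chart_inv z)) = V0 z"
    unfolding chart_coords lorentz_self_light_cone[of _ i1] sum V_h_chart_inv
    by (simp add: power2_eq_square)
  show "V_coord j (chart (chart_inv z)) = V_coord j z" for j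
    by (cases "j = i1") (simp_all add: chart_inv_coords chart_coords V_h_chart_inv)
qed

lemma smooth_on_chart: "open U \<Longrightarrow> smooth_on U chart"
  unfolding chart_def[abs_def]
  by (intro smooth_on_add smooth_on_diff smooth_on_bounded_bilinear[OF _ bounded_bilinear_scaleR]
      smooth_on_bounded_bilinear[OF _ bounded_bilinear_lorentz] smooth_on_const smooth_on_ident
      smooth_on_linear linear_V0 linear_V_h linear_V_coord)

lemma smooth_on_chart_inv:
  assumes "open U" "\<And>z. z \<in> U \<Longrightarrow> V_coord i1 z \<noteq> chi"
  shows "smooth_on U chart_inv"
proof -
  have light: "smooth_on U light_coord"
    unfolding light_coord_def[abs_def] using assms
    by (intro smooth_on_mult smooth_on_add smooth_on_diff smooth_on_sum smooth_on_const
        smooth_on_inverse smooth_on_linear linear_V0 linear_V_coord) auto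
  show ?thesis
    unfolding chart_inv_def[abs_def]
    by (intro light smooth_on_add smooth_on_diff smooth_on_bounded_bilinear[OF _ bounded_bilinear_scaleR]
        smooth_on_mult smooth_on_const smooth_on_ident smooth_on_linear linear_V0 linear_V_coord assms(1))
qed

text \<open>With \<open>b = \<chi>\<close> the domain avoids the boundary, with \<open>b = \<chi> + 1\<close> it contains a neighbourhood of
  it.\<close>

definition chart_domain :: "real \<Rightarrow> 'n minkowski set" where
  "chart_domain b = {x. 0 < V_h i1 x \<and> V_h i1 x < b}"

lemma chart_image: "chart ` chart_domain b = {z. chi - b < V_coord i1 z \<and> V_coord i1 z < chi}"
proof (intro subset_antisym subsetI)
  fix z assume "z \<in> {z. chi - b < V_coord i1 z \<and> V_coord i1 z < chi}"
  then have "chart_inv z \<in> chart_domain b" "chart (chart_inv z) = z"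
    by (auto simp: chart_domain_def V_h_chart_inv chart_chart_inv)
  then show "z \<in> chart ` chart_domain b" by (metis imageI)
qed (auto simp: chart_domain_def chart_coords)

lemma diffeo_on_chart: "diffeo_on (chart_domain b) chart"
  unfolding diffeo_on_def
proof (intro conjI)
  have cont: "continuous_on UNIV (V_h i1)" "continuous_on UNIV (V_coord i1 :: 'n minkowski \<Rightarrow> real)"
    using linear_V_h linear_V_coord by (auto intro: linear_continuous_on simp: linear_conv_bounded_linear)
  show o1: "open (chart_domain b)"
    unfolding chart_domain_def by (intro open_Collect_conj open_Collect_less continuous_on_const cont)
  show o2: "open (chart ` chart_domain b)"
    unfolding chart_image by (intro open_Collect_conj open_Collect_less continuous_on_const cont)
  have inv: "chart_inv (chart x) = x" if "x \<in> chart_domain b" for x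
    using that by (intro chart_inv_chart) (auto simp: chart_domain_def)
  show inj: "inj_on chart (chart_domain b)" using inv by (metis inj_onI)
  show "smooth_on (chart_domain b) chart" by (rule smooth_on_chart[OF o1])
  have "smooth_on (chart ` chart_domain b) chart_inv"
    by (rule smooth_on_chart_inv[OF o2]) (auto simp: chart_image)
  then show "smooth_on (chart ` chart_domain b) (inv_into (chart_domain b) chart)"
    by (rule smooth_on_cong[OF o2]) (use inv inj in auto)
qed

definition chart_space :: "'n minkowski set" where
  "chart_space = {z. V0 z = 0}"

lemma chart_space: "subspace chart_space" "dim chart_space = CARD('n)"
proof -
  show "subspace chart_space" by (auto simp: chart_space_def subspace_def V0_def)
  have "chart_space = {z. time_vec \<bullet> z = 0}"
    by (auto simp: chart_space_def time_vec_def V0_def inner_prod_def)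
  moreover have "(time_vec :: 'n minkowski) \<noteq> 0" by (simp add: time_vec_def prod_eq_iff)
  ultimately show "dim chart_space = CARD('n)" using dim_hyperplane by fastforce
qed

lemma chart_mem_chart_space: "x \<in> chart_domain b \<Longrightarrow> chart x \<in> chart_space \<longleftrightarrow> x \<in> hyperboloid"
  by (auto simp: chart_space_def chart_coords hyperboloid_iff_V_h[of _ i1] chart_domain_def)

lemma interior_point_M:
  assumes "p \<in> M" "V_h i1 p < chi"
  shows "interior_point CARD('n) M p"
  unfolding interior_point_def
proof (intro exI conjI)
  show "p \<in> chart_domain chi" using assms by (auto simp: chart_domain_def M_iff)
  have "chart_domain chi \<inter> M = {x \<in> chart_domain chi. chart x \<in> chart_space}"
    using chart_mem_chart_space[of _ chi] by (auto simp: hyp_horo_domain_def chart_domain_def)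
  then show "chart ` (chart_domain chi \<inter> M) = chart ` chart_domain chi \<inter> chart_space" by auto
qed (rule diffeo_on_chart chart_space)+

lemma boundary_point_M:
  assumes "p \<in> S"
  shows "boundary_point CARD('n) M p"
  unfolding boundary_point_def
proof (intro exI conjI)
  show "p \<in> chart_domain (chi + 1)" using assms chi_pos by (auto simp: chart_domain_def S_def)
  have inner: "z \<bullet> spatial i1 = V_coord i1 z" for z :: "'n minkowski"
    by (simp add: spatial_def V_coord_def inner_prod_def inner_axis)
  show "spatial i1 \<in> chart_space" by (simp add: chart_space_def)
  show "spatial i1 \<noteq> (0 :: 'n minkowski)" by (simp add: spatial_def prod_eq_iff axis_eq_0_iff)
  show "chart p \<bullet> spatial i1 = 0" using assms by (simp add: inner chart_coords S_def)
  have "chart_domain (chi + 1) \<inter> M =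
      {x \<in> chart_domain (chi + 1). chart x \<in> {z \<in> chart_space. z \<bullet> spatial i1 \<ge> 0}}"
    using chart_mem_chart_space[of _ "chi + 1"]
    by (auto simp: hyp_horo_domain_def chart_domain_def inner chart_coords)
  then show "chart ` (chart_domain (chi + 1) \<inter> M) =
      chart ` chart_domain (chi + 1) \<inter> {z \<in> chart_space. z \<bullet> spatial i1 \<ge> 0}" by auto
qed (rule diffeo_on_chart chart_space)+

lemma manifold_with_boundary_M: "manifold_with_boundary CARD('n) M"
  unfolding manifold_with_boundary_def
proof
  fix p assume p: "p \<in> M"
  show "interior_point CARD('n) M p \<or> boundary_point CARD('n) M p"
  proof (cases "V_h i1 p < chi")
    case False
    then have "p \<in> S" using p by (auto simp: S_def hyp_horo_domain_def)
    then show ?thesis using boundary_point_M by blast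
  qed (use interior_point_M[OF p] in blast)
qed

text \<open>Off the level set \<open>V_h = \<chi>\<close> the tangent cone is closed under negation, which excludes
  boundary points there.\<close>

lemma mfd_boundary_M: "mfd_boundary CARD('n) M = S"
proof (intro subset_antisym subsetI)
  fix p assume "p \<in> mfd_boundary CARD('n) M"
  then have p: "p \<in> M" "boundary_point CARD('n) M p" by (auto simp: mfd_boundary_def)
  obtain v where "v \<in> tangent_cone M p" "- v \<notin> tangent_cone M p"
    by (rule boundary_point_tangent_cone[OF p(2,1)]) (rule that)
  then have "V_h i1 p = chi"
    by (auto simp: tangent_cone_M[OF p(1)] lorentz_simps)
  then show "p \<in> S" using p(1) by (auto simp: S_def hyp_horo_domain_def)
qed (use boundary_point_M S_subset_M in \<open>auto simp: mfd_boundary_def\<close>)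

lemma hyp_horo_boundary_eq: "hyp_horo_boundary i1 chi = S"
  by (simp add: hyp_horo_boundary_def mfd_boundary_M)

section \<open>The boundary horosphere\<close>

text \<open>Subtracting from a candidate \<open>\<eta>\<close> its component along \<open>horo_normal\<close> leaves a vector \<open>r\<close> tangent
  to the boundary. Both vectors are orthogonal to \<open>r\<close>, so \<open>r\<close> is null and vanishes; the sign is
  fixed by the tangent cone.\<close>

lemma outward_normal_eq:
  assumes p: "p \<in> S"
  shows "outward_normal M hyp_metric S p = horo_normal i1 p"
  unfolding outward_normal_def
proof (rule the_equality)
  have p': "p \<in> M" "p \<in> hyperboloid" "V_h i1 p = chi"
    using p S_subset_M by (auto simp: S_def)
  note N = horo_normal[OF p'(2), where i = i1]
  show "horo_normal i1 p \<in> tangent_space M p \<and> hyp_metric p (horo_normal i1 p) (horo_normal i1 p) = 1 \<and>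
      (\<forall>w\<in>tangent_space S p. hyp_metric p (horo_normal i1 p) w = 0) \<and> - horo_normal i1 p \<in> tangent_cone M p"
    using N chi_pos p'(3)
    by (auto simp: tangent_space_M[OF p'(1)] tangent_space_S[OF p] tangent_cone_M[OF p'(1)] hyp_metric_def
        lorentz_simps V_h_simps)
  fix \<eta>
  assume \<eta>: "\<eta> \<in> tangent_space M p \<and> hyp_metric p \<eta> \<eta> = 1 \<and>
      (\<forall>w\<in>tangent_space S p. hyp_metric p \<eta> w = 0) \<and> - \<eta> \<in> tangent_cone M p"
  then have e: "lorentz p \<eta> = 0" "lorentz \<eta> \<eta> = 1" "V_h i1 \<eta> \<ge> 0"
    "\<And>w. lorentz p w = 0 \<Longrightarrow> V_h i1 w = 0 \<Longrightarrow> lorentz \<eta> w = 0"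
    using p'(3) by (auto simp: tangent_space_M[OF p'(1)] tangent_space_S[OF p] tangent_cone_M[OF p'(1)]
        hyp_metric_def V_h_simps)
  define c where "c = V_h i1 \<eta> / chi"
  define r where "r = \<eta> - c *\<^sub>R horo_normal i1 p"
  have r: "lorentz p r = 0" "V_h i1 r = 0"
    using e(1) N chi_pos p'(3) by (simp_all add: r_def lorentz_simps V_h_simps c_def)
  have "lorentz r r = lorentz \<eta> r - c * lorentz (horo_normal i1 p) r"
    using lorentz.diff_left[of \<eta> "c *\<^sub>R horo_normal i1 p" r] by (simp add: lorentz_simps flip: r_def)
  also have "\<dots> = 0" using e(4)[OF r] N(4)[OF r(1)] r(2) by simp
  finally have "r = 0"
    using lorentz_pos[OF hyperboloid_lorentz[OF p'(2)] r(1)] by fastforce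
  then have eq: "\<eta> = c *\<^sub>R horo_normal i1 p" by (simp add: r_def)
  have "c\<^sup>2 = 1" using e(2) N(2) unfolding eq by (simp add: lorentz_simps power2_eq_square)
  moreover have "c \<ge> 0" using e(3) chi_pos by (simp add: c_def)
  ultimately have "c = 1" by (metis abs_of_nonneg abs_one power2_eq_1_iff abs_minus_cancel)
  then show "\<eta> = horo_normal i1 p" using eq by simp
qed

lemma smooth_map_inverse_V_h: "smooth_map M (\<lambda>q. 1 / V_h i1 q)"
proof -
  have cont: "continuous_on UNIV (V_h i1)"
    using linear_V_h by (auto intro: linear_continuous_on simp: linear_conv_bounded_linear)
  have o: "open {q. 0 < V_h i1 q}" by (intro open_Collect_less continuous_on_const cont)
  have "smooth_on {q. 0 < V_h i1 q} (\<lambda>q. 1 * inverse (V_h i1 q))"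
    by (rule smooth_on_mult[OF o smooth_on_const smooth_on_inverse[OF o smooth_on_linear[OF o linear_V_h]]]) simp
  then show ?thesis
    unfolding divide_inverse by (rule smooth_on_imp_smooth_map[OF o]) (auto simp: M_iff)
qed

lemma horo_normal_vector_field: "horo_normal i1 \<in> vector_fields M"
  unfolding vector_fields_iff
proof (intro conjI ballI)
  show "smooth_map M (horo_normal i1)"
    unfolding horo_normal_def[abs_def]
    by (intro smooth_map_diff smooth_map_ident smooth_map_scaleR smooth_map_const smooth_map_inverse_V_h)
qed (simp add: horo_normal(1) M_hyperboloid)

text \<open>Any extension \<open>N\<close> of the normal coincides on the boundary with \<open>q - N\<^sub>0 / \<chi>\<close>, \<open>N\<^sub>0\<close> the constant
  null vector, and derivatives in directions tangent to the boundary only see the values there.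
  So the shape operator is the identity.\<close>

lemma second_fundamental_form_eq:
  assumes p: "p \<in> S" and u: "u \<in> tangent_space S p" and v: "v \<in> tangent_space S p"
  shows "second_fundamental_form M hyp_metric S p u v = lorentz u v"
proof -
  have p': "p \<in> M" using p S_subset_M by blast
  have uv: "lorentz p u = 0" "V_h i1 u = 0" "lorentz p v = 0"
    using u v by (auto simp: tangent_space_S[OF p])
  define N where "N = (SOME N. N \<in> vector_fields M \<and>
                 (\<forall>\<^sub>F q in nhds p. q \<in> S \<longrightarrow> N q = outward_normal M hyp_metric S q))"
  have "\<exists>N. N \<in> vector_fields M \<and> (\<forall>\<^sub>F q in nhds p. q \<in> S \<longrightarrow> N q = outward_normal M hyp_metric S q)"
    using horo_normal_vector_field by (intro exI[of _ "horo_normal i1"]) (auto simp: outward_normal_eq)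
  from someI_ex[OF this, folded N_def] have N: "N \<in> vector_fields M"
    "\<forall>\<^sub>F q in nhds p. q \<in> S \<longrightarrow> N q = horo_normal i1 q"
    by (auto simp: outward_normal_eq elim: eventually_mono)
  have Np: "N p = horo_normal i1 p" using eventually_nhds_x_imp_x[OF N(2)] p by simp
  have "dir_deriv M N p u = u"
  proof -
    have "(N has_derivative dir_deriv M N p) (at p within S)"
      using smooth_map_has_derivative[OF vector_fieldsD(1)[OF N(1)] p'] S_subset_M
      by (rule has_derivative_subset)
    moreover have "(N has_derivative (\<lambda>x. x)) (at p within S)"
    proof (rule has_derivative_transform_eventually[of "\<lambda>q. q - (1 / chi) *\<^sub>R null_vec i1"])
      show "((\<lambda>q. q - (1 / chi) *\<^sub>R null_vec i1) has_derivative (\<lambda>x. x)) (at p within S)"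
        by (auto intro!: derivative_eq_intros)
      show "\<forall>\<^sub>F q in at p within S. q - (1 / chi) *\<^sub>R null_vec i1 = N q"
        using N(2) unfolding eventually_at_filter
        by eventually_elim (auto simp: horo_normal_def S_def)
      show "p - (1 / chi) *\<^sub>R null_vec i1 = N p"
        using p unfolding Np by (simp add: horo_normal_def S_def)
    qed (rule p)
    ultimately show ?thesis by (rule has_derivative_within_unique_tangent[OF _ _ u])
  qed
  moreover note field_ext[OF p' uv(1)]
  ultimately have "levi_civita M hyp_metric (field_ext M p u) N p = u - lorentz u (N p) *\<^sub>R p"
    using levi_civita_eq_hyp_connection[OF _ N(1) p'] by (simp add: hyp_connection_def)
  then show ?thesis
    using uv by (simp add: second_fundamental_form_def Let_def hyp_metric_def lorentz_simps flip: N_def)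
qed

definition horo_ray :: "real \<Rightarrow> 'n minkowski" where
  "horo_ray t = cosh t *\<^sub>R time_vec + sinh t *\<^sub>R spatial i1"

lemma lorentz_horo_ray: "lorentz x (horo_ray t) = - (cosh t * V0 x - sinh t * V_coord i1 x)"
  by (simp add: horo_ray_def lorentz_simps lorentz_time_vec lorentz_spatial)

lemma geodesic_ray_horo_ray: "geodesic_ray horo_ray"
  unfolding geodesic_ray_def
proof (intro conjI allI impI)
  have l: "lorentz (horo_ray s) (horo_ray t) = - cosh (s - t)" for s t
    unfolding lorentz_horo_ray by (simp add: horo_ray_def coord_simps cosh_diff mult.commute)
  show "horo_ray t \<in> hyperboloid" for t
    using l[of t t] cosh_real_pos[of t] by (simp add: hyperboloid_def horo_ray_def time_vec_def spatial_def)
  show "hyp_dist (horo_ray s) (horo_ray t) = \<bar>s - t\<bar>" for s t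
    using arcosh_cosh_real[of "\<bar>s - t\<bar>"] by (simp add: hyp_dist_def l cosh_real_abs)
qed

text \<open>For \<open>y\<close> large, \<open>arcosh y\<close> is asymptotic to \<open>ln (2 y)\<close>, and here
  \<open>2 y = s e\<^sup>t + w e\<^sup>-\<^sup>t\<close> with \<open>s = V_h x\<close>.\<close>

lemma busemann_horo_ray:
  assumes "x \<in> hyperboloid"
  shows "((\<lambda>t. hyp_dist x (horo_ray t) - t) \<longlongrightarrow> ln (V_h i1 x)) at_top"
proof -
  define s where "s = V_h i1 x"
  define w where "w = V0 x + V_coord i1 x"
  have s: "s > 0" using V_h_pos[OF assms] by (simp add: s_def)
  have y: "- lorentz x (horo_ray t) = (s * exp t + w * exp (- t)) / 2" for t
    unfolding lorentz_horo_ray cosh_def sinh_def s_def w_def V_h_def by (simp add: field_simps)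
  have lim: "filterlim (\<lambda>t. (s * exp t + w * exp (- t)) / 2) at_top at_top"
    using s by real_asymp
  have "((\<lambda>t. ln ((s * exp t + w * exp (- t)) / 2 + sqrt (((s * exp t + w * exp (- t)) / 2)\<^sup>2 - 1)) - t)
      \<longlongrightarrow> ln s) at_top"
    using s by real_asymp
  then show ?thesis
    unfolding s_def[symmetric]
  proof (rule Lim_transform_eventually)
    have "\<forall>\<^sub>F t in at_top. (s * exp t + w * exp (- t)) / 2 \<ge> 1"
      using lim unfolding filterlim_at_top by blast
    then show "\<forall>\<^sub>F t in at_top. ln ((s * exp t + w * exp (- t)) / 2 +
        sqrt (((s * exp t + w * exp (- t)) / 2)\<^sup>2 - 1)) - t = hyp_dist x (horo_ray t) - t"
      by eventually_elim (simp add: hyp_dist_def y arcosh_real_def)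
  qed
qed

lemma horosphere_S: "horosphere S"
  unfolding horosphere_def
proof (intro exI conjI)
  show "S = {x \<in> hyperboloid. ((\<lambda>t. hyp_dist x (horo_ray t) - t) \<longlongrightarrow> ln chi) at_top}"
  proof (intro subset_antisym subsetI)
    fix x assume "x \<in> S"
    then show "x \<in> {x \<in> hyperboloid. ((\<lambda>t. hyp_dist x (horo_ray t) - t) \<longlongrightarrow> ln chi) at_top}"
      using busemann_horo_ray[of x] by (simp add: S_def)
  next
    fix x assume "x \<in> {x \<in> hyperboloid. ((\<lambda>t. hyp_dist x (horo_ray t) - t) \<longlongrightarrow> ln chi) at_top}"
    then have x: "x \<in> hyperboloid" "((\<lambda>t. hyp_dist x (horo_ray t) - t) \<longlongrightarrow> ln chi) at_top" by auto
    have "ln (V_h i1 x) = ln chi"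
      using tendsto_unique[OF _ busemann_horo_ray[OF x(1)] x(2)] by simp
    then show "x \<in> S" using x(1) V_h_pos[OF x(1)] chi_pos by (simp add: S_def)
  qed
qed (rule geodesic_ray_horo_ray)

end

section \<open>Functions with \<open>Hess V = V g\<close>\<close>

text \<open>The reversed Cauchy--Schwarz inequality: the part of \<open>x\<close> orthogonal to \<open>p\<close> is spacelike with
  square \<open>\<langle>p,x\<rangle>\<^sup>2 - 1\<close>. The sign of \<open>\<langle>p,x\<rangle>\<close> uses that both points lie on the upper sheet.\<close>

lemma lorentz_hyperboloid_le:
  assumes p: "p \<in> hyperboloid" and x: "x \<in> hyperboloid"
  shows "lorentz p x \<le> -1" "lorentz p x = -1 \<Longrightarrow> x = p"
proof -
  have *: "norm (snd y) < fst y" if "y \<in> hyperboloid" for y :: "'a minkowski"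
  proof -
    have "(norm (snd y))\<^sup>2 < (fst y)\<^sup>2" "fst y > 0"
      using that by (auto simp: hyperboloid_def lorentz_eq power2_norm_eq_inner simp flip: power2_eq_square)
    then show ?thesis by (simp add: power2_less_imp_less)
  qed
  have "snd p \<bullet> snd x \<le> norm (snd p) * norm (snd x)" by (rule norm_cauchy_schwarz)
  also have "\<dots> < fst p * fst x" using *[OF p] *[OF x] by (intro mult_strict_mono') auto
  finally have neg: "lorentz p x < 0" by (simp add: lorentz_eq)
  define r where "r = x + lorentz p x *\<^sub>R p"
  have r: "lorentz p r = 0" "lorentz r r = (lorentz p x)\<^sup>2 - 1"
    using hyperboloid_lorentz[OF p] hyperboloid_lorentz[OF x]
    by (simp_all add: r_def lorentz_simps lorentz_commute[of x p] power2_eq_square)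
  have "lorentz r r \<ge> 0"
    using lorentz_pos[OF hyperboloid_lorentz[OF p] r(1)] by (cases "r = 0") (auto simp: lorentz_simps)
  then have "1 \<le> (- lorentz p x)\<^sup>2" using r(2) by simp
  then have "1 \<le> - lorentz p x" using neg power_less_imp_less_base[of "- lorentz p x" 2 1]
    by (metis abs_le_square_iff abs_of_pos abs_one neg_0_less_iff_less power_one)
  then show "lorentz p x \<le> -1" by simp
  show "x = p" if "lorentz p x = -1"
  proof -
    have "r = 0" using lorentz_pos[OF hyperboloid_lorentz[OF p] r(1)] r(2) that by force
    then show ?thesis using that by (simp add: r_def)
  qed
qed

lemma hyperboloid_geodesic:
  assumes p: "p \<in> hyperboloid" and x: "x \<in> hyperboloid" and "x \<noteq> p"
  obtains T v where "T > 0" "lorentz p v = 0" "lorentz v v = 1" "x = cosh T *\<^sub>R p + sinh T *\<^sub>R v"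
proof -
  have a: "- lorentz p x > 1" using lorentz_hyperboloid_le[OF p x] assms(3) by force
  define T where "T = arcosh (- lorentz p x)"
  have T: "cosh T = - lorentz p x" using a by (simp add: T_def)
  have "T \<ge> 0" using a by (simp add: T_def)
  moreover have "T \<noteq> 0" using T a by auto
  ultimately have T0: "T > 0" by simp
  then have s: "sinh T > 0" by simp
  define v where "v = (1 / sinh T) *\<^sub>R (x - cosh T *\<^sub>R p)"
  have "lorentz p (x - cosh T *\<^sub>R p) = 0"
    using hyperboloid_lorentz[OF p] T by (simp add: lorentz_simps)
  then have 1: "lorentz p v = 0" by (simp add: v_def lorentz_simps)
  have "lorentz (x - cosh T *\<^sub>R p) (x - cosh T *\<^sub>R p) = (cosh T)\<^sup>2 - 1"
    using hyperboloid_lorentz[OF p] hyperboloid_lorentz[OF x] T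
    by (simp add: lorentz_simps lorentz_commute[of x p] power2_eq_square algebra_simps)
  also have "\<dots> = sinh T * sinh T" using cosh_square_eq[of T] by (simp add: power2_eq_square)
  finally have 2: "lorentz v v = 1" using s by (simp add: v_def lorentz.scaleR_left lorentz.scaleR_right)
  have 3: "x = cosh T *\<^sub>R p + sinh T *\<^sub>R v" using s by (simp add: v_def)
  show ?thesis by (rule that[OF T0 1 2 3])
qed

context hyperbolic_piece
begin

text \<open>The formula \<open>X X V = Hess V (X,X) + (D\<^sub>X X) V\<close>. It is not an instance of the definition of
  the Hessian, which uses some other extension of \<open>X p\<close>.\<close>

lemma dir_deriv_dir_deriv_self:
  assumes V: "smooth_map M V" and X: "X \<in> vector_fields M" and p: "p \<in> M"
  shows "dir_deriv M (\<lambda>q. dir_deriv M V q (X q)) p (X p) =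
    hessian M hyp_metric V p (X p) (X p) + dir_deriv M V p (hyp_connection X X p)"
proof -
  obtain U F where U: "open U" "p \<in> U" "smooth_on U F" "\<And>q. q \<in> U \<Longrightarrow> q \<in> M \<Longrightarrow> F q = V q"
    by (rule smooth_map_extension[OF V p]) (rule that)
  have lin: "linear (frechet_derivative F (at p))"
    using smooth_on_has_derivative[OF U(3,2)] by (rule has_derivative_linear)
  note tX = vector_fieldsD(2)[OF X p]
  have 1: "dir_deriv M V p (hyp_connection X X p) = frechet_derivative F (at p) (hyp_connection X X p)"
    by (rule dir_deriv_extension[OF U(1,3,4,2) p vector_fieldsD(2)[OF hyp_connection_vector_field[OF X X] p]])
  show ?thesis
    using dir_deriv_dir_deriv[OF U(1,3,4,2) p X tX]
      hessian_eq[OF U(1,3,4,2) p vector_field_tangent[OF X p] vector_field_tangent[OF X p]]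
    unfolding 1 by (simp add: hyp_connection_def linear_diff[OF lin] linear_scale[OF lin])
qed

lemma has_derivative_along_curve:
  fixes f :: "'n minkowski \<Rightarrow> real"
  assumes f: "smooth_map M f" and "t \<in> I" and M: "\<And>t. t \<in> I \<Longrightarrow> \<gamma> t \<in> M"
    and \<gamma>: "(\<gamma> has_vector_derivative w) (at t within I)"
  shows "((\<lambda>t. f (\<gamma> t)) has_real_derivative dir_deriv M f (\<gamma> t) w) (at t within I)"
proof -
  note d = smooth_map_has_derivative[OF f M[OF \<open>t \<in> I\<close>]]
  have "(f has_derivative dir_deriv M f (\<gamma> t)) (at (\<gamma> t) within \<gamma> ` I)"
    using d by (rule has_derivative_subset) (use M in auto)
  from has_derivative_in_compose[OF \<gamma>[unfolded has_vector_derivative_def] this]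
  show ?thesis
    using linear_scale[OF has_derivative_linear[OF d]]
    by (simp add: has_field_derivative_def mult.commute[of "dir_deriv M f (\<gamma> t) w"] mult_commute_abs)
qed

text \<open>Along a unit speed geodesic such a function satisfies \<open>f'' = f\<close>. The geodesic is an
  integral curve of an infinitesimal boost \<open>X\<close>, which makes \<open>f''\<close> the iterated derivative \<open>X X V\<close>.\<close>

lemma hessian_eq_metric_along_geodesic:
  assumes V: "smooth_map M V"
    and H: "\<And>p u v. p \<in> M \<Longrightarrow> lorentz p u = 0 \<Longrightarrow> lorentz p v = 0 \<Longrightarrow>
      hessian M hyp_metric V p u v = V p * lorentz u v"
    and v: "lorentz p v = 0" "lorentz v v = 1" and T: "T \<ge> 0"
    and M: "\<And>t. 0 \<le> t \<Longrightarrow> t \<le> T \<Longrightarrow> cosh t *\<^sub>R p + sinh t *\<^sub>R v \<in> M"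
  shows "V (cosh T *\<^sub>R p + sinh T *\<^sub>R v) = cosh T * V p + sinh T * dir_deriv M V p v"
proof -
  define \<gamma> where "\<gamma> t = cosh t *\<^sub>R p + sinh t *\<^sub>R v" for t
  (* The boost in the plane of p and v: it exchanges p and v and is skew for the Lorentz form. *)
  define X where "X q = lorentz q v *\<^sub>R p - lorentz q p *\<^sub>R v" for q
  have p: "p \<in> M" using M[of 0] T by simp
  note lp = lorentz_self[OF p]
  have bl: "bounded_linear X"
    unfolding X_def by (intro bounded_linear_sub bounded_linear_scaleR_const
        bounded_linear.bounded_linear[OF lorentz.bounded_linear_left])
  have X: "X \<in> vector_fields M"
    unfolding vector_fields_iff using smooth_map_bounded_linear[OF bl]
    by (auto simp: X_def lorentz_simps)
  have X\<gamma>: "X (\<gamma> t) = sinh t *\<^sub>R p + cosh t *\<^sub>R v" for t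
    using v lp by (simp add: X_def \<gamma>_def lorentz_simps lorentz_commute[of v p])
  have XX: "X (X (\<gamma> t)) = \<gamma> t" for t
    unfolding X\<gamma> using v lp by (simp add: X_def \<gamma>_def lorentz_simps lorentz_commute[of v p])
  have unit: "lorentz (X (\<gamma> t)) (X (\<gamma> t)) = 1" for t
    unfolding X\<gamma> using v lp hyperbolic_pythagoras[of t]
    by (simp add: lorentz_simps lorentz_commute[of v p] power2_eq_square)
  define f where "f t = V (\<gamma> t)" for t
  define g where "g t = dir_deriv M V (\<gamma> t) (X (\<gamma> t))" for t
  have M\<gamma>: "\<gamma> t \<in> M" if "t \<in> {0..T}" for t using M[of t] that by (simp add: \<gamma>_def)
  have d\<gamma>: "(\<gamma> has_vector_derivative X (\<gamma> t)) (at t within {0..T})" for t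
    unfolding X\<gamma> unfolding \<gamma>_def[abs_def]
    by (auto intro!: derivative_eq_intros simp: has_vector_derivative_def scaleR_add_right mult.commute)
  have df: "(f has_real_derivative g t) (at t within {0..T})" if "t \<in> {0..T}" for t
    unfolding f_def g_def by (rule has_derivative_along_curve[OF V that M\<gamma> d\<gamma>])
  have dg: "(g has_real_derivative f t) (at t within {0..T})" if t: "t \<in> {0..T}" for t
  proof -
    have "dir_deriv M X (\<gamma> t) (X (\<gamma> t)) = X (X (\<gamma> t))"
      by (rule dir_deriv_eq[OF bounded_linear_imp_has_derivative[OF bl] vector_fieldsD(2)[OF X M\<gamma>[OF t]]])
    then have "hyp_connection X X (\<gamma> t) = 0"
      by (simp add: hyp_connection_def XX unit)
    then have "dir_deriv M (\<lambda>q. dir_deriv M V q (X q)) (\<gamma> t) (X (\<gamma> t)) = f t"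
      unfolding dir_deriv_dir_deriv_self[OF V X M\<gamma>[OF t]]
      using H[OF M\<gamma>[OF t] vector_field_tangent[OF X M\<gamma>[OF t]] vector_field_tangent[OF X M\<gamma>[OF t]]]
        linear_0[OF linear_dir_deriv[OF V M\<gamma>[OF t]]]
      by (simp add: unit f_def)
    then show ?thesis
      using has_derivative_along_curve[OF smooth_map_dir_deriv[OF V X] t M\<gamma> d\<gamma>]
      by (simp add: g_def[abs_def])
  qed
  (* Evolving the state (f t, g t) for the remaining time by the solution of f'' = f gives a
     constant; compare its values at t = 0 and t = T. *)
  have "((\<lambda>t. f t * cosh (T - t) + g t * sinh (T - t)) has_real_derivative 0) (at t within {0..T})"
    if "t \<in> {0..T}" for t
    using df[OF that] dg[OF that] by (auto intro!: derivative_eq_intros)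
  then obtain c where "f t * cosh (T - t) + g t * sinh (T - t) = c" if "t \<in> {0..T}" for t
    using has_field_derivative_zero_constant[of "{0..T}" "\<lambda>t. f t * cosh (T - t) + g t * sinh (T - t)"]
    by auto
  from this[of 0] this[of T] T
  have "f T = cosh T * f 0 + sinh T * g 0" by (simp add: mult.commute)
  moreover have "\<gamma> 0 = p" "X p = v" using X\<gamma>[of 0] by (simp_all add: \<gamma>_def)
  ultimately show ?thesis by (simp add: f_def g_def \<gamma>_def)
qed

end

context horo_domain
begin

text \<open>Multiplied by \<open>sinh T\<close>, the value of \<open>V_h\<close> at time \<open>t\<close> is
  \<open>sinh (T - t) V_h(p) + sinh t V_h(x)\<close>, and \<open>sinh\<close> is superadditive on nonnegative numbers.\<close>

lemma geodesically_convex_M: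
  assumes p: "p \<in> M" and x: "x \<in> M" and v: "lorentz p v = 0" "lorentz v v = 1"
    and T: "T > 0" "x = cosh T *\<^sub>R p + sinh T *\<^sub>R v" and t: "0 \<le> t" "t \<le> T"
  shows "cosh t *\<^sub>R p + sinh t *\<^sub>R v \<in> M"
proof -
  let ?y = "cosh t *\<^sub>R p + sinh t *\<^sub>R v"
  have sp: "0 < V_h i1 p" "V_h i1 p \<le> chi" and sx: "0 < V_h i1 x" "V_h i1 x \<le> chi"
    using p x by (auto simp: M_iff)
  have nonneg: "sinh (T - t) \<ge> 0" "sinh t \<ge> 0" using t by auto
  have sT: "sinh T > 0" using T(1) by simp
  have y: "sinh T * V_h i1 ?y = sinh (T - t) * V_h i1 p + sinh t * V_h i1 x"
    unfolding T(2) by (simp add: V_h_simps sinh_diff algebra_simps)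
  have "lorentz ?y ?y = -1"
    using lorentz_self[OF p] v hyperbolic_pythagoras[of t]
    by (simp add: lorentz_simps lorentz_commute[of v p] power2_eq_square)
  moreover have "V_h i1 ?y > 0"
  proof -
    have "sinh (T - t) * V_h i1 p + sinh t * V_h i1 x > 0"
    proof (cases "t = 0")
      case True
      then show ?thesis using sp sT by simp
    next
      case False
      then show ?thesis using sp sx t nonneg by (intro add_nonneg_pos mult_pos_pos mult_nonneg_nonneg) auto
    qed
    then show ?thesis using y sT by (metis zero_less_mult_pos)
  qed
  moreover have "V_h i1 ?y \<le> chi"
  proof -
    have "sinh (T - t) + sinh t \<le> sinh (T - t) * cosh t + cosh (T - t) * sinh t"
      using nonneg cosh_real_ge_1[of t] cosh_real_ge_1[of "T - t"]
        mult_left_mono[of 1 "cosh t" "sinh (T - t)"] mult_right_mono[of 1 "cosh (T - t)" "sinh t"] by simp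
    also have "\<dots> = sinh T" using sinh_add[of "T - t" t] by simp
    finally have "sinh (T - t) + sinh t \<le> sinh T" .
    moreover have "sinh (T - t) * V_h i1 p + sinh t * V_h i1 x \<le> (sinh (T - t) + sinh t) * chi"
      using nonneg sp sx by (auto simp: distrib_right intro!: add_mono mult_left_mono)
    ultimately have "sinh T * V_h i1 ?y \<le> sinh T * chi"
      unfolding y using chi_pos by (meson mult_right_mono less_imp_le order_trans)
    then show ?thesis using sT by simp
  qed
  ultimately show ?thesis by (simp add: M_iff)
qed

text \<open>For the geodesic from \<open>p\<close> to \<open>x\<close> one has \<open>cosh T = - \<langle>p,x\<rangle>\<close> and \<open>sinh T v = x + \<langle>p,x\<rangle> p\<close>, so the
  formula along geodesics is linear in \<open>x\<close>.\<close>

lemma hessian_eq_metric_imp_linear: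
  assumes V: "smooth_map M V"
    and H: "\<And>p u v. p \<in> M \<Longrightarrow> lorentz p u = 0 \<Longrightarrow> lorentz p v = 0 \<Longrightarrow>
      hessian M hyp_metric V p u v = V p * lorentz u v"
    and p: "p \<in> M"
  obtains l where "linear l" "\<And>x. x \<in> M \<Longrightarrow> V x = l x"
proof
  let ?d = "dir_deriv M V p"
  define l where "l x = - lorentz p x * V p + ?d (x + lorentz p x *\<^sub>R p)" for x
  have d: "linear ?d" by (rule linear_dir_deriv[OF V p])
  show "linear l"
    by (rule linearI)
      (simp_all add: l_def lorentz_simps linear_add[OF d] linear_scale[OF d] algebra_simps)
  fix x assume x: "x \<in> M"
  show "V x = l x"
  proof (cases "x = p")
    case True
    then show ?thesis using lorentz_self[OF p] linear_0[OF d] by (simp add: l_def)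
  next
    case False
    obtain T v where T: "T > 0" "lorentz p v = 0" "lorentz v v = 1" "x = cosh T *\<^sub>R p + sinh T *\<^sub>R v"
      by (rule hyperboloid_geodesic[OF M_hyperboloid[OF p] M_hyperboloid[OF x] False]) (rule that)
    have "V x = cosh T * V p + sinh T * ?d v"
      unfolding T(4)
      by (rule hessian_eq_metric_along_geodesic[OF V H T(2,3)])
        (use geodesically_convex_M[OF p x T(2,3,1,4)] T(1) in auto)
    moreover have "lorentz p x = - cosh T"
      using T(2) lorentz_self[OF p] by (simp add: T(4) lorentz_simps)
    moreover from this have "x + lorentz p x *\<^sub>R p = sinh T *\<^sub>R v" by (simp add: T(4))
    ultimately show ?thesis by (simp add: l_def linear_scale[OF d])
  qed
qed

section \<open>The static potentials\<close>

abbreviation horo_potential :: "('n minkowski \<Rightarrow> real) \<Rightarrow> bool" where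
  "horo_potential \<equiv> static_potential CARD('n) M hyp_metric S
     (- (real CARD('n) * (real CARD('n) - 1) / 2)) (real CARD('n) - 1)"

abbreviation horo_potential_space :: "('n minkowski \<Rightarrow> real) set" where
  "horo_potential_space \<equiv> static_potential_space CARD('n) M hyp_metric S
     (- (real CARD('n) * (real CARD('n) - 1) / 2)) (real CARD('n) - 1)"

text \<open>With \<open>\<Lambda> = -n\<close> and \<open>Ric = -(n-1) g\<close> the tensor equation becomes \<open>Hess V = V g\<close>, whose trace is
  the scalar equation. The boundary is umbilic with \<open>\<pi> = g\<close>, as \<open>\<lambda> = 1\<close> requires.\<close>

lemma static_potential_iff:
  assumes n: "CARD('n) \<ge> 2"
  shows "horo_potential V \<longleftrightarrow>
    smooth_map M V \<and> (\<exists>p\<in>M. V p \<noteq> 0) \<and>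
    (\<forall>p\<in>M. \<forall>u v. lorentz p u = 0 \<longrightarrow> lorentz p v = 0 \<longrightarrow> hessian M hyp_metric V p u v = V p * lorentz u v) \<and>
    (\<forall>p\<in>S. dir_deriv M V p (horo_normal i1 p) = V p)"
proof -
  have n1: "real CARD('n) - 1 \<noteq> 0" using n by simp
  have L: "2 / (real CARD('n) - 1) * (- (real CARD('n) * (real CARD('n) - 1) / 2)) = - real CARD('n)" using n1 by (simp add: field_simps)
  have l: "1 / (real CARD('n) - 1) * (real CARD('n) - 1) = 1" using n1 by simp
  have eq: "hessian M hyp_metric V p u v + - real CARD('n) * V p * hyp_metric p u v
      - V p * ricci M hyp_metric p u v = hessian M hyp_metric V p u v - V p * lorentz u v"
    if "p \<in> M" "lorentz p u = 0" "lorentz p v = 0" for p u v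
    by (simp add: ricci_eq[OF that] hyp_metric_def algebra_simps)
  have "(\<forall>p\<in>M. \<forall>u\<in>tangent_space M p. \<forall>v\<in>tangent_space M p. hessian M hyp_metric V p u v
        + - real CARD('n) * V p * hyp_metric p u v - V p * ricci M hyp_metric p u v = 0) \<longleftrightarrow>
      (\<forall>p\<in>M. \<forall>u v. lorentz p u = 0 \<longrightarrow> lorentz p v = 0 \<longrightarrow> hessian M hyp_metric V p u v = V p * lorentz u v)"
  proof (intro iffI ballI allI impI)
    fix p u v assume A: "\<forall>p\<in>M. \<forall>u\<in>tangent_space M p. \<forall>v\<in>tangent_space M p. hessian M hyp_metric V p u v
        + - real CARD('n) * V p * hyp_metric p u v - V p * ricci M hyp_metric p u v = 0"
      and p: "p \<in> M" and uv: "lorentz p u = 0" "lorentz p v = 0"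
    then have "hessian M hyp_metric V p u v
        + - real CARD('n) * V p * hyp_metric p u v - V p * ricci M hyp_metric p u v = 0"
      using tangent_iff[OF p] by blast
    then show "hessian M hyp_metric V p u v = V p * lorentz u v"
      unfolding eq[OF p uv] by simp
  next
    fix p u v assume A: "\<forall>p\<in>M. \<forall>u v. lorentz p u = 0 \<longrightarrow> lorentz p v = 0 \<longrightarrow>
        hessian M hyp_metric V p u v = V p * lorentz u v"
      and p: "p \<in> M" and "u \<in> tangent_space M p" "v \<in> tangent_space M p"
    then have uv: "lorentz p u = 0" "lorentz p v = 0" by (simp_all only: tangent_iff[OF p])
    show "hessian M hyp_metric V p u v
        + - real CARD('n) * V p * hyp_metric p u v - V p * ricci M hyp_metric p u v = 0"
    proof -
      have "hessian M hyp_metric V p u v = V p * lorentz u v" using A p uv by blast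
      then show ?thesis unfolding eq[OF p uv] by simp
    qed
  qed
  moreover have "laplacian M hyp_metric V p + - real CARD('n) * V p = 0"
    if "p \<in> M" "\<forall>p\<in>M. \<forall>u v. lorentz p u = 0 \<longrightarrow> lorentz p v = 0 \<longrightarrow>
      hessian M hyp_metric V p u v = V p * lorentz u v" for p
  proof -
    have "laplacian M hyp_metric V p = real CARD('n) * V p"
      by (rule laplacian_eq[OF that(1)]) (use that in blast)
    then show ?thesis by simp
  qed
  moreover have "\<forall>p\<in>S. \<forall>u\<in>tangent_space S p. \<forall>v\<in>tangent_space S p.
      second_fundamental_form M hyp_metric S p u v - 1 * hyp_metric p u v = 0"
    by (simp add: second_fundamental_form_eq hyp_metric_def)
  moreover have "(\<forall>p\<in>S. dir_deriv M V p (outward_normal M hyp_metric S p) - 1 * V p = 0) \<longleftrightarrow>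
      (\<forall>p\<in>S. dir_deriv M V p (horo_normal i1 p) = V p)"
    by (auto simp: outward_normal_eq)
  ultimately show ?thesis
    unfolding static_potential_def Let_def L l by blast
qed

lemma horo_normal_tangent: "p \<in> S \<Longrightarrow> horo_normal i1 p \<in> tangent_space M p"
  using tangent_iff[of p "horo_normal i1 p"] horo_normal(1)[of p i1] M_hyperboloid[of p] S_subset_M by blast

text \<open>This turns the boundary condition for a linear function \<open>l\<close> into \<open>l(N) = 0\<close>.\<close>

lemma dir_deriv_linear_normal:
  assumes l: "linear l" and V: "\<And>q. q \<in> M \<Longrightarrow> V q = l q" and p: "p \<in> S"
  shows "dir_deriv M V p (horo_normal i1 p) = V p - l (null_vec i1) / chi"
proof -
  have bl: "bounded_linear l" using l by (simp add: linear_conv_bounded_linear)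
  have p': "p \<in> M" "V_h i1 p = chi" using p S_subset_M by (auto simp: S_def)
  have "dir_deriv M V p (horo_normal i1 p) = dir_deriv M l p (horo_normal i1 p)"
    by (rule dir_deriv_cong[OF V p'(1)])
  also have "\<dots> = l (horo_normal i1 p)"
    by (rule dir_deriv_eq[OF bounded_linear_imp_has_derivative[OF bl] horo_normal_tangent[OF p]])
  also have "\<dots> = V p - l (null_vec i1) / chi"
    using p'(2) V[OF p'(1)] by (simp add: horo_normal_def linear_diff[OF l] linear_scale[OF l])
  finally show ?thesis .
qed

text \<open>The point of the boundary with \<open>x\<^sub>j = 0\<close> for \<open>j \<noteq> 1\<close>. Together with the boundary points
  \<open>side_point j\<close>, where \<open>x\<^sub>j = 1\<close> for a single \<open>j \<noteq> 1\<close>, it detects all coefficients of a linear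
  combination of the basis functions.\<close>

definition base_point :: "'n minkowski" where
  "base_point = ((chi + 1 / chi) / 2) *\<^sub>R time_vec + ((1 / chi - chi) / 2) *\<^sub>R spatial i1"

lemma base_point_coords:
  "V_h i1 base_point = chi" "j \<noteq> i1 \<Longrightarrow> V_coord j base_point = 0"
  by (simp_all add: base_point_def V_h_def coord_simps field_simps)

lemma base_point_S: "base_point \<in> S"
proof -
  have "V0 base_point + V_coord i1 base_point = 1 / chi"
    by (simp add: base_point_def coord_simps field_simps)
  then have "lorentz base_point base_point = -1"
    unfolding lorentz_self_light_cone[of _ i1] using chi_pos by (simp add: base_point_coords)
  then show ?thesis
    using chi_pos by (simp add: S_def hyperboloid_iff_V_h[of _ i1] base_point_coords)
qed

definition side_point :: "'n \<Rightarrow> 'n minkowski" where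
  "side_point j = horo_curve i1 base_point (spatial j) 1"

lemma side_point:
  assumes "j \<noteq> i1"
  shows "side_point j \<in> S" "k \<noteq> i1 \<Longrightarrow> V_coord k (side_point j) = (if k = j then 1 else 0)"
    "V_h i1 (side_point j) = chi"
proof -
  have b: "base_point \<in> hyperboloid" using base_point_S by (simp add: S_def)
  have h: "V_h i1 (spatial j) = 0" using V_h_spatial[OF assms] .
  show s: "V_h i1 (side_point j) = chi"
    by (simp add: side_point_def V_h_horo_curve h base_point_coords)
  have "side_point j \<in> hyperboloid"
    unfolding side_point_def
    by (rule horo_curve_hyperboloid[OF b])
      (use chi_pos assms in \<open>simp_all add: lorentz_spatial base_point_coords h\<close>)
  then show "side_point j \<in> S" using s by (simp add: S_def)
  show "V_coord k (side_point j) = (if k = j then 1 else 0)" if "k \<noteq> i1"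
    using that by (simp add: side_point_def horo_curve_def coord_simps base_point_coords V_coord_null_vec)
qed

text \<open>These turn out to be the static potentials and \<open>0\<close>.\<close>

definition linear_potentials :: "('n minkowski \<Rightarrow> real) set" where
  "linear_potentials = {restrict_to M l | l. linear l \<and> l (null_vec i1) = 0}"

lemma static_potential_space_eq_linear:
  assumes n: "CARD('n) \<ge> 2"
  shows "horo_potential_space = linear_potentials"
proof (intro subset_antisym subsetI)
  fix V assume "V \<in> horo_potential_space"
  then consider "horo_potential V" "\<And>p. p \<notin> M \<Longrightarrow> V p = 0" | "V = (\<lambda>_. 0)"
    by (auto simp: static_potential_space_def)
  then show "V \<in> linear_potentials"
  proof cases
    case 1
    then have V: "smooth_map M V" "\<And>p u v. p \<in> M \<Longrightarrow> lorentz p u = 0 \<Longrightarrow> lorentz p v = 0 \<Longrightarrow>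
        hessian M hyp_metric V p u v = V p * lorentz u v"
      and normal: "\<And>p. p \<in> S \<Longrightarrow> dir_deriv M V p (horo_normal i1 p) = V p"
      unfolding static_potential_iff[OF n] by blast+
    have b: "base_point \<in> M" using base_point_S S_subset_M by blast
    obtain l where l: "linear l" "\<And>x. x \<in> M \<Longrightarrow> V x = l x"
      by (rule hessian_eq_metric_imp_linear[OF V b]) (assumption | rule that)+
    have "l (null_vec i1) = 0"
      using dir_deriv_linear_normal[OF l base_point_S] normal[OF base_point_S] chi_pos by simp
    moreover have "V = restrict_to M l" using l(2) 1(2) by (auto simp: restrict_to_def)
    ultimately show ?thesis using l(1) by (auto simp: linear_potentials_def)
  next
    case 2
    then have "V = restrict_to M (\<lambda>_. 0)" by (auto simp: restrict_to_def)
    moreover have "linear (\<lambda>_ :: 'n minkowski. 0 :: real)" by (auto simp: linear_iff)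
    ultimately show ?thesis unfolding linear_potentials_def by blast
  qed
next
  fix V assume "V \<in> linear_potentials"
  then obtain l where l: "linear l" "l (null_vec i1) = 0" and V: "V = restrict_to M l"
    by (auto simp: linear_potentials_def)
  have eq: "V q = l q" if "q \<in> M" for q using that by (simp add: V restrict_to_def)
  have out: "V q = 0" if "q \<notin> M" for q using that by (simp add: V restrict_to_def)
  show "V \<in> horo_potential_space"
  proof (cases "\<exists>p\<in>M. V p \<noteq> 0")
    case True
    have "smooth_map M l"
      using l(1) by (intro smooth_map_bounded_linear) (simp add: linear_conv_bounded_linear)
    then have "smooth_map M V" by (rule smooth_map_cong) (simp add: eq)
    moreover have "hessian M hyp_metric V p u v = V p * lorentz u v"
      if "p \<in> M" "lorentz p u = 0" "lorentz p v = 0" for p u v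
      by (rule hessian_linear[OF l(1) eq that])
    moreover have "dir_deriv M V p (horo_normal i1 p) = V p" if "p \<in> S" for p
      using dir_deriv_linear_normal[OF l(1) eq that] l(2) by simp
    ultimately have "horo_potential V"
      unfolding static_potential_iff[OF n] using True by blast
    then show ?thesis using out by (simp add: static_potential_space_def)
  next
    case False
    then have "V = (\<lambda>_. 0)" using out by (intro ext) blast
    then show ?thesis by (simp add: static_potential_space_def)
  qed
qed

definition potential_basis :: "'n \<Rightarrow> 'n minkowski \<Rightarrow> real" where
  "potential_basis j = restrict_to M (if j = i1 then V_h i1 else V_coord j)"

lemma range_potential_basis: "range potential_basis = insert (restrict_to M (V_h i1))
    ((\<lambda>i. restrict_to M (V_coord i)) ` (UNIV - {i1}))"
proof -
  have "range potential_basis = insert (potential_basis i1) (potential_basis ` (UNIV - {i1}))"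
    by (metis UNIV_I image_insert insert_Diff)
  also have "potential_basis ` (UNIV - {i1}) = (\<lambda>i. restrict_to M (V_coord i)) ` (UNIV - {i1})"
    by (intro image_cong) (auto simp: potential_basis_def)
  finally show ?thesis by (simp add: potential_basis_def)
qed

lemma sum_fun_scale_apply: "(\<Sum>j\<in>A. fun_scale (c j) (f j)) x = (\<Sum>j\<in>A. c j * f j x)"
  by (induction A rule: infinite_finite_induct) (auto simp: fun_scale_def)

interpretation fs: vector_space "fun_scale :: real \<Rightarrow> ('n minkowski \<Rightarrow> real) \<Rightarrow> 'n minkowski \<Rightarrow> real"
  by (rule vector_space_fun_scale)

text \<open>Since \<open>N = e\<^sub>0 + e\<^sub>1\<close>, the condition \<open>l(N) = 0\<close> means \<open>l(e\<^sub>1) = - l(e\<^sub>0)\<close>, which joins the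
  first two terms of the coordinate expansion to \<open>l(e\<^sub>0) (x\<^sub>0 - x\<^sub>1)\<close>.\<close>

lemma linear_potential_expansion:
  assumes l: "linear l" "l (null_vec i1) = 0"
  shows "restrict_to M l =
    (\<Sum>j\<in>UNIV. fun_scale (if j = i1 then l time_vec else l (spatial j)) (potential_basis j))"
proof
  fix x :: "'n minkowski"
  have N: "null_vec i1 = time_vec + spatial i1"
    by (simp add: null_vec_def time_vec_def spatial_def)
  then have li: "l (spatial i1) = - l time_vec" using l by (simp add: linear_add[OF l(1)])
  have sum: "(\<Sum>j\<in>UNIV. f j) = f i1 + (\<Sum>j\<in>UNIV - {i1}. f j)" for f :: "'n \<Rightarrow> 'z::comm_monoid_add"
    by (rule sum.remove) auto
  have x: "x = V0 x *\<^sub>R time_vec + (\<Sum>j\<in>UNIV. V_coord j x *\<^sub>R spatial j)"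
  proof (rule minkowski_eqI)
    show "V0 x = V0 (V0 x *\<^sub>R time_vec + (\<Sum>j\<in>UNIV. V_coord j x *\<^sub>R spatial j))"
      by (simp add: coord_simps linear_sum[OF linear_V0])
    show "V_coord k x = V_coord k (V0 x *\<^sub>R time_vec + (\<Sum>j\<in>UNIV. V_coord j x *\<^sub>R spatial j))" for k
      using sum_mult_delta[of UNIV k "\<lambda>j. V_coord j x"]
      by (simp add: coord_simps linear_sum[OF linear_V_coord] eq_commute[of k])
  qed
  have "l x = V0 x * l time_vec + (\<Sum>j\<in>UNIV. V_coord j x * l (spatial j))"
    by (subst x) (simp add: linear_add[OF l(1)] linear_scale[OF l(1)] linear_sum[OF l(1)])
  also have "\<dots> = l time_vec * V_h i1 x + (\<Sum>j\<in>UNIV - {i1}. l (spatial j) * V_coord j x)"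
    unfolding sum li by (simp add: V_h_def algebra_simps)
  finally have lx: "l x = l time_vec * V_h i1 x + (\<Sum>j\<in>UNIV - {i1}. l (spatial j) * V_coord j x)" .
  have "(\<Sum>j\<in>UNIV. fun_scale (if j = i1 then l time_vec else l (spatial j)) (potential_basis j)) x =
      l time_vec * potential_basis i1 x + (\<Sum>j\<in>UNIV - {i1}. l (spatial j) * potential_basis j x)"
    unfolding sum_fun_scale_apply by (subst sum) (auto intro: sum.cong)
  also have "\<dots> = restrict_to M l x"
  proof (cases "x \<in> M")
    case True
    then have "(\<Sum>j\<in>UNIV - {i1}. l (spatial j) * potential_basis j x) =
        (\<Sum>j\<in>UNIV - {i1}. l (spatial j) * V_coord j x)"
      by (intro sum.cong) (auto simp: potential_basis_def restrict_to_def)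
    with True show ?thesis by (simp add: lx potential_basis_def restrict_to_def)
  qed (simp add: potential_basis_def restrict_to_def)
  finally show "restrict_to M l x =
    (\<Sum>j\<in>UNIV. fun_scale (if j = i1 then l time_vec else l (spatial j)) (potential_basis j)) x" ..
qed

lemma span_potential_basis: "fs.span (range potential_basis) = linear_potentials"
proof
  have "fs.subspace linear_potentials"
  proof (rule fs.subspaceI)
    have "(0 :: 'n minkowski \<Rightarrow> real) = restrict_to M (\<lambda>_. 0)" by (auto simp: restrict_to_def)
    moreover have "linear (\<lambda>_ :: 'n minkowski. 0 :: real)" by (auto simp: linear_iff)
    ultimately show "0 \<in> linear_potentials" unfolding linear_potentials_def by blast
  next
    fix f g assume "f \<in> linear_potentials" "g \<in> linear_potentials"
    then obtain k l where kl: "linear k" "linear l" "k (null_vec i1) = 0" "l (null_vec i1) = 0"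
      "f = restrict_to M k" "g = restrict_to M l"
      by (auto simp: linear_potentials_def)
    then have "f + g = restrict_to M (\<lambda>x. k x + l x)" by (auto simp: restrict_to_def)
    with kl show "f + g \<in> linear_potentials"
      unfolding linear_potentials_def using linear_compose_add[OF kl(1,2)] by force
  next
    fix c f assume "f \<in> linear_potentials"
    then obtain l where l: "linear l" "l (null_vec i1) = 0" "f = restrict_to M l"
      by (auto simp: linear_potentials_def)
    then have "fun_scale c f = restrict_to M (\<lambda>x. c *\<^sub>R l x)" by (auto simp: restrict_to_def fun_scale_def)
    with l show "fun_scale c f \<in> linear_potentials"
      unfolding linear_potentials_def using linear_compose_scale_right[OF l(1), of c] by force
  qed
  moreover have "range potential_basis \<subseteq> linear_potentials"
  proof (rule image_subsetI)
    fix j show "potential_basis j \<in> linear_potentials"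
      unfolding linear_potentials_def potential_basis_def
      using linear_V_h linear_V_coord V_coord_null_vec
      by (intro CollectI exI[of _ "if j = i1 then V_h i1 else V_coord j"]) auto
  qed
  ultimately show "fs.span (range potential_basis) \<subseteq> linear_potentials" by (intro fs.span_minimal)
  show "linear_potentials \<subseteq> fs.span (range potential_basis)"
  proof
    fix f assume "f \<in> linear_potentials"
    then obtain l where "linear l" "l (null_vec i1) = 0" and f: "f = restrict_to M l"
      by (auto simp: linear_potentials_def)
    then show "f \<in> fs.span (range potential_basis)"
      unfolding f by (subst linear_potential_expansion)
        (auto intro: fs.span_sum fs.span_scale fs.span_base)
  qed
qed

lemma potential_basis_coefficients_zero:
  assumes "(\<Sum>j\<in>UNIV. fun_scale (c j) (potential_basis j)) = 0"
  shows "c j = 0"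
proof -
  have sum: "(\<Sum>j\<in>UNIV. f j) = f i1 + (\<Sum>j\<in>UNIV - {i1}. f j)" for f :: "'n \<Rightarrow> real"
    by (rule sum.remove) auto
  have zero: "c i1 * V_h i1 x + (\<Sum>j\<in>UNIV - {i1}. c j * V_coord j x) = 0" if "x \<in> S" for x
  proof -
    have "x \<in> M" using that S_subset_M by blast
    have "0 = (\<Sum>j\<in>UNIV. c j * potential_basis j x)"
      using fun_cong[OF assms, of x] by (simp add: sum_fun_scale_apply)
    also have "\<dots> = c i1 * V_h i1 x + (\<Sum>j\<in>UNIV - {i1}. c j * V_coord j x)"
      unfolding sum using \<open>x \<in> M\<close>
      by (intro arg_cong2[where f = "(+)"] sum.cong) (auto simp: potential_basis_def restrict_to_def)
    finally show ?thesis by simp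
  qed
  have 1: "c i1 = 0"
    using zero[OF base_point_S] chi_pos by (simp add: base_point_coords)
  show ?thesis
  proof (cases "j = i1")
    case False
    have "(\<Sum>k\<in>UNIV - {i1}. c k * V_coord k (side_point j)) = (\<Sum>k\<in>UNIV - {i1}. c k * (if k = j then 1 else 0))"
      using side_point(2)[OF False] by (intro sum.cong) auto
    also have "\<dots> = c j" using False by (intro sum_mult_delta) auto
    finally show ?thesis using zero[OF side_point(1)[OF False]] 1 by simp
  qed (use 1 in simp)
qed

lemma inj_potential_basis: "inj potential_basis"
proof (rule injI, rule ccontr)
  fix j k assume jk: "potential_basis j = potential_basis k" "j \<noteq> k"
  define c :: "'n \<Rightarrow> real" where "c i = (if i = j then 1 else 0) - (if i = k then 1 else 0)" for i
  have "(\<Sum>i\<in>UNIV. fun_scale (c i) (potential_basis i)) x = 0" for x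
  proof -
    have "(\<Sum>i\<in>UNIV. c i * potential_basis i x) =
        (\<Sum>i\<in>UNIV. potential_basis i x * (if i = j then 1 else 0)) -
        (\<Sum>i\<in>UNIV. potential_basis i x * (if i = k then 1 else 0))"
      unfolding sum_subtractf[symmetric] by (intro sum.cong) (auto simp: c_def)
    also have "\<dots> = 0" using jk(1) by (simp only: sum_mult_delta finite UNIV_I)
    finally show ?thesis by (simp add: sum_fun_scale_apply)
  qed
  then have "c j = 0" by (intro potential_basis_coefficients_zero) auto
  then show False using jk(2) by (simp add: c_def)
qed

lemma independent_potential_basis: "fs.independent (range potential_basis)"
proof (rule fs.independent_if_scalars_zero)
  fix c f assume *: "(\<Sum>f\<in>range potential_basis. fun_scale (c f) f) = 0" and "f \<in> range potential_basis"
  then obtain j where j: "f = potential_basis j" by auto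
  have "(\<Sum>j\<in>UNIV. fun_scale (c (potential_basis j)) (potential_basis j)) = 0"
    using * by (simp add: sum.reindex[OF inj_potential_basis])
  then show "c f = 0" unfolding j by (rule potential_basis_coefficients_zero)
qed simp

lemma dim_linear_potentials: "fs.dim linear_potentials = CARD('n)"
  using fs.dim_span_eq_card_independent[OF independent_potential_basis]
  by (simp add: span_potential_basis card_image[OF inj_potential_basis])

lemma static_potential_V_h:
  assumes n: "CARD('n) \<ge> 2"
  shows "horo_potential (restrict_to M (V_h i1))"
proof -
  have "restrict_to M (V_h i1) \<in> linear_potentials"
    unfolding linear_potentials_def using linear_V_h by force
  then have "restrict_to M (V_h i1) \<in> horo_potential_space"
    by (simp add: static_potential_space_eq_linear[OF n])
  moreover have "restrict_to M (V_h i1) base_point \<noteq> 0"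
    using base_point_S S_subset_M chi_pos by (auto simp: restrict_to_def base_point_coords)
  ultimately show ?thesis by (auto simp: static_potential_space_def)
qed

end

theorem proposition5p1:
  fixes i1 :: "'n::finite" and chi :: real
  assumes "CARD('n) \<ge> 2" and "chi > 0"
  shows
    "static_manifold_with_boundary CARD('n)
       (hyp_horo_domain i1 chi) hyp_metric (hyp_horo_boundary i1 chi)
       (- (real CARD('n) * (real CARD('n) - 1) / 2)) (real CARD('n) - 1)
    \<and> horosphere (hyp_horo_boundary i1 chi)
    \<and> vector_space.dim fun_scale
       (static_potential_space CARD('n)
         (hyp_horo_domain i1 chi) hyp_metric (hyp_horo_boundary i1 chi)
         (- (real CARD('n) * (real CARD('n) - 1) / 2)) (real CARD('n) - 1)) = CARD('n)
    \<and> module.span fun_scale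
       (insert (restrict_to (hyp_horo_domain i1 chi) (V_h i1))
         ((\<lambda>i. restrict_to (hyp_horo_domain i1 chi) (V_coord i)) ` (UNIV - {i1}))) =
     static_potential_space CARD('n)
       (hyp_horo_domain i1 chi) hyp_metric (hyp_horo_boundary i1 chi)
       (- (real CARD('n) * (real CARD('n) - 1) / 2)) (real CARD('n) - 1)"
proof -
  interpret horo_domain i1 chi by unfold_locales (rule assms)
  show ?thesis
    unfolding hyp_horo_boundary_eq static_potential_space_eq_linear[OF assms(1)]
      range_potential_basis[symmetric] span_potential_basis dim_linear_potentials
      static_manifold_with_boundary_def
    using manifold_with_boundary_M riemannian_metric mfd_boundary_M horosphere_S
      static_potential_V_h[OF assms(1)] by auto
qed

end
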